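(* There exists $K\in\mathbb{N}$ such that for every $k\ge K$, setting $C_k:=(k)_2^2\,2^{\binom k2-1}$, the density threshold of the extremist rule of order $k$ satisfies $\theta(k)\le\frac12-\frac{(k)_2}{2\cdot10^5C_k}$.
   Context: Let $(\Omega,\pi)$ be an atomless probability space with separable $\sigma$-algebra. A kernel is a bounded symmetric measurable $W:\Omega^2\to\mathbb{R}$; $\mathcal{W}$ is the Banach space of kernels with $\|\cdot\|_\infty$; graphons are kernels with values in $[0,1]$; $\mathcal{W}_0$ is the set of graphons; $0$ denotes the constant-$0$ graphon; $\|W\|_1=\int|W|\,d\pi^2$; $d_\square(U,W)=\sup_{S,T\subseteq\Omega}|\int_{S\times T}(U-W)\,d\pi^2|$; $(k)_2=k(k-1)$. $\mathcal{H}_k$ is the set of graphs on $[k]$. A rule of order $k$ is a matrix $\mathcal{R}\in[0,1]^{\mathcal{H}_k\times\mathcal{H}_k}$ with row sums $1$. For a kernel $W$, $F\in\mathcal{H}_k$, distinct $a,b$, $x,y$: $t^{x,y}_{\mathrm{ind}}(F^{a,b},W)=\int\prod_{ij\in E(F)}W(x_i,x_j)\prod_{ij\notin E(F)}(1-W(x_i,x_j))\prod_{i\ne a,b}d\pi(x_i)$ with $x_a=x,x_b=y$. Velocity: $\mathfrak{V}_{\mathcal{R}}W(x,y)=\sum_{F,H}\sum_{a\ne b}\mathcal{R}_{F,H}t^{x,y}_{\mathrm{ind}}(F^{a,b},W)(\mathbb{1}[ab\in E(H)\setminus E(F)]-\mathbb{1}[ab\in E(F)\setminus E(H)])$. For a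 graphon $W$, the trajectory $t\mapsto\Phi^tW$, $t\ge0$, is the unique solution of $\frac{d}{dt}\Phi^tW=\mathfrak{V}_{\mathcal{R}}(\Phi^tW)$ in $(\mathcal{W},\|\cdot\|_\infty)$, $\Phi^0W=W$; $\mathrm{dest}(W)$ is the graphon $S$ (if it exists) with $d_\square(\Phi^tW,S)\to0$. The extremist rule of order $k$: $\mathcal{R}_{F,\overline{K_k}}=1$ if $e(F)<\frac12\binom k2$; $\mathcal{R}_{F,K_k}=1$ if $e(F)>\frac12\binom k2$; $\mathcal{R}_{F,F}=1$ if $e(F)=\frac12\binom k2$; other entries $0$. Density threshold: $\theta(k):=\sup\{p\in[0,1]:\forall W\in\mathcal{W}_0,\ \|W\|_1\le p\Rightarrow\mathrm{dest}(W)=0\}$. *)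

theory Defs
  imports "HOL-Probability.Probability"
begin

definition atomless :: "'a measure \<Rightarrow> bool" where
  "atomless M \<longleftrightarrow> (\<forall>A\<in>sets M. emeasure M A > 0 \<longrightarrow>
     (\<exists>B\<in>sets M. B \<subseteq> A \<and> 0 < emeasure M B \<and> emeasure M B < emeasure M A))"

text \<open>Separability of the \<open>\<sigma>\<close>-algebra for the pseudometric \<open>(A, B) \<mapsto> \<pi>(A \<triangle> B)\<close>;
  every countably generated \<open>\<sigma>\<close>-algebra has this property.\<close>

definition separable_sigma_algebra :: "'a measure \<Rightarrow> bool" where
  "separable_sigma_algebra M \<longleftrightarrow> (\<exists>D. countable D \<and> D \<subseteq> sets M \<and>
     (\<forall>A\<in>sets M. \<forall>\<epsilon>>0. \<exists>B\<in>D. measure M ((A - B) \<union> (B - A)) < \<epsilon>))"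


section \<open>Kernels and graphons\<close>

definition kernel :: "'a measure \<Rightarrow> ('a \<Rightarrow> 'a \<Rightarrow> real) \<Rightarrow> bool" where
  "kernel M W \<longleftrightarrow>
     (\<lambda>(x, y). W x y) \<in> borel_measurable (M \<Otimes>\<^sub>M M) \<and>
     (\<forall>x\<in>space M. \<forall>y\<in>space M. W x y = W y x) \<and>
     (\<exists>B. \<forall>x\<in>space M. \<forall>y\<in>space M. \<bar>W x y\<bar> \<le> B)"

definition graphon :: "'a measure \<Rightarrow> ('a \<Rightarrow> 'a \<Rightarrow> real) \<Rightarrow> bool" where
  "graphon M W \<longleftrightarrow> kernel M W \<and> (\<forall>x\<in>space M. \<forall>y\<in>space M. 0 \<le> W x y \<and> W x y \<le> 1)"

definition Linf_norm :: "'a measure \<Rightarrow> ('a \<Rightarrow> 'a \<Rightarrow> real) \<Rightarrow> ereal" where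
  "Linf_norm M W = esssup (M \<Otimes>\<^sub>M M) (\<lambda>(x, y). ereal \<bar>W x y\<bar>)"

definition L1_norm :: "'a measure \<Rightarrow> ('a \<Rightarrow> 'a \<Rightarrow> real) \<Rightarrow> real" where
  "L1_norm M W = (\<integral>(x, y). \<bar>W x y\<bar> \<partial>(M \<Otimes>\<^sub>M M))"

definition cut_dist :: "'a measure \<Rightarrow> ('a \<Rightarrow> 'a \<Rightarrow> real) \<Rightarrow> ('a \<Rightarrow> 'a \<Rightarrow> real) \<Rightarrow> real" where
  "cut_dist M U W = (SUP (S, T)\<in>sets M \<times> sets M.
     \<bar>set_lebesgue_integral (M \<Otimes>\<^sub>M M) (S \<times> T) (\<lambda>(x, y). U x y - W x y)\<bar>)"


section \<open>Graphs on \<open>[k]\<close> and rules\<close>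

text \<open>A graph on the vertex set \<open>[k] = {1..k}\<close> is identified with its edge set.\<close>

definition complete_on :: "nat \<Rightarrow> nat set set" where
  "complete_on k = {e. e \<subseteq> {1..k} \<and> card e = 2}"

definition graphs :: "nat \<Rightarrow> nat set set set" where
  "graphs k = Pow (complete_on k)"

definition is_rule :: "nat \<Rightarrow> (nat set set \<Rightarrow> nat set set \<Rightarrow> real) \<Rightarrow> bool" where
  "is_rule k R \<longleftrightarrow>
     (\<forall>F\<in>graphs k. (\<forall>H\<in>graphs k. 0 \<le> R F H \<and> R F H \<le> 1) \<and> (\<Sum>H\<in>graphs k. R F H) = 1)"

definition extremist_rule :: "nat \<Rightarrow> nat set set \<Rightarrow> nat set set \<Rightarrow> real" where
  "extremist_rule k F H =
     (if real (card F) < 1/2 * real (k choose 2) then (if H = {} then 1 else 0)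
      else if real (card F) > 1/2 * real (k choose 2) then (if H = complete_on k then 1 else 0)
      else (if H = F then 1 else 0))"

lemma is_rule_extremist_rule: "is_rule k (extremist_rule k)"
proof -
  have "finite (graphs k)"
    unfolding graphs_def complete_on_def by simp
  moreover have "{} \<in> graphs k" "complete_on k \<in> graphs k"
    unfolding graphs_def by auto
  ultimately have "(\<Sum>H\<in>graphs k. extremist_rule k F H) = 1" if "F \<in> graphs k" for F
    using that unfolding extremist_rule_def
    by (cases "real (card F) < 1/2 * real (k choose 2)";
        cases "real (card F) > 1/2 * real (k choose 2)") (simp_all only: if_True if_False sum.delta)
  then show ?thesis
    unfolding is_rule_def by (auto simp: extremist_rule_def)
qed


section \<open>Velocity, trajectories and destinations\<close>

text \<open>The rooted induced density: the roots \<open>a\<close> and \<open>b\<close> are mapped to \<open>x\<close> and \<open>y\<close>, the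
  remaining vertices are integrated out. Each unordered pair of vertices is taken once, as \<open>i < j\<close>.\<close>

definition t_ind :: "'a measure \<Rightarrow> nat \<Rightarrow> nat set set \<Rightarrow> nat \<Rightarrow> nat \<Rightarrow>
    ('a \<Rightarrow> 'a \<Rightarrow> real) \<Rightarrow> 'a \<Rightarrow> 'a \<Rightarrow> real" where
  "t_ind M k F a b W x y =
     (\<integral>\<omega>. (let z = fun_upd (fun_upd \<omega> a x) b y in
          (\<Prod>(i, j)\<in>{(i, j). i \<in> {1..k} \<and> j \<in> {1..k} \<and> i < j \<and> {i, j} \<in> F}. W (z i) (z j)) *
          (\<Prod>(i, j)\<in>{(i, j). i \<in> {1..k} \<and> j \<in> {1..k} \<and> i < j \<and> {i, j} \<notin> F}. 1 - W (z i) (z j)))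
      \<partial>(Pi\<^sub>M ({1..k} - {a, b}) (\<lambda>_. M)))"

definition velocity :: "'a measure \<Rightarrow> nat \<Rightarrow> (nat set set \<Rightarrow> nat set set \<Rightarrow> real) \<Rightarrow>
    ('a \<Rightarrow> 'a \<Rightarrow> real) \<Rightarrow> 'a \<Rightarrow> 'a \<Rightarrow> real" where
  "velocity M k R W x y =
     (\<Sum>F\<in>graphs k. \<Sum>H\<in>graphs k. \<Sum>a\<in>{1..k}. \<Sum>b\<in>{1..k} - {a}.
        R F H * t_ind M k F a b W x y * (of_bool ({a, b} \<in> H - F) - of_bool ({a, b} \<in> F - H)))"

text \<open>\<open>is_trajectory M k R W \<Phi>\<close>: the map \<open>t \<mapsto> \<Phi> t\<close>, for \<open>t \<ge> 0\<close>, solves the initial value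
  problem in the space of kernels with the \<open>L\<^sup>\<infinity>\<close> norm (derivatives at \<open>0\<close> are one-sided).
  Kernels are represented by functions, so equality in that space is equality almost everywhere.\<close>

definition is_trajectory :: "'a measure \<Rightarrow> nat \<Rightarrow> (nat set set \<Rightarrow> nat set set \<Rightarrow> real) \<Rightarrow>
    ('a \<Rightarrow> 'a \<Rightarrow> real) \<Rightarrow> (real \<Rightarrow> 'a \<Rightarrow> 'a \<Rightarrow> real) \<Rightarrow> bool" where
  "is_trajectory M k R W \<Phi> \<longleftrightarrow>
     (\<forall>t\<ge>0. kernel M (\<Phi> t)) \<and>
     (AE (x, y) in M \<Otimes>\<^sub>M M. \<Phi> 0 x y = W x y) \<and>
     (\<forall>t\<ge>0. ((\<lambda>s. Linf_norm M (\<lambda>x y. (\<Phi> s x y - \<Phi> t x y) / (s - t) - velocity M k R (\<Phi> t) x y))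
        \<longlongrightarrow> 0) (at t within {0..}))"

text \<open>\<open>is_dest M k R W S\<close> says that the destination of \<open>W\<close> exists and equals \<open>S\<close>. The
  trajectory of a graphon is unique up to null sets, on which the cut distance does not depend.\<close>

definition is_dest :: "'a measure \<Rightarrow> nat \<Rightarrow> (nat set set \<Rightarrow> nat set set \<Rightarrow> real) \<Rightarrow>
    ('a \<Rightarrow> 'a \<Rightarrow> real) \<Rightarrow> ('a \<Rightarrow> 'a \<Rightarrow> real) \<Rightarrow> bool" where
  "is_dest M k R W S \<longleftrightarrow> graphon M S \<and>
     (\<exists>\<Phi>. is_trajectory M k R W \<Phi> \<and> ((\<lambda>t. cut_dist M (\<Phi> t) S) \<longlongrightarrow> 0) at_top)"

definition density_threshold :: "'a measure \<Rightarrow> nat \<Rightarrow> real" where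
  "density_threshold M k = Sup {p. 0 \<le> p \<and> p \<le> 1 \<and>
     (\<forall>W. graphon M W \<and> L1_norm M W \<le> p \<longrightarrow> is_dest M k (extremist_rule k) W (\<lambda>_ _. 0))}"

definition falling2 :: "nat \<Rightarrow> real" where
  "falling2 k = real k * (real k - 1)"

end

theory Submission
  imports Defs
begin

text \<open>Split \<open>\<Omega>\<close> into halves and let \<open>W\<close> be the complete bipartite graphon between them, which has
  density \<open>1/2\<close>. A sample with \<open>X\<close> vertices in one half has \<open>X (k - X)\<close> edges, which exceeds
  \<open>(k choose 2) / 2\<close> exactly if \<open>(2 X - k)\<^sup>2 < k\<close>; by the central limit theorem this event has
  probability close to \<open>P(\<bar>N(0,1)\<bar> < 1) > 1/2\<close>, so the density of \<open>W\<close> moves upwards at a rate of order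
  \<open>k\<^sup>2\<close>. The velocity functional is Lipschitz with a constant polynomial in \<open>k\<close>, so a trajectory that
  starts from \<open>(1 - 2 \<delta>) W\<close>, of density \<open>1/2 - \<delta>\<close> with \<open>\<delta>\<close> exponentially small, reaches density
  \<open>1/2 + \<delta>\<close>. The rule is invariant under complementation: if every graphon of density at most
  \<open>1/2 - \<delta>\<close> converged to \<open>0\<close>, every graphon of density at least \<open>1/2 + \<delta>\<close> would converge to \<open>1\<close>,
  and uniqueness of trajectories gives a contradiction.

  That trajectories stay in \<open>[0,1]\<close> and are unique follows from Gronwall's inequality for
  \<open>\<integral> dist(\<Phi>\<^sup>t, [0,1])\<^sup>2\<close> and \<open>\<integral> (\<Phi>\<^sup>t - \<Psi>\<^sup>t)\<^sup>2\<close>.\<close>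

section \<open>Sampled graphs and the extremist drift\<close>

text \<open>With N = \<open>k choose 2\<close>, a sample with e edges contributes 2 (N - e) to the
  velocity, summed over ordered pairs, if e exceeds N / 2, and at least -2 e otherwise. A bipartite
  sample has e at most k^2 / 4, so the mean velocity is at least 2 N q - k^2 / 2, where q is the
  probability of passing the threshold. This is roughly k^2 (q - 1/2), so q has to be bounded away
  from 1/2; Chebyshev says nothing at one standard deviation, hence the central limit theorem.

  No existence theorem for trajectories is proved: the assumption to be refuted supplies a
  trajectory for every graphon of density at most p, because \<open>is_dest\<close> contains one.
  Such a curve comes without a priori bounds. It consists of kernels that may leave [0,1] and are
  determined only up to null sets. The estimates therefore work with almost everywhere bounds |u| +
  |1 - u| \<le> B, and every velocity integral is rewritten over one tuple of k independent points.
  There the sum over all 2^N graphs is controlled in total variation; for B = 1 this yields a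
  Lipschitz constant of order k^4. The argument could cross a gap of order 1 / k^4, and the gap of
  the theorem is far smaller.\<close>

definition sample_weight :: "'e set \<Rightarrow> 'e set \<Rightarrow> ('e \<Rightarrow> real) \<Rightarrow> real" where
  "sample_weight E F u = (\<Prod>e\<in>E. if e \<in> F then u e else 1 - u e)"

lemma sample_weight_insert:
  assumes "finite E" "e \<notin> E" "F \<subseteq> E"
  shows "sample_weight (insert e E) F u = (1 - u e) * sample_weight E F u"
    and "sample_weight (insert e E) (insert e F) u = u e * sample_weight E F u"
proof -
  have "e \<notin> F" using assms by auto
  then show "sample_weight (insert e E) F u = (1 - u e) * sample_weight E F u"
    using assms by (simp add: sample_weight_def)
  have "(\<Prod>x\<in>E. if x \<in> insert e F then u x else 1 - u x) = (\<Prod>x\<in>E. if x \<in> F then u x else 1 - u x)"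
    using assms by (intro prod.cong) auto
  then show "sample_weight (insert e E) (insert e F) u = u e * sample_weight E F u"
    using assms by (simp add: sample_weight_def)
qed

lemma sum_Pow_insert:
  fixes f :: "'e set \<Rightarrow> real"
  assumes "finite E" "e \<notin> E"
  shows "(\<Sum>F\<in>Pow (insert e E). f F) = (\<Sum>F\<in>Pow E. f F + f (insert e F))"
proof -
  have "inj_on (insert e) (Pow E)"
    using assms by (auto intro!: inj_onI dest: insert_ident[THEN iffD1, rotated 2])
  moreover have "Pow E \<inter> insert e ` Pow E = {}"
    using assms by auto
  ultimately show ?thesis
    using assms by (simp add: Pow_insert sum.union_disjoint sum.reindex sum.distrib)
qed

text \<open>The sum factors over the edges into terms |u e| + |1 - u e|. Such a term is at most 1
  exactly if u e lies in [0,1], where the weights are probabilities; a larger B covers kernels not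
  yet known to be [0,1]-valued, whose weights are signed.\<close>

lemma sum_abs_sample_weight_le:
  assumes "finite E" "\<And>e. e \<in> E \<Longrightarrow> \<bar>u e\<bar> + \<bar>1 - u e\<bar> \<le> B" "B \<ge> 1"
  shows "(\<Sum>F\<in>Pow E. \<bar>sample_weight E F u\<bar>) \<le> B ^ card E"
  using assms(1,2)
proof (induction E rule: finite_induct)
  case empty
  then show ?case by (simp add: sample_weight_def)
next
  case (insert e E)
  have "(\<Sum>F\<in>Pow (insert e E). \<bar>sample_weight (insert e E) F u\<bar>)
      = (\<Sum>F\<in>Pow E. (\<bar>u e\<bar> + \<bar>1 - u e\<bar>) * \<bar>sample_weight E F u\<bar>)"
    unfolding sum_Pow_insert[OF insert.hyps]
    by (intro sum.cong refl)
       (auto simp: sample_weight_insert[OF insert.hyps] abs_mult distrib_right)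
  also have "\<dots> = (\<bar>u e\<bar> + \<bar>1 - u e\<bar>) * (\<Sum>F\<in>Pow E. \<bar>sample_weight E F u\<bar>)"
    by (simp add: sum_distrib_left)
  also have "\<dots> \<le> B * B ^ card E"
    using insert assms(3) by (intro mult_mono) (auto intro!: sum_nonneg)
  finally show ?case using insert.hyps by simp
qed

text \<open>For \<open>B = 1\<close> this bounds the total variation distance of two product Bernoulli measures; the
  point is that the bound does not grow with the number of graphs.\<close>

lemma sum_abs_diff_sample_weight_le:
  assumes "finite E" "B \<ge> 1"
    and "\<And>e. e \<in> E \<Longrightarrow> \<bar>u e\<bar> + \<bar>1 - u e\<bar> \<le> B" "\<And>e. e \<in> E \<Longrightarrow> \<bar>v e\<bar> + \<bar>1 - v e\<bar> \<le> B"
  shows "(\<Sum>F\<in>Pow E. \<bar>sample_weight E F u - sample_weight E F v\<bar>) \<le> 2 * B ^ card E * (\<Sum>e\<in>E. \<bar>u e - v e\<bar>)"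
  using assms(1,3,4)
proof (induction E rule: finite_induct)
  case empty
  then show ?case by (simp add: sample_weight_def)
next
  case (insert e E)
  let ?w = "\<lambda>F u. sample_weight E F u"
  have pointwise: "\<bar>sample_weight (insert e E) F u - sample_weight (insert e E) F v\<bar>
     + \<bar>sample_weight (insert e E) (insert e F) u - sample_weight (insert e E) (insert e F) v\<bar>
     \<le> (\<bar>u e\<bar> + \<bar>1 - u e\<bar>) * \<bar>?w F u - ?w F v\<bar> + 2 * \<bar>u e - v e\<bar> * \<bar>?w F v\<bar>"
    if "F \<in> Pow E" for F
  proof -
    have F: "F \<subseteq> E" using that by simp
    have "\<bar>(1 - u e) * ?w F u - (1 - v e) * ?w F v\<bar>
        = \<bar>(1 - u e) * (?w F u - ?w F v) + (v e - u e) * ?w F v\<bar>"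
      by (simp add: algebra_simps)
    also have "\<dots> \<le> \<bar>1 - u e\<bar> * \<bar>?w F u - ?w F v\<bar> + \<bar>u e - v e\<bar> * \<bar>?w F v\<bar>"
      by (metis abs_minus_commute abs_mult abs_triangle_ineq)
    finally have 1: "\<bar>(1 - u e) * ?w F u - (1 - v e) * ?w F v\<bar> \<le> \<dots>" .
    have "\<bar>u e * ?w F u - v e * ?w F v\<bar> = \<bar>u e * (?w F u - ?w F v) + (u e - v e) * ?w F v\<bar>"
      by (simp add: algebra_simps)
    also have "\<dots> \<le> \<bar>u e\<bar> * \<bar>?w F u - ?w F v\<bar> + \<bar>u e - v e\<bar> * \<bar>?w F v\<bar>"
      by (metis abs_mult abs_triangle_ineq)
    finally have 2: "\<bar>u e * ?w F u - v e * ?w F v\<bar> \<le> \<dots>" .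
    show ?thesis
      unfolding sample_weight_insert[OF insert.hyps F] using 1 2 by (simp add: algebra_simps)
  qed
  have "(\<Sum>F\<in>Pow (insert e E). \<bar>sample_weight (insert e E) F u - sample_weight (insert e E) F v\<bar>)
      \<le> (\<Sum>F\<in>Pow E. (\<bar>u e\<bar> + \<bar>1 - u e\<bar>) * \<bar>?w F u - ?w F v\<bar> + 2 * \<bar>u e - v e\<bar> * \<bar>?w F v\<bar>)"
    unfolding sum_Pow_insert[OF insert.hyps] by (intro sum_mono pointwise)
  also have "\<dots> = (\<bar>u e\<bar> + \<bar>1 - u e\<bar>) * (\<Sum>F\<in>Pow E. \<bar>?w F u - ?w F v\<bar>)
      + 2 * \<bar>u e - v e\<bar> * (\<Sum>F\<in>Pow E. \<bar>?w F v\<bar>)"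
    by (simp add: sum.distrib sum_distrib_left)
  \<comment> \<open>The second sum is given a spare factor B \<ge> 1, so that both terms carry the
    power \<open>B ^ card (insert e E)\<close>.\<close>
  also have "\<dots> \<le> B * (2 * B ^ card E * (\<Sum>e\<in>E. \<bar>u e - v e\<bar>)) + 2 * \<bar>u e - v e\<bar> * (B * B ^ card E)"
  proof (intro add_mono mult_mono)
    show "(\<Sum>F\<in>Pow E. \<bar>?w F v\<bar>) \<le> B * B ^ card E"
      using sum_abs_sample_weight_le[OF insert.hyps(1) _ assms(2), of v] insert.prems assms(2)
      by (smt (verit) insertCI mult_right_mono one_le_power mult_cancel_right1)
  qed (use insert assms(2) in \<open>auto intro!: sum_nonneg\<close>)
  also have "\<dots> = 2 * B ^ card (insert e E) * (\<Sum>e\<in>insert e E. \<bar>u e - v e\<bar>)"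
    using insert.hyps by (simp add: algebra_simps)
  finally show ?case .
qed

lemma sample_weight_complement:
  "sample_weight E F (\<lambda>e. 1 - u e) = sample_weight E (E - F) u"
  unfolding sample_weight_def by (intro prod.cong) auto

text \<open>Edge probabilities 0 and 1 make the sampled graph deterministic. This is the situation
  of a bipartite graphon once the sample points are fixed.\<close>

lemma sample_weight_of_bool:
  assumes "finite E" "F \<subseteq> E" "G \<subseteq> E"
  shows "sample_weight E F (\<lambda>e. of_bool (e \<in> G)) = of_bool (F = G)"
proof (cases "F = G")
  case True
  then show ?thesis unfolding sample_weight_def by (auto intro!: prod.neutral)
next
  case False
  then obtain e where "e \<in> E" "(e \<in> F) \<noteq> (e \<in> G)" using assms by blast
  then show ?thesis
    using assms False unfolding sample_weight_def by (auto intro!: prod_zero bexI[of _ e])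
qed

section \<open>Edge sets on the vertices 1 to k\<close>

lemma finite_complete_on: "finite (complete_on k)"
  unfolding complete_on_def by simp

lemma card_complete_on: "card (complete_on k) = k choose 2"
  unfolding complete_on_def using n_subsets[of "{1..k}" 2] by simp

lemma finite_graphs: "finite (graphs k)"
  unfolding graphs_def using finite_complete_on by simp

lemma doubleton_in_complete_on:
  "a \<in> {1..k} \<Longrightarrow> b \<in> {1..k} - {a} \<Longrightarrow> {a, b} \<in> complete_on k"
  unfolding complete_on_def by auto

lemma complete_onE:
  assumes "e \<in> complete_on k"
  obtains i j where "e = {i, j}" "i < j" "i \<in> {1..k}" "j \<in> {1..k}"
proof -
  obtain i j where "e = {i, j}" "i \<noteq> j" "i \<in> {1..k}" "j \<in> {1..k}"
    using assms unfolding complete_on_def card_2_iff by auto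
  then show thesis
    using that[of i j] that[of j i] by (cases i j rule: linorder_cases) (auto simp: insert_commute)
qed

lemma Min_Max_complete_on:
  assumes "e \<in> complete_on k"
  shows "Min e \<in> {1..k}" "Max e \<in> {1..k}" "Min e \<noteq> Max e" "{Min e, Max e} = e"
  using assms by (auto elim!: complete_onE)

text \<open>A kernel is symmetric only on \<open>space M\<close>, so the value on an edge is read
  off in the order Min, Max. This agrees with the convention i < j in \<open>t_ind\<close>.\<close>

definition edge_value :: "('a \<Rightarrow> 'a \<Rightarrow> real) \<Rightarrow> (nat \<Rightarrow> 'a) \<Rightarrow> nat set \<Rightarrow> real" where
  "edge_value W z e = W (z (Min e)) (z (Max e))"

abbreviation induced_weight :: "nat \<Rightarrow> nat set set \<Rightarrow> ('a \<Rightarrow> 'a \<Rightarrow> real) \<Rightarrow> (nat \<Rightarrow> 'a) \<Rightarrow> real" where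
  "induced_weight k F W z \<equiv> sample_weight (complete_on k) F (edge_value W z)"

text \<open>Pairs i < j correspond bijectively to two-element sets, which merges the products over
  edges and non-edges into one product over \<open>complete_on k\<close>.\<close>

lemma t_ind_eq:
  "t_ind M k F a b W x y
    = (\<integral>\<omega>. induced_weight k F W (fun_upd (fun_upd \<omega> a x) b y) \<partial>(Pi\<^sub>M ({1..k} - {a, b}) (\<lambda>_. M)))"
proof -
  let ?P = "{(i, j). i \<in> {1..k} \<and> j \<in> {1..k} \<and> i < j}"
  have fin: "finite ?P" by (rule finite_subset[of _ "{1..k} \<times> {1..k}"]) auto
  have bij: "bij_betw (\<lambda>(i, j). {i, j}) ?P (complete_on k)"
  proof (rule bij_betw_imageI)
    show "inj_on (\<lambda>(i, j). {i, j}) ?P" by (auto simp: inj_on_def doubleton_eq_iff)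
    show "(\<lambda>(i, j). {i, j}) ` ?P = complete_on k"
      by (auto elim!: complete_onE simp: image_iff) (auto simp: complete_on_def)
  qed
  have "(\<Prod>(i, j)\<in>{(i, j). i \<in> {1..k} \<and> j \<in> {1..k} \<and> i < j \<and> {i, j} \<in> F}. W (z i) (z j)) *
        (\<Prod>(i, j)\<in>{(i, j). i \<in> {1..k} \<and> j \<in> {1..k} \<and> i < j \<and> {i, j} \<notin> F}. 1 - W (z i) (z j))
     = induced_weight k F W z" (is "?A * ?B = _") for z
  proof -
    have A: "?A = (\<Prod>p\<in>?P. if {fst p, snd p} \<in> F then W (z (fst p)) (z (snd p)) else 1)"
      by (subst prod.inter_filter[OF fin, symmetric]) (auto intro!: prod.cong)
    have B: "?B = (\<Prod>p\<in>?P. if {fst p, snd p} \<notin> F then 1 - W (z (fst p)) (z (snd p)) else 1)"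
      by (subst prod.inter_filter[OF fin, symmetric]) (auto intro!: prod.cong)
    have "induced_weight k F W z = (\<Prod>p\<in>?P. let e = (case p of (i, j) \<Rightarrow> {i, j}) in
        if e \<in> F then edge_value W z e else 1 - edge_value W z e)"
      unfolding sample_weight_def Let_def using prod.reindex_bij_betw[OF bij, symmetric] .
    also have "\<dots> = ?A * ?B"
      unfolding A B prod.distrib[symmetric] by (intro prod.cong) (auto simp: edge_value_def)
    finally show ?thesis by simp
  qed
  then show ?thesis
    unfolding t_ind_def Let_def by (simp only:)
qed

text \<open>For a pair e of vertices, this is the change of the indicator of e when the extremist
  rule replaces F. The rule is deterministic, so no second graph appears; the last case is the tie,
  in which F stays.\<close>

definition drift :: "nat \<Rightarrow> nat set set \<Rightarrow> nat set \<Rightarrow> real" where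
  "drift k F e = (if real (card F) < 1/2 * real (k choose 2) then - of_bool (e \<in> F)
     else if real (card F) > 1/2 * real (k choose 2) then of_bool (e \<notin> F) else 0)"

lemma abs_drift_le_1: "\<bar>drift k F e\<bar> \<le> 1"
  by (simp add: drift_def)

text \<open>Every row of the extremist rule is a point mass, so the sum over H collapses to the
  single graph that replaces F.\<close>

lemma velocity_extremist:
  "velocity M k (extremist_rule k) W x y =
     (\<Sum>F\<in>graphs k. \<Sum>a\<in>{1..k}. \<Sum>b\<in>{1..k} - {a}. drift k F {a, b} * t_ind M k F a b W x y)"
proof -
  have "(\<Sum>H\<in>graphs k. extremist_rule k F H * (of_bool (e \<in> H - F) - of_bool (e \<in> F - H))) = drift k F e"
    if "F \<in> graphs k" "e \<in> complete_on k" for F e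
  proof -
    let ?H = "if real (card F) < 1/2 * real (k choose 2) then {}
      else if real (card F) > 1/2 * real (k choose 2) then complete_on k else F"
    have "?H \<in> graphs k" using that by (auto simp: graphs_def)
    moreover have "extremist_rule k F H = of_bool (H = ?H)" for H
      by (simp add: extremist_rule_def)
    ultimately have "(\<Sum>H\<in>graphs k. extremist_rule k F H * (of_bool (e \<in> H - F) - of_bool (e \<in> F - H)))
       = (\<Sum>H\<in>graphs k. if H = ?H then of_bool (e \<in> ?H - F) - of_bool (e \<in> F - ?H) else 0)"
      by (intro sum.cong) auto
    also have "\<dots> = of_bool (e \<in> ?H - F) - of_bool (e \<in> F - ?H)"
      using \<open>?H \<in> graphs k\<close> finite_graphs by (subst sum.delta) auto
    also have "\<dots> = drift k F e" using that by (auto simp: drift_def)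
    finally show ?thesis .
  qed
  note * = this
  have "velocity M k (extremist_rule k) W x y =
    (\<Sum>F\<in>graphs k. \<Sum>a\<in>{1..k}. \<Sum>b\<in>{1..k} - {a}. \<Sum>H\<in>graphs k.
        extremist_rule k F H * t_ind M k F a b W x y * (of_bool ({a, b} \<in> H - F) - of_bool ({a, b} \<in> F - H)))"
    unfolding velocity_def
    by (intro sum.cong refl, subst sum.swap, intro sum.cong refl, subst sum.swap, rule refl)
  also have "\<dots> = (\<Sum>F\<in>graphs k. \<Sum>a\<in>{1..k}. \<Sum>b\<in>{1..k} - {a}. drift k F {a, b} * t_ind M k F a b W x y)"
    by (intro sum.cong refl, subst *[symmetric])
       (auto simp: doubleton_in_complete_on sum_distrib_left sum_distrib_right mult_ac)
  finally show ?thesis .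
qed

text \<open>Complementation reflects the edge count about half of \<open>k choose 2\<close>. It
  swaps the two strict cases and maps ties to ties.\<close>

lemma drift_complement:
  assumes "F \<in> graphs k" "e \<in> complete_on k"
  shows "drift k (complete_on k - F) e = - drift k F e"
proof -
  have F: "F \<subseteq> complete_on k" "finite F"
    using assms finite_complete_on finite_subset unfolding graphs_def by blast+
  then have "card (complete_on k - F) = (k choose 2) - card F" "card F \<le> k choose 2"
    using card_complete_on[of k] card_mono[OF finite_complete_on F(1)] by (simp_all add: card_Diff_subset)
  then have "real (card (complete_on k - F)) = real (k choose 2) - real (card F)"
    by (simp add: of_nat_diff)
  then show ?thesis using assms by (auto simp: drift_def)
qed

text \<open>Sampling F from 1 - W is sampling its complement from W, so the claim follows by
  reindexing the sum over graphs. This symmetry turns convergence to 0 into convergence to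
  1.\<close>

lemma velocity_extremist_complement:
  "velocity M k (extremist_rule k) (\<lambda>x y. 1 - W x y) x y = - velocity M k (extremist_rule k) W x y"
proof -
  let ?c = "\<lambda>F. complete_on k - F"
  have bij: "bij_betw ?c (graphs k) (graphs k)"
    by (rule bij_betw_byWitness[where f' = ?c]) (auto simp: graphs_def)
  have t: "t_ind M k F a b (\<lambda>x y. 1 - W x y) x y = t_ind M k (?c F) a b W x y" for F a b
    unfolding t_ind_eq edge_value_def[abs_def] sample_weight_complement ..
  have "velocity M k (extremist_rule k) (\<lambda>x y. 1 - W x y) x y =
      (\<Sum>F\<in>graphs k. \<Sum>a\<in>{1..k}. \<Sum>b\<in>{1..k} - {a}. - (drift k (?c F) {a, b} * t_ind M k (?c F) a b W x y))"
    unfolding velocity_extremist t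
    by (intro sum.cong refl, subst drift_complement) (auto simp: doubleton_in_complete_on)
  also have "\<dots> = (\<Sum>F\<in>graphs k. \<Sum>a\<in>{1..k}. \<Sum>b\<in>{1..k} - {a}. - (drift k F {a, b} * t_ind M k F a b W x y))"
    by (rule sum.reindex_bij_betw[OF bij])
  finally show ?thesis by (simp add: velocity_extremist sum_negf)
qed

text \<open>The velocity runs over ordered roots (a, b), so each edge is met twice, as (Min e, Max
  e) and as (Max e, Min e).\<close>

lemma sum_ordered_pairs_of_bool:
  assumes "F \<subseteq> complete_on k"
  shows "(\<Sum>a\<in>{1..k}. \<Sum>b\<in>{1..k} - {a}. of_bool ({a, b} \<in> F)) = 2 * real (card F)"
proof -
  have fin: "finite F" using assms finite_complete_on finite_subset by blast
  let ?P = "{(a, b). a \<in> {1..k} \<and> b \<in> {1..k} - {a} \<and> {a, b} \<in> F}"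
  have "(\<Sum>a\<in>{1..k}. \<Sum>b\<in>{1..k} - {a}. of_bool ({a, b} \<in> F) :: real)
      = (\<Sum>(a, b)\<in>(SIGMA a:{1..k}. {1..k} - {a}). of_bool ({a, b} \<in> F))"
    by (rule sum.Sigma) auto
  also have "\<dots> = (\<Sum>p\<in>(SIGMA a:{1..k}. {1..k} - {a}). of_bool (p \<in> ?P))"
    by (intro sum.cong) auto
  also have "\<dots> = real (card ((SIGMA a:{1..k}. {1..k} - {a}) \<inter> ?P))"
    by (subst sum_of_bool_eq) (auto intro!: arg_cong[where f = card])
  also have "(SIGMA a:{1..k}. {1..k} - {a}) \<inter> ?P = ?P"
    by auto
  also have "?P = (\<Union>e\<in>F. {(Min e, Max e), (Max e, Min e)})" (is "_ = ?Q")
  proof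
    have "(Min e, Max e) \<in> ?P \<and> (Max e, Min e) \<in> ?P" if "e \<in> F" for e
      using Min_Max_complete_on[of e k] that assms by (auto simp: insert_commute)
    then show "?Q \<subseteq> ?P" by blast
    show "?P \<subseteq> ?Q"
    proof
      fix p assume "p \<in> ?P"
      then obtain a b where p: "p = (a, b)" and ab: "a \<noteq> b" "{a, b} \<in> F" by auto
      have "p \<in> {(Min {a, b}, Max {a, b}), (Max {a, b}, Min {a, b})}"
        using ab unfolding p by (cases a b rule: linorder_cases) auto
      then show "p \<in> ?Q" using ab by blast
    qed
  qed
  also have "card ?Q = (\<Sum>e\<in>F. card {(Min e, Max e), (Max e, Min e)})"
  proof (rule card_UN_disjoint[OF fin])
    show "\<forall>e\<in>F. \<forall>f\<in>F. e \<noteq> f \<longrightarrow>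
       {(Min e, Max e), (Max e, Min e)} \<inter> {(Min f, Max f), (Max f, Min f)} = {}"
      using Min_Max_complete_on(4)[of _ k] assms by (auto simp: insert_commute) (metis insert_commute subsetD)+
  qed auto
  also have "\<dots> = (\<Sum>e\<in>F. 2)"
    using Min_Max_complete_on(3)[of _ k] assms by (intro sum.cong) (auto simp: card_insert_if subset_iff)
  finally show ?thesis by simp
qed

lemma sum_drift:
  assumes "F \<in> graphs k"
  shows "(\<Sum>a\<in>{1..k}. \<Sum>b\<in>{1..k} - {a}. drift k F {a, b}) =
    (if real (card F) < 1/2 * real (k choose 2) then - 2 * real (card F)
     else if real (card F) > 1/2 * real (k choose 2) then 2 * (real (k choose 2) - real (card F)) else 0)"
proof -
  have F: "F \<subseteq> complete_on k" using assms by (simp add: graphs_def)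
  have fin: "finite F" using F finite_complete_on finite_subset by blast
  have "(\<Sum>a\<in>{1..k}. \<Sum>b\<in>{1..k} - {a}. of_bool ({a, b} \<notin> F) :: real)
      = (\<Sum>a\<in>{1..k}. \<Sum>b\<in>{1..k} - {a}. of_bool ({a, b} \<in> complete_on k - F))"
    by (intro sum.cong refl) (auto simp: doubleton_in_complete_on)
  also have "\<dots> = 2 * (real (k choose 2) - real (card F))"
    using card_mono[OF finite_complete_on F] fin F
    by (subst sum_ordered_pairs_of_bool) (auto simp: card_Diff_subset card_complete_on of_nat_diff)
  finally show ?thesis
    using sum_ordered_pairs_of_bool[OF F] by (simp add: drift_def sum_negf)
qed

section \<open>The velocity as an integral over samples\<close>

lemma kernel_measurable:
  assumes "kernel M W"
  shows "(\<lambda>(x, y). W x y) \<in> borel_measurable (M \<Otimes>\<^sub>M M)"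
  using assms by (simp add: kernel_def)

lemma kernel_bounded:
  assumes "kernel M W"
  obtains B where "B \<ge> 0" "\<And>x y. x \<in> space M \<Longrightarrow> y \<in> space M \<Longrightarrow> \<bar>W x y\<bar> \<le> B"
proof -
  obtain B where "\<forall>x\<in>space M. \<forall>y\<in>space M. \<bar>W x y\<bar> \<le> B" using assms unfolding kernel_def by blast
  then show thesis using that[of "\<bar>B\<bar>"] by fastforce
qed

lemma integral_triple_sum:
  fixes g :: "_ \<Rightarrow> _ \<Rightarrow> _ \<Rightarrow> _ \<Rightarrow> real"
  assumes "\<And>F a b. F \<in> X \<Longrightarrow> a \<in> Y F \<Longrightarrow> b \<in> Z F a \<Longrightarrow> integrable N (g F a b)"
  shows "(\<integral>x. (\<Sum>F\<in>X. \<Sum>a\<in>Y F. \<Sum>b\<in>Z F a. c F a b * g F a b x) \<partial>N) = (\<Sum>F\<in>X. \<Sum>a\<in>Y F. \<Sum>b\<in>Z F a. c F a b * (\<integral>x. g F a b x \<partial>N))"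
  using assms by (simp add: Bochner_Integration.integral_sum Bochner_Integration.integrable_sum cong: sum.cong)

text \<open>The bound holds at every point of the space, as it does for kernels. The class is thus
  closed under composition with continuous functions and consists of integrable functions on a
  probability space.\<close>

definition bounded_measurable :: "'b measure \<Rightarrow> ('b \<Rightarrow> real) \<Rightarrow> bool" where
  "bounded_measurable N f \<longleftrightarrow> f \<in> borel_measurable N \<and> (\<exists>B\<ge>0. \<forall>p\<in>space N. \<bar>f p\<bar> \<le> B)"

lemma bounded_measurableI:
  assumes "f \<in> borel_measurable N" "\<And>p. p \<in> space N \<Longrightarrow> \<bar>f p\<bar> \<le> B"
  shows "bounded_measurable N f"
proof -
  have "\<bar>f p\<bar> \<le> \<bar>B\<bar>" if "p \<in> space N" for p
    using assms(2)[OF that] by linarith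
  then show ?thesis
    unfolding bounded_measurable_def using assms(1) abs_ge_zero by blast
qed

lemma bounded_measurableD:
  assumes "bounded_measurable N f"
  shows "f \<in> borel_measurable N"
  using assms by (simp add: bounded_measurable_def)

lemma bounded_measurable_pairE:
  assumes "bounded_measurable (M \<Otimes>\<^sub>M M) (\<lambda>(x, y). h x y)"
  obtains C where "C \<ge> 0" "\<And>x y. x \<in> space M \<Longrightarrow> y \<in> space M \<Longrightarrow> \<bar>h x y\<bar> \<le> C"
proof -
  obtain C where "C \<ge> 0" and C: "\<forall>p\<in>space (M \<Otimes>\<^sub>M M). \<bar>case p of (x, y) \<Rightarrow> h x y\<bar> \<le> C"
    using assms unfolding bounded_measurable_def by blast
  show thesis
    using that[OF \<open>C \<ge> 0\<close>] C[THEN bspec, of "(_, _)"] by (simp add: space_pair_measure)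
qed

lemma bounded_measurable_continuous:
  fixes G :: "real \<Rightarrow> real"
  assumes "continuous_on UNIV G" "bounded_measurable N f"
  shows "bounded_measurable N (\<lambda>p. G (f p))"
proof -
  obtain B where f: "f \<in> borel_measurable N" and B: "\<And>p. p \<in> space N \<Longrightarrow> \<bar>f p\<bar> \<le> B"
    using assms(2) unfolding bounded_measurable_def by blast
  have "compact (G ` {-B..B})"
    using assms(1) continuous_on_subset by (intro compact_continuous_image) auto
  from compact_imp_bounded[OF this] obtain C where "\<forall>y\<in>G ` {-B..B}. norm y \<le> C"
    unfolding bounded_iff ..
  then have C: "\<bar>G x\<bar> \<le> C" if "x \<in> {-B..B}" for x
    using that by auto
  show ?thesis
  proof (rule bounded_measurableI[of _ _ C])
    show "(\<lambda>p. G (f p)) \<in> borel_measurable N"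
      by (rule measurable_compose[OF f borel_measurable_continuous_onI[OF assms(1)]])
    show "\<bar>G (f p)\<bar> \<le> C" if "p \<in> space N" for p
      using B[OF that] by (intro C) (auto simp: abs_le_iff)
  qed
qed

lemma bounded_measurable_mult:
  assumes "bounded_measurable N f" "bounded_measurable N g"
  shows "bounded_measurable N (\<lambda>p. f p * g p)"
proof -
  obtain B C where "B \<ge> 0" "C \<ge> 0" "\<And>p. p \<in> space N \<Longrightarrow> \<bar>f p\<bar> \<le> B" "\<And>p. p \<in> space N \<Longrightarrow> \<bar>g p\<bar> \<le> C"
    using assms unfolding bounded_measurable_def by blast
  then show ?thesis
    using assms[THEN bounded_measurableD]
    by (intro bounded_measurableI[of _ _ "B * C"]) (auto simp: abs_mult intro!: mult_mono)
qed

lemma bounded_measurable_diff: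
  assumes "bounded_measurable N f" "bounded_measurable N g"
  shows "bounded_measurable N (\<lambda>p. f p - g p)"
proof -
  obtain B C where B: "\<And>p. p \<in> space N \<Longrightarrow> \<bar>f p\<bar> \<le> B" and C: "\<And>p. p \<in> space N \<Longrightarrow> \<bar>g p\<bar> \<le> C"
    using assms unfolding bounded_measurable_def by blast
  have "\<bar>f p - g p\<bar> \<le> B + C" if "p \<in> space N" for p
    using B[OF that] C[OF that] by linarith
  then show ?thesis
    using assms[THEN bounded_measurableD] by (intro bounded_measurableI[of _ _ "B + C"]) auto
qed

lemma (in prob_space) integrable_bounded_measurable:
  assumes "bounded_measurable M f"
  shows "integrable M f"
proof -
  obtain B where "\<And>p. p \<in> space M \<Longrightarrow> \<bar>f p\<bar> \<le> B" "f \<in> borel_measurable M"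
    using assms unfolding bounded_measurable_def by blast
  then show ?thesis by (intro integrable_const_bound[where B = B]) auto
qed

lemma (in prob_space) abs_integral_le_const:
  fixes f :: "'a \<Rightarrow> real"
  assumes "f \<in> borel_measurable M" "AE p in M. \<bar>f p\<bar> \<le> c"
  shows "\<bar>\<integral>p. f p \<partial>M\<bar> \<le> c"
proof -
  have "integrable M f" using assms by (intro integrable_const_bound[where B = c]) auto
  then have "\<bar>\<integral>p. f p \<partial>M\<bar> \<le> (\<integral>p. c \<partial>M)"
    using assms by (intro integral_abs_bound[THEN order_trans] integral_mono_AE) auto
  then show ?thesis by (simp add: prob_space)
qed

section \<open>Independent samples of k points\<close>

context prob_space
begin

abbreviation sample_space :: "nat \<Rightarrow> (nat \<Rightarrow> 'a) measure" where
  "sample_space k \<equiv> Pi\<^sub>M {1..k} (\<lambda>_. M)"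

lemma product_prob_space_const: "product_prob_space (\<lambda>_::nat. M)"
  by (intro product_prob_spaceI prob_space_axioms)

lemma prob_space_sample_space: "prob_space (Pi\<^sub>M (I :: nat set) (\<lambda>_. M))"
  by (intro prob_space_PiM prob_space_axioms)

lemma prob_space_pair: "prob_space (M \<Otimes>\<^sub>M M)"
  by (intro prob_space_pair prob_space_axioms)

lemma measurable_update_roots:
  assumes "a \<in> {1..k}" "b \<in> {1..k}"
  shows "(\<lambda>((x, y), \<omega>). fun_upd (fun_upd \<omega> a x) b y)
    \<in> measurable ((M \<Otimes>\<^sub>M M) \<Otimes>\<^sub>M Pi\<^sub>M ({1..k} - {a, b}) (\<lambda>_. M)) (sample_space k)"
proof -
  have *: "{1..k} = insert a ({1..k} - {a, b}) \<union> {b}" "insert a ({1..k} - {a, b}) = ({1..k} - {a, b}) \<union> {a}"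
    using assms by auto
  have "(\<lambda>p. fun_upd (fun_upd (snd p) a (fst (fst p))) b (snd (fst p)))
    \<in> measurable ((M \<Otimes>\<^sub>M M) \<Otimes>\<^sub>M Pi\<^sub>M ({1..k} - {a, b}) (\<lambda>_. M)) (sample_space k)"
    by (intro measurable_fun_upd[OF *(1)] measurable_fun_upd[OF *(2)]) measurable
  then show ?thesis by (simp add: case_prod_unfold)
qed

text \<open>Inserting two independent points at the coordinates a and b completes the remaining
  independent points to an independent k-tuple. By uniqueness of product measures it suffices to
  compare boxes; since a and b differ, the second update does not overwrite the first.\<close>

lemma distr_update_roots:
  assumes "a \<in> {1..k}" "b \<in> {1..k}" "a \<noteq> b"
  shows "distr ((M \<Otimes>\<^sub>M M) \<Otimes>\<^sub>M Pi\<^sub>M ({1..k} - {a, b}) (\<lambda>_. M)) (sample_space k)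
    (\<lambda>((x, y), \<omega>). fun_upd (fun_upd \<omega> a x) b y) = sample_space k"
proof -
  interpret P: product_prob_space "\<lambda>_::nat. M" by (rule product_prob_space_const)
  interpret J: prob_space "Pi\<^sub>M ({1..k} - {a, b}) (\<lambda>_. M)" by (rule prob_space_sample_space)
  interpret MM: prob_space "M \<Otimes>\<^sub>M M" by (rule prob_space_pair)
  let ?J = "{1..k} - {a, b}"
  let ?f = "\<lambda>((x, y), \<omega>). fun_upd (fun_upd \<omega> a x) b y"
  show ?thesis
  proof (rule P.PiM_eqI)
    fix A :: "nat \<Rightarrow> 'a set" assume A: "\<And>i. i \<in> {1..k} \<Longrightarrow> A i \<in> sets M"
    have sub: "A i \<subseteq> space M" if "i \<in> {1..k}" for i using A[OF that] sets.sets_into_space by blast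
    have pre: "?f -` (Pi\<^sub>E {1..k} A) \<inter> space ((M \<Otimes>\<^sub>M M) \<Otimes>\<^sub>M Pi\<^sub>M ?J (\<lambda>_. M)) = (A a \<times> A b) \<times> Pi\<^sub>E ?J A"
    proof (intro set_eqI iffI)
      fix p assume "p \<in> ?f -` (Pi\<^sub>E {1..k} A) \<inter> space ((M \<Otimes>\<^sub>M M) \<Otimes>\<^sub>M Pi\<^sub>M ?J (\<lambda>_. M))"
      then obtain x y \<omega> where p: "p = ((x, y), \<omega>)" and *: "fun_upd (fun_upd \<omega> a x) b y \<in> Pi\<^sub>E {1..k} A"
        "((x, y), \<omega>) \<in> space ((M \<Otimes>\<^sub>M M) \<Otimes>\<^sub>M Pi\<^sub>M ?J (\<lambda>_. M))"
        by (cases p) auto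
      have "fun_upd (fun_upd \<omega> a x) b y i \<in> A i" if "i \<in> {1..k}" for i
        using *(1) that by (rule PiE_mem)
      moreover have "fun_upd (fun_upd \<omega> a x) b y i = \<omega> i" if "i \<in> ?J" for i
        using that by auto
      ultimately have "x \<in> A a" "y \<in> A b" "\<And>i. i \<in> ?J \<Longrightarrow> \<omega> i \<in> A i"
        using assms by (metis fun_upd_apply, metis fun_upd_same, metis Diff_iff)
      then show "p \<in> (A a \<times> A b) \<times> Pi\<^sub>E ?J A"
        unfolding p using assms *(2) by (auto simp: space_pair_measure space_PiM PiE_iff)
    next
      fix p assume "p \<in> (A a \<times> A b) \<times> Pi\<^sub>E ?J A"
      then obtain x y \<omega> where p: "p = ((x, y), \<omega>)" and "x \<in> A a" "y \<in> A b" "\<omega> \<in> Pi\<^sub>E ?J A"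
        by (cases p) auto
      moreover from this have "\<omega> i \<in> space M" if "i \<in> ?J" for i
        using sub[of i] that PiE_mem[of \<omega> ?J A i] by blast
      ultimately show "p \<in> ?f -` (Pi\<^sub>E {1..k} A) \<inter> space ((M \<Otimes>\<^sub>M M) \<Otimes>\<^sub>M Pi\<^sub>M ?J (\<lambda>_. M))"
        unfolding p using assms sub by (auto simp: space_pair_measure space_PiM PiE_iff extensional_def simp del: One_nat_def)
    qed
    have ins: "{1..k} = insert a (insert b ?J)" using assms by auto
    have prodA: "(\<Prod>i\<in>{1..k}. emeasure M (A i)) = emeasure M (A a) * emeasure M (A b) * (\<Prod>i\<in>?J. emeasure M (A i))"
      using assms by (subst ins) (simp add: mult_ac)
    have "emeasure (distr ((M \<Otimes>\<^sub>M M) \<Otimes>\<^sub>M Pi\<^sub>M ?J (\<lambda>_. M)) (sample_space k) ?f) (Pi\<^sub>E {1..k} A)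
        = emeasure ((M \<Otimes>\<^sub>M M) \<Otimes>\<^sub>M Pi\<^sub>M ?J (\<lambda>_. M)) ((A a \<times> A b) \<times> Pi\<^sub>E ?J A)"
      using A by (subst emeasure_distr[OF measurable_update_roots[OF assms(1,2)]]) (auto simp: pre simp del: One_nat_def intro!: sets_PiM_I_finite)
    also have "\<dots> = emeasure M (A a) * emeasure M (A b) * emeasure (Pi\<^sub>M ?J (\<lambda>_. M)) (Pi\<^sub>E ?J A)"
      using assms A by (subst J.emeasure_pair_measure_Times, auto simp del: One_nat_def intro!: sets_PiM_I_finite)
        (subst emeasure_pair_measure_Times, auto)
    also have "\<dots> = (\<Prod>i\<in>{1..k}. emeasure M (A i))"
      unfolding prodA using A by (subst P.emeasure_PiM) auto
    finally show "emeasure (distr ((M \<Otimes>\<^sub>M M) \<Otimes>\<^sub>M Pi\<^sub>M ?J (\<lambda>_. M)) (sample_space k) ?f) (Pi\<^sub>E {1..k} A)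
        = (\<Prod>i\<in>{1..k}. emeasure M (A i))" .
  qed simp_all
qed

text \<open>Fubini together with \<open>distr_update_roots\<close>: integrating a rooted integral
  over its two roots gives the integral over the full sample, whichever roots are chosen.\<close>

lemma integral_roots:
  fixes f :: "(nat \<Rightarrow> 'a) \<Rightarrow> real"
  assumes "a \<in> {1..k}" "b \<in> {1..k}" "a \<noteq> b"
    and f: "f \<in> borel_measurable (sample_space k)" "\<And>z. z \<in> space (sample_space k) \<Longrightarrow> \<bar>f z\<bar> \<le> B"
  shows "(\<lambda>(x, y). \<integral>\<omega>. f (fun_upd (fun_upd \<omega> a x) b y) \<partial>(Pi\<^sub>M ({1..k} - {a, b}) (\<lambda>_. M)))
      \<in> borel_measurable (M \<Otimes>\<^sub>M M)" (is ?meas)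
    and "(\<integral>(x, y). (\<integral>\<omega>. f (fun_upd (fun_upd \<omega> a x) b y) \<partial>(Pi\<^sub>M ({1..k} - {a, b}) (\<lambda>_. M))) \<partial>(M \<Otimes>\<^sub>M M))
       = (\<integral>z. f z \<partial>(sample_space k))" (is ?int)
    and "\<And>x y. x \<in> space M \<Longrightarrow> y \<in> space M \<Longrightarrow>
       \<bar>\<integral>\<omega>. f (fun_upd (fun_upd \<omega> a x) b y) \<partial>(Pi\<^sub>M ({1..k} - {a, b}) (\<lambda>_. M))\<bar> \<le> B" (is "PROP ?bdd")
proof -
  let ?J = "Pi\<^sub>M ({1..k} - {a, b}) (\<lambda>_. M)"
  interpret J: prob_space ?J by (rule prob_space_sample_space)
  interpret MM: prob_space "M \<Otimes>\<^sub>M M" by (rule prob_space_pair)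
  interpret JJ: pair_prob_space "M \<Otimes>\<^sub>M M" ?J ..
  let ?f = "\<lambda>((x, y), \<omega>). fun_upd (fun_upd \<omega> a x) b y"
  note T = measurable_update_roots[OF assms(1,2)]
  note m = measurable_compose[OF T f(1)]
  have m': "(\<lambda>(p, \<omega>). f (fun_upd (fun_upd \<omega> a (fst p)) b (snd p))) \<in> borel_measurable ((M \<Otimes>\<^sub>M M) \<Otimes>\<^sub>M ?J)"
    using m by (simp add: case_prod_unfold)
  show ?meas
    using J.borel_measurable_lebesgue_integral[OF m'] by (simp add: case_prod_unfold)
  have in_space: "?f p \<in> space (sample_space k)" if "p \<in> space ((M \<Otimes>\<^sub>M M) \<Otimes>\<^sub>M ?J)" for p
    using measurable_space[OF T that] .
  have int: "integrable ((M \<Otimes>\<^sub>M M) \<Otimes>\<^sub>M ?J) (\<lambda>p. f (?f p))"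
    using f(2)[OF in_space] m by (intro JJ.integrable_const_bound[where B = B]) auto
  have "(\<integral>z. f z \<partial>(sample_space k)) = (\<integral>p. f (?f p) \<partial>((M \<Otimes>\<^sub>M M) \<Otimes>\<^sub>M ?J))"
    by (subst distr_update_roots[OF assms(1-3), symmetric]) (rule integral_distr[OF T f(1)])
  also have "\<dots> = (\<integral>p. \<integral>\<omega>. f (?f (p, \<omega>)) \<partial>?J \<partial>(M \<Otimes>\<^sub>M M))"
    using JJ.integral_fst'[OF int] by simp
  finally show ?int by (simp add: case_prod_unfold)
  show "PROP ?bdd"
  proof -
    fix x y assume xy: "x \<in> space M" "y \<in> space M"
    have b: "\<bar>f (fun_upd (fun_upd \<omega> a x) b y)\<bar> \<le> B" if "\<omega> \<in> space ?J" for \<omega>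
      using f(2)[OF in_space[of "((x, y), \<omega>)"]] xy that by (simp add: space_pair_measure)
    have "(\<lambda>\<omega>. f (fun_upd (fun_upd \<omega> a x) b y)) \<in> borel_measurable ?J"
      using measurable_Pair2[OF m', of "(x, y)"] xy by (simp add: space_pair_measure)
    then have "integrable ?J (\<lambda>\<omega>. f (fun_upd (fun_upd \<omega> a x) b y))"
      using b by (intro J.integrable_const_bound[where B = B]) auto
    then have "\<bar>\<integral>\<omega>. f (fun_upd (fun_upd \<omega> a x) b y) \<partial>?J\<bar> \<le> (\<integral>\<omega>. B \<partial>?J)"
      using b by (intro integral_abs_bound[THEN order_trans] integral_mono_AE)
        (auto simp del: One_nat_def)
    then show "\<bar>\<integral>\<omega>. f (fun_upd (fun_upd \<omega> a x) b y) \<partial>?J\<bar> \<le> B" by (simp add: J.prob_space del: One_nat_def)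
  qed
qed

text \<open>When the sample is written as roots i, j plus the remaining points, the pair (z i, z j)
  is the first projection.\<close>

lemma distr_sample_pair:
  assumes "i \<in> {1..k}" "j \<in> {1..k}" "i \<noteq> j"
  shows "distr (sample_space k) (M \<Otimes>\<^sub>M M) (\<lambda>z. (z i, z j)) = M \<Otimes>\<^sub>M M"
proof -
  let ?J = "Pi\<^sub>M ({1..k} - {i, j}) (\<lambda>_. M)"
  interpret J: prob_space ?J by (rule prob_space_sample_space)
  let ?f = "\<lambda>((x, y), \<omega>). fun_upd (fun_upd \<omega> i x) j y"
  have "distr (sample_space k) (M \<Otimes>\<^sub>M M) (\<lambda>z. (z i, z j))
      = distr (distr ((M \<Otimes>\<^sub>M M) \<Otimes>\<^sub>M ?J) (sample_space k) ?f) (M \<Otimes>\<^sub>M M) (\<lambda>z. (z i, z j))"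
    by (subst distr_update_roots[OF assms]) (rule refl)
  also have "\<dots> = distr ((M \<Otimes>\<^sub>M M) \<Otimes>\<^sub>M ?J) (M \<Otimes>\<^sub>M M) ((\<lambda>z. (z i, z j)) \<circ> ?f)"
    using assms by (intro distr_distr measurable_update_roots) auto
  also have "\<dots> = distr ((M \<Otimes>\<^sub>M M) \<Otimes>\<^sub>M ?J) (M \<Otimes>\<^sub>M M) fst"
    using assms by (intro distr_cong) auto
  also have "\<dots> = M \<Otimes>\<^sub>M M" by (rule J.distr_pair_fst)
  finally show ?thesis .
qed

lemma measurable_sample_pair:
  assumes "i \<in> {1..k}" "j \<in> {1..k}"
  shows "(\<lambda>z. (z i, z j)) \<in> measurable (sample_space k) (M \<Otimes>\<^sub>M M)"
  using assms by measurable

lemma AE_sample_pair: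
  assumes "i \<in> {1..k}" "j \<in> {1..k}" "i \<noteq> j" "AE (x, y) in M \<Otimes>\<^sub>M M. P x y"
  shows "AE z in sample_space k. P (z i) (z j)"
proof -
  have "AE p in distr (sample_space k) (M \<Otimes>\<^sub>M M) (\<lambda>z. (z i, z j)). (case p of (x, y) \<Rightarrow> P x y)"
    unfolding distr_sample_pair[OF assms(1-3)] by (rule assms(4))
  from AE_distrD[OF measurable_sample_pair[OF assms(1,2)] this] show ?thesis by simp
qed

lemma integral_sample_pair:
  fixes f :: "'a \<Rightarrow> 'a \<Rightarrow> real"
  assumes "i \<in> {1..k}" "j \<in> {1..k}" "i \<noteq> j" "(\<lambda>(x, y). f x y) \<in> borel_measurable (M \<Otimes>\<^sub>M M)"
  shows "(\<integral>z. f (z i) (z j) \<partial>(sample_space k)) = (\<integral>(x, y). f x y \<partial>(M \<Otimes>\<^sub>M M))"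
proof -
  have "(\<integral>(x, y). f x y \<partial>(M \<Otimes>\<^sub>M M)) = (\<integral>(x, y). f x y \<partial>(distr (sample_space k) (M \<Otimes>\<^sub>M M) (\<lambda>z. (z i, z j))))"
    unfolding distr_sample_pair[OF assms(1-3)] ..
  also have "\<dots> = (\<integral>z. f (z i) (z j) \<partial>(sample_space k))"
    by (subst integral_distr[OF measurable_sample_pair assms(4)]) (use assms in auto)
  finally show ?thesis ..
qed

lemma measurable_sample_value:
  assumes "i \<in> {1..k}" "j \<in> {1..k}" "(\<lambda>(x, y). f x y) \<in> borel_measurable (M \<Otimes>\<^sub>M M)"
  shows "(\<lambda>z. f (z i) (z j) :: real) \<in> borel_measurable (sample_space k)"
  using measurable_compose[OF measurable_sample_pair[OF assms(1,2)] assms(3)] by simp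

lemma measurable_edge_value:
  assumes "kernel M W" "e \<in> complete_on k"
  shows "(\<lambda>z. edge_value W z e) \<in> borel_measurable (sample_space k)"
  unfolding edge_value_def
  using Min_Max_complete_on[OF assms(2)] kernel_measurable[OF assms(1)] by (intro measurable_sample_value)

lemma measurable_induced_weight:
  assumes "kernel M W"
  shows "induced_weight k F W \<in> borel_measurable (sample_space k)"
  unfolding sample_weight_def
  using measurable_edge_value[OF assms]
  by (intro borel_measurable_prod) (auto intro!: borel_measurable_diff)

lemma bounded_induced_weight:
  assumes "kernel M W"
  obtains B where "B \<ge> 0" "\<And>F z. F \<in> graphs k \<Longrightarrow> z \<in> space (sample_space k) \<Longrightarrow> \<bar>induced_weight k F W z\<bar> \<le> B"
proof -
  obtain C where C: "C \<ge> 0" "\<And>x y. x \<in> space M \<Longrightarrow> y \<in> space M \<Longrightarrow> \<bar>W x y\<bar> \<le> C"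
    using kernel_bounded[OF assms] by blast
  have "\<bar>induced_weight k F W z\<bar> \<le> (1 + 2 * C) ^ card (complete_on k)"
    if F: "F \<in> graphs k" and z: "z \<in> space (sample_space k)" for F z
  proof -
    have "\<bar>edge_value W z e\<bar> + \<bar>1 - edge_value W z e\<bar> \<le> 1 + 2 * C" if "e \<in> complete_on k" for e
      using C(2)[of "z (Min e)" "z (Max e)"] Min_Max_complete_on[OF that] z
      by (auto simp: edge_value_def space_PiM PiE_iff)
    from sum_abs_sample_weight_le[OF finite_complete_on this]
    have "(\<Sum>F\<in>graphs k. \<bar>induced_weight k F W z\<bar>) \<le> (1 + 2 * C) ^ card (complete_on k)"
      using C by (simp add: graphs_def)
    moreover have "\<bar>induced_weight k F W z\<bar> \<le> (\<Sum>F\<in>graphs k. \<bar>induced_weight k F W z\<bar>)"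
      using F finite_graphs by (intro member_le_sum) auto
    ultimately show ?thesis by simp
  qed
  moreover have "(1 + 2 * C) ^ card (complete_on k) \<ge> 0"
    using C by simp
  ultimately show thesis using that by blast
qed

section \<open>The velocity tested against bounded functions\<close>

abbreviation vel :: "nat \<Rightarrow> ('a \<Rightarrow> 'a \<Rightarrow> real) \<Rightarrow> 'a \<Rightarrow> 'a \<Rightarrow> real" where
  "vel k W \<equiv> velocity M k (extremist_rule k) W"

lemma t_ind_measurable_bounded:
  assumes "kernel M W" "F \<in> graphs k" "a \<in> {1..k}" "b \<in> {1..k}" "a \<noteq> b"
  shows "(\<lambda>(x, y). t_ind M k F a b W x y) \<in> borel_measurable (M \<Otimes>\<^sub>M M)"
    and "\<exists>B. \<forall>x\<in>space M. \<forall>y\<in>space M. \<bar>t_ind M k F a b W x y\<bar> \<le> B"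
proof -
  obtain B where B: "B \<ge> 0" "\<And>F z. F \<in> graphs k \<Longrightarrow> z \<in> space (sample_space k) \<Longrightarrow> \<bar>induced_weight k F W z\<bar> \<le> B"
    using bounded_induced_weight[OF assms(1)] by blast
  note * = integral_roots[OF assms(3-5) measurable_induced_weight[OF assms(1), of k F] B(2)[OF assms(2)]]
  show "(\<lambda>(x, y). t_ind M k F a b W x y) \<in> borel_measurable (M \<Otimes>\<^sub>M M)"
    unfolding t_ind_eq using *(1) .
  show "\<exists>B. \<forall>x\<in>space M. \<forall>y\<in>space M. \<bar>t_ind M k F a b W x y\<bar> \<le> B"
    unfolding t_ind_eq using *(3) by blast
qed

lemma velocity_measurable:
  assumes "kernel M W"
  shows "(\<lambda>(x, y). vel k W x y) \<in> borel_measurable (M \<Otimes>\<^sub>M M)"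
  unfolding velocity_extremist case_prod_unfold
  using t_ind_measurable_bounded(1)[OF assms, unfolded case_prod_unfold]
  by (intro borel_measurable_sum borel_measurable_times) auto

lemma velocity_bounded:
  assumes "kernel M W"
  obtains B where "B \<ge> 0" "\<And>x y. x \<in> space M \<Longrightarrow> y \<in> space M \<Longrightarrow> \<bar>vel k W x y\<bar> \<le> B"
proof -
  have "\<forall>F\<in>graphs k. \<forall>a\<in>{1..k}. \<forall>b\<in>{1..k} - {a}. \<exists>B. \<forall>x\<in>space M. \<forall>y\<in>space M. \<bar>t_ind M k F a b W x y\<bar> \<le> B"
    by (intro ballI t_ind_measurable_bounded(2)[OF assms]) auto
  then have "\<exists>B. \<forall>F\<in>graphs k. \<forall>a\<in>{1..k}. \<forall>b\<in>{1..k} - {a}. \<forall>x\<in>space M. \<forall>y\<in>space M.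
      \<bar>t_ind M k F a b W x y\<bar> \<le> B F a b"
    unfolding bchoice_iff .
  then obtain B where "\<forall>F\<in>graphs k. \<forall>a\<in>{1..k}. \<forall>b\<in>{1..k} - {a}. \<forall>x\<in>space M. \<forall>y\<in>space M.
      \<bar>t_ind M k F a b W x y\<bar> \<le> B F a b" ..
  note B = this[rule_format]
  let ?B = "\<Sum>F\<in>graphs k. \<Sum>a\<in>{1..k}. \<Sum>b\<in>{1..k} - {a}. B F a b"
  have "\<bar>vel k W x y\<bar> \<le> ?B" if "x \<in> space M" "y \<in> space M" for x y
    unfolding velocity_extremist
  proof (intro order_trans[OF sum_abs] sum_mono)
    fix F a b assume *: "F \<in> graphs k" "a \<in> {1..k}" "b \<in> {1..k} - {a}"
    have "\<bar>drift k F {a, b} * t_ind M k F a b W x y\<bar> \<le> 1 * B F a b"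
      unfolding abs_mult using * that B by (intro mult_mono abs_drift_le_1) auto
    then show "\<bar>drift k F {a, b} * t_ind M k F a b W x y\<bar> \<le> B F a b" by simp
  qed
  then show thesis using that[of "\<bar>?B\<bar>"] by fastforce
qed

text \<open>Each rooted density has its own roots and its own integration space. Tested against h
  and integrated, all of them become integrals over the same k-tuple z, so the sum over F can be
  estimated pointwise in z as a total variation.\<close>

lemma integral_mult_velocity:
  assumes W: "kernel M W"
    and bm: "bounded_measurable (M \<Otimes>\<^sub>M M) (\<lambda>(x, y). h x y)"
  shows "(\<integral>(x, y). h x y * vel k W x y \<partial>(M \<Otimes>\<^sub>M M)) =
    (\<integral>z. (\<Sum>F\<in>graphs k. \<Sum>a\<in>{1..k}. \<Sum>b\<in>{1..k} - {a}.
        drift k F {a, b} * (h (z a) (z b) * induced_weight k F W z)) \<partial>(sample_space k))"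
    and "integrable (M \<Otimes>\<^sub>M M) (\<lambda>(x, y). h x y * vel k W x y)"
    and "integrable (sample_space k) (\<lambda>z. \<Sum>F\<in>graphs k. \<Sum>a\<in>{1..k}. \<Sum>b\<in>{1..k} - {a}.
        drift k F {a, b} * (h (z a) (z b) * induced_weight k F W z))"
proof -
  interpret MM: prob_space "M \<Otimes>\<^sub>M M" by (rule prob_space_pair)
  interpret Z: prob_space "sample_space k" by (rule prob_space_sample_space)
  have h: "(\<lambda>(x, y). h x y) \<in> borel_measurable (M \<Otimes>\<^sub>M M)"
    using bm by (rule bounded_measurableD)
  obtain C where C: "C \<ge> 0" and hB: "\<And>x y. x \<in> space M \<Longrightarrow> y \<in> space M \<Longrightarrow> \<bar>h x y\<bar> \<le> C"
    using bounded_measurable_pairE[OF bm] by blast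
  obtain B where B: "B \<ge> 0" "\<And>F z. F \<in> graphs k \<Longrightarrow> z \<in> space (sample_space k) \<Longrightarrow> \<bar>induced_weight k F W z\<bar> \<le> B"
    using bounded_induced_weight[OF W] by blast
  have *: "(\<integral>(x, y). h x y * t_ind M k F a b W x y \<partial>(M \<Otimes>\<^sub>M M))
        = (\<integral>z. h (z a) (z b) * induced_weight k F W z \<partial>(sample_space k))"
    "integrable (M \<Otimes>\<^sub>M M) (\<lambda>(x, y). h x y * t_ind M k F a b W x y)"
    "integrable (sample_space k) (\<lambda>z. h (z a) (z b) * induced_weight k F W z)"
    if "F \<in> graphs k" "a \<in> {1..k}" "b \<in> {1..k} - {a}" for F a b
  proof -
    let ?f = "\<lambda>z. h (z a) (z b) * induced_weight k F W z"
    have ab: "a \<in> {1..k}" "b \<in> {1..k}" "a \<noteq> b" using that by auto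
    have f: "?f \<in> borel_measurable (sample_space k)"
      using ab h by (intro borel_measurable_times measurable_induced_weight[OF W] measurable_sample_value)
    have fB: "\<bar>?f z\<bar> \<le> C * B" if "z \<in> space (sample_space k)" for z
      unfolding abs_mult using that \<open>F \<in> graphs k\<close> ab B C
      by (intro mult_mono hB B) (auto simp: space_PiM PiE_iff)
    note r = integral_roots[OF ab f fB]
    \<comment> \<open>After the updates the coordinates a and b are x and y, so the factor h no
      longer depends on the integration variable.\<close>
    have eq: "(\<integral>\<omega>. ?f (fun_upd (fun_upd \<omega> a x) b y) \<partial>(Pi\<^sub>M ({1..k} - {a, b}) (\<lambda>_. M)))
        = h x y * t_ind M k F a b W x y" for x y
      unfolding t_ind_eq using ab by simp
    show "(\<integral>(x, y). h x y * t_ind M k F a b W x y \<partial>(M \<Otimes>\<^sub>M M)) = (\<integral>z. ?f z \<partial>(sample_space k))"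
      using r(2) unfolding eq .
    show "integrable (M \<Otimes>\<^sub>M M) (\<lambda>(x, y). h x y * t_ind M k F a b W x y)"
      using r(1,3) unfolding eq
      by (intro MM.integrable_const_bound[where B = "C * B"]) (auto simp: space_pair_measure)
    show "integrable (sample_space k) ?f"
      using f fB by (intro Z.integrable_const_bound[where B = "C * B"]) auto
  qed
  have v: "(\<lambda>(x, y). h x y * vel k W x y) = (\<lambda>p. \<Sum>F\<in>graphs k. \<Sum>a\<in>{1..k}. \<Sum>b\<in>{1..k} - {a}.
      drift k F {a, b} * (case p of (x, y) \<Rightarrow> h x y * t_ind M k F a b W x y))"
    by (auto simp: fun_eq_iff velocity_extremist sum_distrib_left mult_ac)
  show "integrable (M \<Otimes>\<^sub>M M) (\<lambda>(x, y). h x y * vel k W x y)"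
    unfolding v by (intro Bochner_Integration.integrable_sum integrable_mult_right *)
  show "integrable (sample_space k) (\<lambda>z. \<Sum>F\<in>graphs k. \<Sum>a\<in>{1..k}. \<Sum>b\<in>{1..k} - {a}.
        drift k F {a, b} * (h (z a) (z b) * induced_weight k F W z))"
    by (intro Bochner_Integration.integrable_sum integrable_mult_right *)
  show "(\<integral>(x, y). h x y * vel k W x y \<partial>(M \<Otimes>\<^sub>M M)) =
    (\<integral>z. (\<Sum>F\<in>graphs k. \<Sum>a\<in>{1..k}. \<Sum>b\<in>{1..k} - {a}.
        drift k F {a, b} * (h (z a) (z b) * induced_weight k F W z)) \<partial>(sample_space k))"
    unfolding v
    by (subst (1 2) integral_triple_sum) (auto intro!: * sum.cong simp del: One_nat_def simp: *)
qed

end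

section \<open>Differentiating integrals along curves of bounded functions\<close>

lemma has_real_derivative_at_within_atLeast:
  assumes "(g has_real_derivative D) (at t within {0..})" "0 < t"
  shows "(g has_real_derivative D) (at t)"
proof -
  have "at t within {0..} = at t" using assms(2) by (intro at_within_interior) auto
  then show ?thesis using assms(1) by simp
qed

text \<open>The derivative of g multiplied by exp (- L t) is nonpositive on the open interval, so
  this product cannot exceed its initial value. At 0 only the one-sided derivative is available, and
  there continuity is enough.\<close>

lemma gronwall_zero:
  fixes g g' :: "real \<Rightarrow> real"
  assumes der: "\<And>t. 0 \<le> t \<Longrightarrow> t \<le> T \<Longrightarrow> (g has_real_derivative g' t) (at t within {0..})"
    and le: "\<And>t. 0 \<le> t \<Longrightarrow> t \<le> T \<Longrightarrow> g' t \<le> L * g t"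
    and "g 0 \<le> 0" "0 \<le> T"
  shows "g T \<le> 0"
proof -
  have "g T * exp (- (L * T)) \<le> g 0 * exp (- (L * 0))"
  proof (rule DERIV_nonpos_imp_decreasing_open[OF \<open>0 \<le> T\<close>])
    fix t assume t: "0 < t" "t < T"
    have dg: "(g has_real_derivative g' t) (at t)"
      using t by (intro has_real_derivative_at_within_atLeast der) auto
    have "((\<lambda>t. g t * exp (- (L * t))) has_real_derivative
        g' t * exp (- (L * t)) + (exp (- (L * t)) * - (L * 1)) * g t) (at t)"
      by (intro DERIV_mult dg DERIV_fun_exp DERIV_minus DERIV_cmult DERIV_ident)
    then have "((\<lambda>t. g t * exp (- (L * t))) has_real_derivative (g' t - L * g t) * exp (- (L * t))) (at t)"
      by (simp add: algebra_simps)
    moreover have "(g' t - L * g t) * exp (- (L * t)) \<le> 0"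
      using le[of t] t by (intro mult_nonpos_nonneg) auto
    ultimately show "\<exists>y. ((\<lambda>t. g t * exp (- (L * t))) has_real_derivative y) (at t) \<and> y \<le> 0" by blast
  next
    have "continuous_on {0..T} g"
      by (rule DERIV_continuous_on[where D = g'], rule DERIV_subset[where s = "{0..}"], rule der) auto
    then show "continuous_on {0..T} (\<lambda>t. g t * exp (- (L * t)))" by (intro continuous_intros)
  qed
  then have "g T * exp (- (L * T)) \<le> 0" using assms(3) by simp
  then show ?thesis by (simp add: mult_le_0_iff)
qed

lemma increment_ge:
  fixes g g' :: "real \<Rightarrow> real"
  assumes der: "\<And>t. 0 \<le> t \<Longrightarrow> t \<le> T \<Longrightarrow> (g has_real_derivative g' t) (at t within {0..})"
    and ge: "\<And>t. 0 \<le> t \<Longrightarrow> t \<le> T \<Longrightarrow> c \<le> g' t"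
    and "0 \<le> T"
  shows "g 0 + c * T \<le> g T"
proof -
  have "g 0 - c * 0 \<le> g T - c * T"
  proof (rule DERIV_nonneg_imp_increasing_open[OF \<open>0 \<le> T\<close>])
    fix t assume t: "0 < t" "t < T"
    have dg: "(g has_real_derivative g' t) (at t)"
      using t by (intro has_real_derivative_at_within_atLeast der) auto
    have "((\<lambda>t. g t - c * t) has_real_derivative (g' t - c * 1)) (at t)"
      by (intro DERIV_diff dg DERIV_cmult DERIV_ident)
    then have "((\<lambda>t. g t - c * t) has_real_derivative (g' t - c)) (at t)"
      by simp
    then show "\<exists>y. ((\<lambda>t. g t - c * t) has_real_derivative y) (at t) \<and> 0 \<le> y"
      using ge[of t] t by (intro exI[of _ "g' t - c"]) auto
  next
    have "continuous_on {0..T} g"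
      by (rule DERIV_continuous_on[where D = g'], rule DERIV_subset[where s = "{0..}"], rule der) auto
    then show "continuous_on {0..T} (\<lambda>t. g t - c * t)" by (intro continuous_intros)
  qed
  then show ?thesis by simp
qed

text \<open>Differentiability of u at t as a curve in the L-infinity space, one-sided at t = 0. The
  essential supremum is replaced by almost everywhere bounds, whose exceptional null sets may depend
  on s.\<close>

definition Linf_deriv :: "'b measure \<Rightarrow> (real \<Rightarrow> 'b \<Rightarrow> real) \<Rightarrow> ('b \<Rightarrow> real) \<Rightarrow> real \<Rightarrow> bool" where
  "Linf_deriv N u v t \<longleftrightarrow> (\<forall>\<epsilon>>0. \<exists>\<delta>>0. \<forall>s\<ge>0. s \<noteq> t \<longrightarrow> \<bar>s - t\<bar> < \<delta> \<longrightarrow>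
     (AE p in N. \<bar>(u s p - u t p) / (s - t) - v p\<bar> \<le> \<epsilon>))"

text \<open>A chain rule under the integral: a remainder quadratic in b - a, uniformly in a and b,
  contributes O(|s - t|) to the difference quotient. The identity, the square and the squared
  distance to [0,1] all satisfy this condition; the absolute value does not, which is why distances
  enter squared.\<close>

lemma (in prob_space) has_derivative_integral:
  assumes t: "t \<ge> 0" and der: "Linf_deriv M u v t"
    and u: "\<And>s. s \<ge> 0 \<Longrightarrow> bounded_measurable M (u s)" and v: "bounded_measurable M v"
    and G: "continuous_on UNIV G" and G': "continuous_on UNIV G'"
    and taylor: "\<And>a b. \<bar>G b - G a - G' a * (b - a)\<bar> \<le> K * (b - a)\<^sup>2"
  shows "((\<lambda>s. \<integral>p. G (u s p) \<partial>M) has_real_derivative (\<integral>p. G' (u t p) * v p \<partial>M)) (at t within {0..})"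
proof -
  have K: "K \<ge> 0" using taylor[of 1 0] by simp
  have bmG: "bounded_measurable M (\<lambda>p. G (u s p))" if "s \<ge> 0" for s
    using bounded_measurable_continuous[OF G u[OF that]] .
  have bmG': "bounded_measurable M (\<lambda>p. G' (u t p))"
    using bounded_measurable_continuous[OF G' u[OF t]] .
  have bmv: "bounded_measurable M (\<lambda>p. G' (u t p) * v p)"
    by (intro bounded_measurable_mult bmG' v)
  obtain C where C: "C \<ge> 0" "\<And>p. p \<in> space M \<Longrightarrow> \<bar>G' (u t p)\<bar> \<le> C"
    using bmG' unfolding bounded_measurable_def by blast
  obtain V where V: "V \<ge> 0" "\<And>p. p \<in> space M \<Longrightarrow> \<bar>v p\<bar> \<le> V"
    using v unfolding bounded_measurable_def by blast
  \<comment> \<open>Once \<eta> \<le> 1, difference quotients are at most V + 1 in absolute value,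
    so D bounds the coefficient of |s - t| in the Taylor remainder.\<close>
  define D where "D = K * (V + 1)\<^sup>2"
  have D: "D \<ge> 0" using K by (simp add: D_def)
  let ?g = "\<lambda>s. \<integral>p. G (u s p) \<partial>M"
  show ?thesis
    unfolding has_field_derivative_iff tendsto_iff eventually_at dist_real_def
  proof (intro allI impI)
    fix \<epsilon> :: real assume \<epsilon>: "\<epsilon> > 0"
    \<comment> \<open>This makes the linear error at most \<epsilon> / 2; C + 1 instead of C avoids
      division by zero. The choice of d below treats D in the same way.\<close>
    define \<eta> where "\<eta> = min 1 (\<epsilon> / (2 * (C + 1)))"
    have \<eta>: "\<eta> > 0" "\<eta> \<le> 1" "C * \<eta> \<le> \<epsilon> / 2"
    proof -
      show "\<eta> > 0" "\<eta> \<le> 1" using \<epsilon> C by (auto simp: \<eta>_def)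
      have "C * \<eta> \<le> (C + 1) * (\<epsilon> / (2 * (C + 1)))"
        using C \<open>\<eta> > 0\<close> by (intro mult_mono) (auto simp: \<eta>_def)
      also have "\<dots> = \<epsilon> / 2" using C by (simp add: field_simps)
      finally show "C * \<eta> \<le> \<epsilon> / 2" .
    qed
    obtain \<delta> where \<delta>: "\<delta> > 0" and AE\<delta>: "\<And>s. s \<ge> 0 \<Longrightarrow> s \<noteq> t \<Longrightarrow> \<bar>s - t\<bar> < \<delta> \<Longrightarrow>
        AE p in M. \<bar>(u s p - u t p) / (s - t) - v p\<bar> \<le> \<eta>"
      using der \<eta>(1) unfolding Linf_deriv_def by blast
    define d where "d = min \<delta> (\<epsilon> / (2 * (D + 1)))"
    have d: "d > 0" using \<delta> \<epsilon> D by (auto simp: d_def)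
    show "\<exists>d>0. \<forall>s\<in>{0..}. s \<noteq> t \<and> \<bar>s - t\<bar> < d \<longrightarrow>
        \<bar>(?g s - ?g t) / (s - t) - (\<integral>p. G' (u t p) * v p \<partial>M)\<bar> < \<epsilon>"
    proof (intro exI[of _ d] conjI d ballI impI)
      fix s :: real assume s: "s \<in> {0..}" and st: "s \<noteq> t \<and> \<bar>s - t\<bar> < d"
      let ?f = "\<lambda>p. (G (u s p) - G (u t p)) / (s - t) - G' (u t p) * v p"
      note ints = integrable_bounded_measurable[OF bmG[of s]] integrable_bounded_measurable[OF bmG[of t]]
        integrable_bounded_measurable[OF bmv]
      have eq: "(?g s - ?g t) / (s - t) - (\<integral>p. G' (u t p) * v p \<partial>M) = (\<integral>p. ?f p \<partial>M)"
        using ints s t by simp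
      have "AE p in M. \<bar>?f p\<bar> \<le> C * \<eta> + D * \<bar>s - t\<bar>"
      proof -
        have "AE p in M. \<bar>(u s p - u t p) / (s - t) - v p\<bar> \<le> \<eta>"
          using s st by (intro AE\<delta>) (auto simp: d_def)
        then show ?thesis
        proof (rule AE_mp, intro AE_I2 impI)
          fix p assume p: "p \<in> space M" and q: "\<bar>(u s p - u t p) / (s - t) - v p\<bar> \<le> \<eta>"
          define q where "q = (u s p - u t p) / (s - t)"
          have us: "u s p - u t p = q * (s - t)" using st by (simp add: q_def)
          have q\<eta>: "\<bar>q - v p\<bar> \<le> \<eta>" using q by (simp add: q_def)
          then have "\<bar>q\<bar> \<le> V + 1" using V(2)[OF p] \<eta>(2) by linarith
          then have q2: "q\<^sup>2 \<le> (V + 1)\<^sup>2"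
            by (metis abs_ge_zero power2_abs power_mono)
          have "?f p = (G (u s p) - G (u t p) - G' (u t p) * (u s p - u t p)) / (s - t) + G' (u t p) * (q - v p)"
            unfolding us using st by (simp add: field_simps)
          also have "\<bar>\<dots>\<bar> \<le> \<bar>(G (u s p) - G (u t p) - G' (u t p) * (u s p - u t p)) / (s - t)\<bar> + \<bar>G' (u t p) * (q - v p)\<bar>"
            by (rule abs_triangle_ineq)
          also have "\<bar>G' (u t p) * (q - v p)\<bar> \<le> C * \<eta>"
            unfolding abs_mult using C p q\<eta> by (intro mult_mono) auto
          also have "\<bar>(G (u s p) - G (u t p) - G' (u t p) * (u s p - u t p)) / (s - t)\<bar>
              \<le> K * (u s p - u t p)\<^sup>2 / \<bar>s - t\<bar>"
            unfolding abs_divide using taylor[of "u s p" "u t p"] by (intro divide_right_mono) auto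
          also have "K * (u s p - u t p)\<^sup>2 / \<bar>s - t\<bar> = K * q\<^sup>2 * \<bar>s - t\<bar>"
            unfolding us power_mult_distrib using st by (simp add: power2_eq_square field_simps)
          also have "\<dots> \<le> D * \<bar>s - t\<bar>"
            unfolding D_def using q2 K by (intro mult_right_mono mult_left_mono) auto
          finally show "\<bar>?f p\<bar> \<le> C * \<eta> + D * \<bar>s - t\<bar>" by simp
        qed
      qed
      then have "\<bar>\<integral>p. ?f p \<partial>M\<bar> \<le> C * \<eta> + D * \<bar>s - t\<bar>"
        using ints s t by (intro abs_integral_le_const) auto
      moreover have "D * \<bar>s - t\<bar> < \<epsilon> / 2"
      proof -
        have "D * \<bar>s - t\<bar> \<le> (D + 1) * \<bar>s - t\<bar>" by (intro mult_right_mono) auto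
        also have "\<dots> < (D + 1) * (\<epsilon> / (2 * (D + 1)))"
          using st D by (intro mult_strict_left_mono) (auto simp: d_def)
        also have "\<dots> = \<epsilon> / 2" using D by (simp add: field_simps)
        finally show ?thesis .
      qed
      ultimately show "\<bar>(?g s - ?g t) / (s - t) - (\<integral>p. G' (u t p) * v p \<partial>M)\<bar> < \<epsilon>"
        unfolding eq using \<eta>(3) by linarith
    qed
  qed
qed

text \<open>Each u s is bounded, but nothing makes the bound uniform in s, and Gronwall's inequality
  needs one constant on all of [0, T]. Near a fixed t the difference quotients are bounded by V + 1,
  which gives a local bound; bisection extends it to the interval.\<close>

lemma Linf_deriv_locally_bounded:
  assumes der: "\<And>t. t \<ge> 0 \<Longrightarrow> Linf_deriv N u (v t) t"
    and u: "\<And>s. s \<ge> 0 \<Longrightarrow> bounded_measurable N (u s)"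
    and v: "\<And>s. s \<ge> 0 \<Longrightarrow> bounded_measurable N (v s)"
    and T: "0 \<le> T"
  shows "\<exists>B. \<forall>s. 0 \<le> s \<and> s \<le> T \<longrightarrow> (AE p in N. \<bar>u s p\<bar> \<le> B)"
proof -
  \<comment> \<open>The restriction to s \<ge> 0 matters: the small intervals in
    \<open>Bolzano\<close> may reach below 0, where nothing is known about u.\<close>
  define P where "P a b = (\<exists>B. \<forall>s\<ge>0. a \<le> s \<and> s \<le> b \<longrightarrow> (AE p in N. \<bar>u s p\<bar> \<le> B))" for a b
  have "P 0 T"
  proof (rule Bolzano[OF T])
    fix a b c :: real assume "P a b" "P b c" "a \<le> b" "b \<le> c"
    then obtain B C where B: "\<And>s. s \<ge> 0 \<Longrightarrow> a \<le> s \<and> s \<le> b \<Longrightarrow> AE p in N. \<bar>u s p\<bar> \<le> B"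
      and C: "\<And>s. s \<ge> 0 \<Longrightarrow> b \<le> s \<and> s \<le> c \<Longrightarrow> AE p in N. \<bar>u s p\<bar> \<le> C"
      unfolding P_def by blast
    have "AE p in N. \<bar>u s p\<bar> \<le> max B C" if "s \<ge> 0" "a \<le> s \<and> s \<le> c" for s
    proof (cases "s \<le> b")
      case True
      then have "AE p in N. \<bar>u s p\<bar> \<le> B" using B[of s] that by simp
      then show ?thesis by eventually_elim simp
    next
      case False
      then have "AE p in N. \<bar>u s p\<bar> \<le> C" using C[of s] that by simp
      then show ?thesis by eventually_elim simp
    qed
    then show "P a c" unfolding P_def by blast
  next
    fix t :: real assume t: "0 \<le> t" "t \<le> T"
    obtain \<delta> where \<delta>: "\<delta> > 0" and AE\<delta>: "\<And>s. s \<ge> 0 \<Longrightarrow> s \<noteq> t \<Longrightarrow> \<bar>s - t\<bar> < \<delta> \<Longrightarrow>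
        AE p in N. \<bar>(u s p - u t p) / (s - t) - v t p\<bar> \<le> 1"
      using der[OF t(1)] unfolding Linf_deriv_def by (meson zero_less_one)
    obtain C where C: "C \<ge> 0" "\<And>p. p \<in> space N \<Longrightarrow> \<bar>u t p\<bar> \<le> C"
      using u[OF t(1)] unfolding bounded_measurable_def by blast
    obtain V where V: "V \<ge> 0" "\<And>p. p \<in> space N \<Longrightarrow> \<bar>v t p\<bar> \<le> V"
      using v[OF t(1)] unfolding bounded_measurable_def by blast
    have "AE p in N. \<bar>u s p\<bar> \<le> C + (V + 1) * \<delta>" if s: "s \<ge> 0" "\<bar>s - t\<bar> < \<delta>" for s
    proof (cases "s = t")
      case True
      have "(V + 1) * \<delta> \<ge> 0" using V \<delta> by simp
      then show ?thesis using C True by (auto intro!: AE_I2 add_increasing2)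
    next
      case False
      from AE\<delta>[OF s(1) False s(2)] show ?thesis
      proof (rule AE_mp, intro AE_I2 impI)
        fix p assume p: "p \<in> space N" and q: "\<bar>(u s p - u t p) / (s - t) - v t p\<bar> \<le> 1"
        have "\<bar>(u s p - u t p) / (s - t)\<bar> \<le> V + 1" using q V(2)[OF p] by linarith
        then have "\<bar>u s p - u t p\<bar> \<le> (V + 1) * \<bar>s - t\<bar>" using False by (simp add: abs_divide divide_le_eq)
        also have "\<dots> \<le> (V + 1) * \<delta>" using V s by (intro mult_left_mono) auto
        finally show "\<bar>u s p\<bar> \<le> C + (V + 1) * \<delta>" using C(2)[OF p] by linarith
      qed
    qed
    then have "P a b" if "a \<le> t \<and> t \<le> b \<and> b - a < \<delta>" for a b
      unfolding P_def using that by (intro exI[of _ "C + (V + 1) * \<delta>"]) (auto simp: abs_less_iff)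
    then show "\<exists>d>0. \<forall>a b. a \<le> t \<and> t \<le> b \<and> b - a < d \<longrightarrow> P a b" using \<delta> by blast
  qed
  then show ?thesis unfolding P_def by blast
qed

section \<open>Lipschitz bounds for the velocity\<close>

context prob_space
begin

text \<open>Any two distinct sample points have the distribution of a random pair, and there are
  finitely many edges. Hypotheses on kernels that hold only almost everywhere thus become usable at
  all edges of almost every sample.\<close>

lemma AE_all_edges:
  assumes "AE (x, y) in M \<Otimes>\<^sub>M M. P (W x y)"
  shows "AE z in sample_space k. \<forall>e\<in>complete_on k. P (edge_value W z e)"
  unfolding edge_value_def
  using AE_sample_pair[OF _ _ _ assms] Min_Max_complete_on finite_complete_on
  by (intro AE_finite_allI) auto

lemma kernel_bounded_measurable:
  assumes "kernel M W"
  shows "bounded_measurable (M \<Otimes>\<^sub>M M) (\<lambda>(x, y). W x y)"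
proof -
  obtain B where "B \<ge> 0" "\<And>x y. x \<in> space M \<Longrightarrow> y \<in> space M \<Longrightarrow> \<bar>W x y\<bar> \<le> B"
    using kernel_bounded[OF assms] by blast
  then show ?thesis
    by (intro bounded_measurableI[of _ _ B] kernel_measurable[OF assms]) (auto simp: space_pair_measure)
qed

lemma velocity_bounded_measurable:
  assumes "kernel M W"
  shows "bounded_measurable (M \<Otimes>\<^sub>M M) (\<lambda>(x, y). vel k W x y)"
proof -
  obtain B where "B \<ge> 0" "\<And>x y. x \<in> space M \<Longrightarrow> y \<in> space M \<Longrightarrow> \<bar>vel k W x y\<bar> \<le> B"
    using velocity_bounded[OF assms] by blast
  then show ?thesis
    by (intro bounded_measurableI[of _ _ B] velocity_measurable[OF assms]) (auto simp: space_pair_measure)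
qed

text \<open>Both integrals live on the same sample space and the drift is at most 1 in absolute
  value. What remains is the total variation between the two families of induced weights, which is
  bounded by a sum over edges and not over graphs.\<close>

lemma integral_mult_velocity_diff_le:
  assumes U: "kernel M U" and W: "kernel M W" and "B \<ge> 1"
    and UB: "AE (x, y) in M \<Otimes>\<^sub>M M. \<bar>U x y\<bar> + \<bar>1 - U x y\<bar> \<le> B"
    and WB: "AE (x, y) in M \<Otimes>\<^sub>M M. \<bar>W x y\<bar> + \<bar>1 - W x y\<bar> \<le> B"
    and bm: "bounded_measurable (M \<Otimes>\<^sub>M M) (\<lambda>(x, y). h x y)"
  shows "\<bar>(\<integral>(x, y). h x y * vel k U x y \<partial>(M \<Otimes>\<^sub>M M)) - (\<integral>(x, y). h x y * vel k W x y \<partial>(M \<Otimes>\<^sub>M M))\<bar>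
    \<le> 2 * B ^ (k choose 2) * (\<Sum>a\<in>{1..k}. \<Sum>b\<in>{1..k} - {a}. \<Sum>e\<in>complete_on k.
        \<integral>z. \<bar>h (z a) (z b)\<bar> * \<bar>edge_value U z e - edge_value W z e\<bar> \<partial>(sample_space k))"
proof -
  interpret Z: prob_space "sample_space k" by (rule prob_space_sample_space)
  have h: "(\<lambda>(x, y). h x y) \<in> borel_measurable (M \<Otimes>\<^sub>M M)"
    using bm by (rule bounded_measurableD)
  obtain C where "C \<ge> 0" and hC: "\<And>x y. x \<in> space M \<Longrightarrow> y \<in> space M \<Longrightarrow> \<bar>h x y\<bar> \<le> C"
    using bounded_measurable_pairE[OF bm] by blast
  let ?w = "\<lambda>F z. induced_weight k F U z - induced_weight k F W z"
  let ?g = "\<lambda>z. 2 * B ^ (k choose 2) * (\<Sum>a\<in>{1..k}. \<Sum>b\<in>{1..k} - {a}. \<Sum>e\<in>complete_on k.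
      \<bar>h (z a) (z b)\<bar> * \<bar>edge_value U z e - edge_value W z e\<bar>)"
  let ?f = "\<lambda>z. (\<Sum>F\<in>graphs k. \<Sum>a\<in>{1..k}. \<Sum>b\<in>{1..k} - {a}. drift k F {a, b} * (h (z a) (z b) * ?w F z))"
  note iU = integral_mult_velocity[OF U bm, of k]
  note iW = integral_mult_velocity[OF W bm, of k]
  have feq: "?f z = (\<Sum>F\<in>graphs k. \<Sum>a\<in>{1..k}. \<Sum>b\<in>{1..k} - {a}. drift k F {a, b} * (h (z a) (z b) * induced_weight k F U z))
      - (\<Sum>F\<in>graphs k. \<Sum>a\<in>{1..k}. \<Sum>b\<in>{1..k} - {a}. drift k F {a, b} * (h (z a) (z b) * induced_weight k F W z))" for z
    by (simp add: sum_subtractf right_diff_distrib)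
  have fint: "integrable (sample_space k) ?f"
    unfolding feq using iU(3) iW(3) by (rule Bochner_Integration.integrable_diff)
  have gint: "integrable (sample_space k) (\<lambda>z. \<bar>h (z a) (z b)\<bar> * \<bar>edge_value U z e - edge_value W z e\<bar>)"
    if "a \<in> {1..k}" "b \<in> {1..k} - {a}" "e \<in> complete_on k" for a b e
  proof (rule Z.integrable_bounded_measurable)
    have 1: "bounded_measurable (sample_space k) (\<lambda>z. edge_value X z e)" if X: "kernel M X" for X
    proof -
      obtain D where "D \<ge> 0" "\<And>x y. x \<in> space M \<Longrightarrow> y \<in> space M \<Longrightarrow> \<bar>X x y\<bar> \<le> D"
        using kernel_bounded[OF X] by blast
      then show ?thesis
        using measurable_edge_value[OF X \<open>e \<in> complete_on k\<close>] Min_Max_complete_on[OF \<open>e \<in> complete_on k\<close>]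
        by (intro bounded_measurableI[of _ _ D]) (auto simp: edge_value_def space_PiM PiE_iff)
    qed
    have 2: "bounded_measurable (sample_space k) (\<lambda>z. h (z a) (z b))"
      using that hC by (intro bounded_measurableI[of _ _ C] measurable_sample_value h)
         (auto simp: space_PiM PiE_iff)
    have abs: "continuous_on UNIV (abs :: real \<Rightarrow> real)" by (intro continuous_intros)
    show "bounded_measurable (sample_space k) (\<lambda>z. \<bar>h (z a) (z b)\<bar> * \<bar>edge_value U z e - edge_value W z e\<bar>)"
      using 1 2 U W
      by (intro bounded_measurable_mult bounded_measurable_continuous[OF abs] bounded_measurable_diff)
  qed
  have le: "AE z in sample_space k. \<bar>?f z\<bar> \<le> ?g z"
    using AE_all_edges[where P = "\<lambda>u. \<bar>u\<bar> + \<bar>1 - u\<bar> \<le> B" and W = U and k = k, OF UB] AE_all_edges[where P = "\<lambda>u. \<bar>u\<bar> + \<bar>1 - u\<bar> \<le> B" and W = W and k = k, OF WB]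
  proof eventually_elim
    case (elim z)
    have tv: "(\<Sum>F\<in>graphs k. \<bar>?w F z\<bar>) \<le> 2 * B ^ (k choose 2) * (\<Sum>e\<in>complete_on k. \<bar>edge_value U z e - edge_value W z e\<bar>)"
      using sum_abs_diff_sample_weight_le[OF finite_complete_on \<open>B \<ge> 1\<close>, of k "edge_value U z" "edge_value W z"] elim
      by (simp add: graphs_def card_complete_on)
    have "\<bar>?f z\<bar> \<le> (\<Sum>F\<in>graphs k. \<Sum>a\<in>{1..k}. \<Sum>b\<in>{1..k} - {a}. \<bar>h (z a) (z b)\<bar> * \<bar>?w F z\<bar>)"
    proof (intro order_trans[OF sum_abs] sum_mono)
      fix F a b
      have "\<bar>drift k F {a, b} * (h (z a) (z b) * ?w F z)\<bar> \<le> 1 * (\<bar>h (z a) (z b)\<bar> * \<bar>?w F z\<bar>)"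
        unfolding abs_mult by (intro mult_right_mono abs_drift_le_1) auto
      then show "\<bar>drift k F {a, b} * (h (z a) (z b) * ?w F z)\<bar> \<le> \<bar>h (z a) (z b)\<bar> * \<bar>?w F z\<bar>" by simp
    qed
    \<comment> \<open>The sum over F moves to the innermost place, where \<open>tv\<close>
      applies.\<close>
    also have "\<dots> = (\<Sum>a\<in>{1..k}. \<Sum>b\<in>{1..k} - {a}. \<bar>h (z a) (z b)\<bar> * (\<Sum>F\<in>graphs k. \<bar>?w F z\<bar>))"
      unfolding sum_distrib_left by (subst sum.swap, intro sum.cong refl, subst sum.swap, rule refl)
    also have "\<dots> \<le> (\<Sum>a\<in>{1..k}. \<Sum>b\<in>{1..k} - {a}. \<bar>h (z a) (z b)\<bar> *
        (2 * B ^ (k choose 2) * (\<Sum>e\<in>complete_on k. \<bar>edge_value U z e - edge_value W z e\<bar>)))"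
      by (intro sum_mono mult_left_mono tv) auto
    also have "\<dots> = ?g z" by (simp add: sum_distrib_left mult_ac)
    finally show ?case .
  qed
  have eq: "(\<integral>(x, y). h x y * vel k U x y \<partial>(M \<Otimes>\<^sub>M M)) - (\<integral>(x, y). h x y * vel k W x y \<partial>(M \<Otimes>\<^sub>M M))
      = (\<integral>z. ?f z \<partial>(sample_space k))"
    unfolding iU(1) iW(1) feq Bochner_Integration.integral_diff[OF iU(3) iW(3)] ..
  have "\<bar>\<integral>z. ?f z \<partial>(sample_space k)\<bar> \<le> (\<integral>z. ?g z \<partial>(sample_space k))"
  proof (intro integral_abs_bound[THEN order_trans] integral_mono_AE)
    show "integrable (sample_space k) ?g"
      by (intro integrable_mult_right Bochner_Integration.integrable_sum gint)
  qed (use fint le in auto)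
  also have "\<dots> = 2 * B ^ (k choose 2) * (\<Sum>a\<in>{1..k}. \<Sum>b\<in>{1..k} - {a}. \<Sum>e\<in>complete_on k.
        \<integral>z. \<bar>h (z a) (z b)\<bar> * \<bar>edge_value U z e - edge_value W z e\<bar> \<partial>(sample_space k))"
  proof -
    \<comment> \<open>The coefficient 1 brings the integrand into the form expected by
      \<open>integral_triple_sum\<close>.\<close>
    have "(\<integral>z. (\<Sum>a\<in>{1..k}. \<Sum>b\<in>{1..k} - {a}. \<Sum>e\<in>complete_on k.
          1 * (\<bar>h (z a) (z b)\<bar> * \<bar>edge_value U z e - edge_value W z e\<bar>)) \<partial>(sample_space k))
        = (\<Sum>a\<in>{1..k}. \<Sum>b\<in>{1..k} - {a}. \<Sum>e\<in>complete_on k.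
          1 * (\<integral>z. \<bar>h (z a) (z b)\<bar> * \<bar>edge_value U z e - edge_value W z e\<bar> \<partial>(sample_space k)))"
      by (rule integral_triple_sum[where X = "{1..k}" and Y = "\<lambda>a. {1..k} - {a}" and Z = "\<lambda>_ _. complete_on k"
            and c = "\<lambda>_ _ _. 1" and g = "\<lambda>a b e z. \<bar>h (z a) (z b)\<bar> * \<bar>edge_value U z e - edge_value W z e\<bar>"]) (rule gint)
    then show ?thesis by (simp only: mult_1 integral_mult_right_zero)
  qed
  finally show ?thesis unfolding eq .
qed

lemma sum_three_le_const:
  fixes f :: "nat \<Rightarrow> nat \<Rightarrow> nat set \<Rightarrow> real"
  assumes "\<And>a b e. a \<in> {1..k} \<Longrightarrow> b \<in> {1..k} - {a} \<Longrightarrow> e \<in> complete_on k \<Longrightarrow> f a b e \<le> c" "c \<ge> 0"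
  shows "(\<Sum>a\<in>{1..k}. \<Sum>b\<in>{1..k} - {a}. \<Sum>e\<in>complete_on k. f a b e) \<le> real k ^ 2 * real (k choose 2) * c"
proof -
  have "(\<Sum>a\<in>{1..k}. \<Sum>b\<in>{1..k} - {a}. \<Sum>e\<in>complete_on k. f a b e)
      \<le> (\<Sum>a\<in>{1..k}. \<Sum>b\<in>{1..k} - {a}. \<Sum>e\<in>complete_on k. c)"
    by (intro sum_mono assms)
  also have "\<dots> \<le> (\<Sum>a\<in>{1..k}. \<Sum>b\<in>{1..k}. \<Sum>e\<in>complete_on k. c)"
    using assms(2) by (intro sum_mono sum_mono2) auto
  also have "\<dots> = real k ^ 2 * real (k choose 2) * c"
    by (simp add: card_complete_on power2_eq_square)
  finally show ?thesis .
qed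

text \<open>Testing the increment of the velocity against the increment of the kernel keeps everything
  in \<open>L\<^sup>2\<close>: each pair of sampled points has distribution \<open>\<pi>\<^sup>2\<close>, so AM-GM bounds every term.\<close>

lemma velocity_L2_Lipschitz:
  assumes U: "kernel M U" and W: "kernel M W" and B: "B \<ge> 1"
    and UB: "AE (x, y) in M \<Otimes>\<^sub>M M. \<bar>U x y\<bar> + \<bar>1 - U x y\<bar> \<le> B"
    and WB: "AE (x, y) in M \<Otimes>\<^sub>M M. \<bar>W x y\<bar> + \<bar>1 - W x y\<bar> \<le> B"
  shows "(\<integral>(x, y). (U x y - W x y) * (vel k U x y - vel k W x y) \<partial>(M \<Otimes>\<^sub>M M))
    \<le> 2 * B ^ (k choose 2) * (real k ^ 2 * real (k choose 2)) * (\<integral>(x, y). (U x y - W x y)\<^sup>2 \<partial>(M \<Otimes>\<^sub>M M))"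
proof -
  interpret MM: prob_space "M \<Otimes>\<^sub>M M" by (rule prob_space_pair)
  interpret Z: prob_space "sample_space k" by (rule prob_space_sample_space)
  let ?d = "\<lambda>x y. U x y - W x y"
  let ?I = "\<integral>(x, y). (?d x y)\<^sup>2 \<partial>(M \<Otimes>\<^sub>M M)"
  have bm: "bounded_measurable (M \<Otimes>\<^sub>M M) (\<lambda>(x, y). ?d x y)"
    using bounded_measurable_diff[OF kernel_bounded_measurable[OF U] kernel_bounded_measurable[OF W]]
    by (simp add: case_prod_unfold)
  obtain C where "C \<ge> 0" and C: "\<And>x y. x \<in> space M \<Longrightarrow> y \<in> space M \<Longrightarrow> \<bar>?d x y\<bar> \<le> C"
    using bounded_measurable_pairE[OF bm] by blast
  have m: "(\<lambda>(x, y). ?d x y) \<in> borel_measurable (M \<Otimes>\<^sub>M M)"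
    using bm by (rule bounded_measurableD)
  have m2: "(\<lambda>(x, y). (?d x y)\<^sup>2) \<in> borel_measurable (M \<Otimes>\<^sub>M M)"
    using borel_measurable_power[OF m, of 2] by (simp add: case_prod_unfold)
  have I0: "?I \<ge> 0" by (intro Bochner_Integration.integral_nonneg) auto
  note iU = integral_mult_velocity[OF U bm, of k]
  note iW = integral_mult_velocity[OF W bm, of k]
  have "(\<integral>(x, y). ?d x y * (vel k U x y - vel k W x y) \<partial>(M \<Otimes>\<^sub>M M))
      = (\<integral>(x, y). ?d x y * vel k U x y \<partial>(M \<Otimes>\<^sub>M M)) - (\<integral>(x, y). ?d x y * vel k W x y \<partial>(M \<Otimes>\<^sub>M M))"
    using Bochner_Integration.integral_diff[OF iU(2) iW(2)] by (simp add: case_prod_unfold right_diff_distrib)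
  also have "\<dots> \<le> 2 * B ^ (k choose 2) * (\<Sum>a\<in>{1..k}. \<Sum>b\<in>{1..k} - {a}. \<Sum>e\<in>complete_on k.
        \<integral>z. \<bar>?d (z a) (z b)\<bar> * \<bar>edge_value U z e - edge_value W z e\<bar> \<partial>(sample_space k))"
    using integral_mult_velocity_diff_le[OF U W B UB WB bm, of k] by linarith
  also have "\<dots> \<le> 2 * B ^ (k choose 2) * (real k ^ 2 * real (k choose 2) * ?I)"
  proof (intro mult_left_mono sum_three_le_const I0)
    fix a b e assume ab: "a \<in> {1..k}" "b \<in> {1..k} - {a}" and e: "e \<in> complete_on k"
    let ?i = "Min e" and ?j = "Max e"
    note ij = Min_Max_complete_on[OF e]
    have int2: "integrable (sample_space k) (\<lambda>z. (?d (z i) (z j))\<^sup>2)" if "i \<in> {1..k}" "j \<in> {1..k}" for i j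
    proof (intro Z.integrable_const_bound[where B = "C\<^sup>2"] AE_I2)
      show "(\<lambda>z. (?d (z i) (z j))\<^sup>2) \<in> borel_measurable (sample_space k)"
        using that by (intro measurable_sample_value[OF _ _ m2])
      show "norm ((?d (z i) (z j))\<^sup>2) \<le> C\<^sup>2" if "z \<in> space (sample_space k)" for z
      proof -
        have "\<bar>?d (z i) (z j)\<bar> \<le> C"
          using that \<open>i \<in> {1..k}\<close> \<open>j \<in> {1..k}\<close> by (intro C) (auto simp: space_PiM PiE_iff)
        then have "\<bar>?d (z i) (z j)\<bar>\<^sup>2 \<le> C\<^sup>2" by (intro power_mono) auto
        then show ?thesis by simp
      qed
    qed
    have eq2: "(\<integral>z. (?d (z i) (z j))\<^sup>2 \<partial>(sample_space k)) = ?I" if "i \<in> {1..k}" "j \<in> {1..k}" "i \<noteq> j" for i j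
      using that by (intro integral_sample_pair m2)
    have "(\<integral>z. \<bar>?d (z a) (z b)\<bar> * \<bar>edge_value U z e - edge_value W z e\<bar> \<partial>(sample_space k))
        \<le> (\<integral>z. ((?d (z a) (z b))\<^sup>2 + (?d (z ?i) (z ?j))\<^sup>2) / 2 \<partial>(sample_space k))"
    proof (rule integral_mono')
      show "integrable (sample_space k) (\<lambda>z. ((?d (z a) (z b))\<^sup>2 + (?d (z ?i) (z ?j))\<^sup>2) / 2)"
        using ab ij int2 by (intro integrable_divide Bochner_Integration.integrable_add) auto
      show "\<bar>?d (z a) (z b)\<bar> * \<bar>edge_value U z e - edge_value W z e\<bar>
          \<le> ((?d (z a) (z b))\<^sup>2 + (?d (z ?i) (z ?j))\<^sup>2) / 2" for z
        using sum_squares_bound[of "\<bar>?d (z a) (z b)\<bar>" "\<bar>?d (z ?i) (z ?j)\<bar>"]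
        by (simp add: edge_value_def)
    qed auto
    also have "\<dots> = (?I + ?I) / 2"
      using ab ij int2 eq2[of a b] eq2[of ?i ?j] by (subst integral_divide_zero, subst Bochner_Integration.integral_add) auto
    finally show "(\<integral>z. \<bar>?d (z a) (z b)\<bar> * \<bar>edge_value U z e - edge_value W z e\<bar> \<partial>(sample_space k)) \<le> ?I"
      by simp
  qed (use B in auto)
  finally show ?thesis by (simp add: mult_ac)
qed

text \<open>The test function is 1, and values in [0,1] allow B = 1. The resulting constant, of
  order k^4, determines how close to the bipartite graphon a trajectory must stay.\<close>

lemma integral_velocity_Lipschitz:
  assumes U: "kernel M U" and W: "kernel M W"
    and U01: "AE (x, y) in M \<Otimes>\<^sub>M M. 0 \<le> U x y \<and> U x y \<le> 1"
    and W01: "AE (x, y) in M \<Otimes>\<^sub>M M. 0 \<le> W x y \<and> W x y \<le> 1"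
  shows "\<bar>(\<integral>(x, y). vel k U x y \<partial>(M \<Otimes>\<^sub>M M)) - (\<integral>(x, y). vel k W x y \<partial>(M \<Otimes>\<^sub>M M))\<bar>
    \<le> 2 * real k ^ 2 * real (k choose 2) * (\<integral>(x, y). \<bar>U x y - W x y\<bar> \<partial>(M \<Otimes>\<^sub>M M))"
proof -
  have UB: "AE (x, y) in M \<Otimes>\<^sub>M M. \<bar>U x y\<bar> + \<bar>1 - U x y\<bar> \<le> 1"
    using U01 by eventually_elim auto
  have WB: "AE (x, y) in M \<Otimes>\<^sub>M M. \<bar>W x y\<bar> + \<bar>1 - W x y\<bar> \<le> 1"
    using W01 by eventually_elim auto
  let ?I = "\<integral>(x, y). \<bar>U x y - W x y\<bar> \<partial>(M \<Otimes>\<^sub>M M)"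
  have m: "(\<lambda>(x, y). \<bar>U x y - W x y\<bar>) \<in> borel_measurable (M \<Otimes>\<^sub>M M)"
    using kernel_measurable[OF U] kernel_measurable[OF W] by (simp add: case_prod_unfold)
  have I0: "?I \<ge> 0" by (intro Bochner_Integration.integral_nonneg) auto
  have "\<bar>(\<integral>(x, y). 1 * vel k U x y \<partial>(M \<Otimes>\<^sub>M M)) - (\<integral>(x, y). 1 * vel k W x y \<partial>(M \<Otimes>\<^sub>M M))\<bar>
    \<le> 2 * 1 ^ (k choose 2) * (\<Sum>a\<in>{1..k}. \<Sum>b\<in>{1..k} - {a}. \<Sum>e\<in>complete_on k.
        \<integral>z. \<bar>1\<bar> * \<bar>edge_value U z e - edge_value W z e\<bar> \<partial>(sample_space k))"
    by (rule integral_mult_velocity_diff_le[OF U W _ UB WB]) (auto intro!: bounded_measurableI[of _ _ 1])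
  also have "\<dots> \<le> 2 * 1 ^ (k choose 2) * (real k ^ 2 * real (k choose 2) * ?I)"
  proof (intro mult_left_mono sum_three_le_const I0)
    fix a b e assume "e \<in> complete_on k"
    note ij = Min_Max_complete_on[OF this]
    show "(\<integral>z. \<bar>1\<bar> * \<bar>edge_value U z e - edge_value W z e\<bar> \<partial>(sample_space k)) \<le> ?I"
      using integral_sample_pair[OF ij(1-3) m] by (simp add: edge_value_def)
  qed auto
  finally show ?thesis by simp
qed

text \<open>For [0,1]-valued W the induced weights sum to at most 1, and each of at most k^2 ordered
  pairs of roots contributes at most c. This limits the speed of a trajectory.\<close>

lemma abs_integral_mult_velocity_le:
  assumes W: "kernel M W" and bm: "bounded_measurable (M \<Otimes>\<^sub>M M) (\<lambda>(x, y). h x y)"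
    and W01: "AE (x, y) in M \<Otimes>\<^sub>M M. 0 \<le> W x y \<and> W x y \<le> 1"
    and h1: "AE (x, y) in M \<Otimes>\<^sub>M M. \<bar>h x y\<bar> \<le> c" and c: "c \<ge> 0"
  shows "\<bar>\<integral>(x, y). h x y * vel k W x y \<partial>(M \<Otimes>\<^sub>M M)\<bar> \<le> real k ^ 2 * c"
proof -
  interpret Z: prob_space "sample_space k" by (rule prob_space_sample_space)
  have W1: "AE (x, y) in M \<Otimes>\<^sub>M M. \<bar>W x y\<bar> + \<bar>1 - W x y\<bar> \<le> 1"
    using W01 by eventually_elim auto
  have hA: "AE z in sample_space k. \<forall>a\<in>{1..k}. \<forall>b\<in>{1..k} - {a}. \<bar>h (z a) (z b)\<bar> \<le> c"
    using AE_sample_pair[OF _ _ _ h1, of _ k] by (intro AE_finite_allI) auto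
  note iW = integral_mult_velocity[OF W bm, of k]
  have "\<bar>\<integral>z. (\<Sum>F\<in>graphs k. \<Sum>a\<in>{1..k}. \<Sum>b\<in>{1..k} - {a}.
        drift k F {a, b} * (h (z a) (z b) * induced_weight k F W z)) \<partial>(sample_space k)\<bar> \<le> real k ^ 2 * c"
  proof (rule Z.abs_integral_le_const)
    show "AE z in sample_space k. \<bar>\<Sum>F\<in>graphs k. \<Sum>a\<in>{1..k}. \<Sum>b\<in>{1..k} - {a}.
        drift k F {a, b} * (h (z a) (z b) * induced_weight k F W z)\<bar> \<le> real k ^ 2 * c"
      using AE_all_edges[where P = "\<lambda>u. \<bar>u\<bar> + \<bar>1 - u\<bar> \<le> 1" and W = W and k = k, OF W1] hA
    proof eventually_elim
      case (elim z)
      have "\<bar>\<Sum>F\<in>graphs k. \<Sum>a\<in>{1..k}. \<Sum>b\<in>{1..k} - {a}.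
          drift k F {a, b} * (h (z a) (z b) * induced_weight k F W z)\<bar>
          \<le> (\<Sum>F\<in>graphs k. \<Sum>a\<in>{1..k}. \<Sum>b\<in>{1..k} - {a}. c * \<bar>induced_weight k F W z\<bar>)"
      proof (intro order_trans[OF sum_abs] sum_mono)
        fix F a b assume ab: "a \<in> {1..k}" "b \<in> {1..k} - {a}"
        have "\<bar>drift k F {a, b} * (h (z a) (z b) * induced_weight k F W z)\<bar> \<le> 1 * (c * \<bar>induced_weight k F W z\<bar>)"
          unfolding abs_mult using elim(2) ab c by (intro mult_mono abs_drift_le_1) auto
        then show "\<bar>drift k F {a, b} * (h (z a) (z b) * induced_weight k F W z)\<bar> \<le> c * \<bar>induced_weight k F W z\<bar>" by simp
      qed
      also have "\<dots> \<le> (\<Sum>F\<in>graphs k. \<Sum>a\<in>{1..k}. \<Sum>b\<in>{1..k}. c * \<bar>induced_weight k F W z\<bar>)"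
        using c by (intro sum_mono sum_mono2) auto
      also have "\<dots> = real k ^ 2 * c * (\<Sum>F\<in>graphs k. \<bar>induced_weight k F W z\<bar>)"
        by (simp add: sum_distrib_left power2_eq_square mult_ac)
      also have "\<dots> \<le> real k ^ 2 * c * 1"
        using sum_abs_sample_weight_le[OF finite_complete_on, of k "edge_value W z" 1] elim(1) c
        by (intro mult_left_mono) (auto simp: graphs_def)
      finally show ?case by simp
    qed
  qed (use iW(3) in auto)
  then show ?thesis unfolding iW(1)[symmetric] .
qed

text \<open>The edge between the two roots contributes a factor that depends only on x and y, so if
  it vanishes the whole integrand does. Symmetry of W covers the case b < a.\<close>

lemma t_ind_eq_0:
  assumes W: "kernel M W" and ab: "a \<in> {1..k}" "b \<in> {1..k}" "a \<noteq> b"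
    and xy: "x \<in> space M" "y \<in> space M"
    and zero: "(if {a, b} \<in> F then W x y else 1 - W x y) = 0"
  shows "t_ind M k F a b W x y = 0"
proof -
  have e: "{a, b} \<in> complete_on k" using ab by (auto simp: complete_on_def)
  have sym: "W x y = W y x" using W xy by (simp add: kernel_def)
  have "edge_value W (fun_upd (fun_upd \<omega> a x) b y) {a, b} = W x y" for \<omega>
    using ab sym by (cases a b rule: linorder_cases) (auto simp: edge_value_def)
  then have "induced_weight k F W (fun_upd (fun_upd \<omega> a x) b y) = 0" for \<omega>
    unfolding sample_weight_def using e zero
    by (intro prod_zero finite_complete_on bexI[of _ "{a, b}"]) (simp_all only:)
  then show ?thesis unfolding t_ind_eq by simp
qed

lemma t_ind_nonneg:
  assumes W: "graphon M W" and ab: "a \<in> {1..k}" "b \<in> {1..k}" "a \<noteq> b"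
    and xy: "x \<in> space M" "y \<in> space M"
  shows "t_ind M k F a b W x y \<ge> 0"
proof -
  have "induced_weight k F W (fun_upd (fun_upd \<omega> a x) b y) \<ge> 0"
    if \<omega>: "\<omega> \<in> space (Pi\<^sub>M ({1..k} - {a, b}) (\<lambda>_. M))" for \<omega>
  proof -
    let ?z = "fun_upd (fun_upd \<omega> a x) b y"
    have z: "?z i \<in> space M" if "i \<in> {1..k}" for i
      using that xy \<omega> by (auto simp: space_PiM PiE_iff)
    have "0 \<le> edge_value W ?z e \<and> edge_value W ?z e \<le> 1" if "e \<in> complete_on k" for e
      using W z[OF Min_Max_complete_on(1)[OF that]] z[OF Min_Max_complete_on(2)[OF that]]
      unfolding graphon_def edge_value_def by blast
    then show ?thesis unfolding sample_weight_def by (intro prod_nonneg) auto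
  qed
  then show ?thesis unfolding t_ind_eq by (intro Bochner_Integration.integral_nonneg)
qed

text \<open>If W x y = 0, a sampled graph cannot contain the root edge, so the rule can only create
  it; if W x y = 1, the rule can only remove it. The velocity thus points into [0,1] at the
  boundary.\<close>

lemma velocity_sign:
  assumes W: "graphon M W" and xy: "x \<in> space M" "y \<in> space M"
  shows "W x y = 0 \<Longrightarrow> vel k W x y \<ge> 0" and "W x y = 1 \<Longrightarrow> vel k W x y \<le> 0"
proof -
  have K: "kernel M W" using W by (simp add: graphon_def)
  show "vel k W x y \<ge> 0" if "W x y = 0"
    unfolding velocity_extremist
  proof (intro sum_nonneg)
    fix F a b assume "a \<in> {1..k}" "b \<in> {1..k} - {a}"
    then have ab: "a \<in> {1..k}" "b \<in> {1..k}" "a \<noteq> b" by auto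
    show "drift k F {a, b} * t_ind M k F a b W x y \<ge> 0"
    proof (cases "{a, b} \<in> F")
      case True
      then show ?thesis using t_ind_eq_0[OF K ab xy, of F] that by simp
    next
      case False
      then show ?thesis using t_ind_nonneg[OF W ab xy, of F] by (auto simp: drift_def)
    qed
  qed
  show "vel k W x y \<le> 0" if "W x y = 1"
    unfolding velocity_extremist
  proof (intro sum_nonpos)
    fix F a b assume "a \<in> {1..k}" "b \<in> {1..k} - {a}"
    then have ab: "a \<in> {1..k}" "b \<in> {1..k}" "a \<noteq> b" by auto
    show "drift k F {a, b} * t_ind M k F a b W x y \<le> 0"
    proof (cases "{a, b} \<in> F")
      case False
      then show ?thesis using t_ind_eq_0[OF K ab xy, of F] that by simp
    next
      case True
      then show ?thesis using t_ind_nonneg[OF W ab xy, of F] by (auto simp: drift_def)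
    qed
  qed
qed

end

section \<open>Invariance and uniqueness of trajectories\<close>

definition clamp01 :: "real \<Rightarrow> real" where
  "clamp01 x = max 0 (min 1 x)"

lemma clamp01_bounds: "0 \<le> clamp01 x" "clamp01 x \<le> 1"
  by (auto simp: clamp01_def)

lemma clamp01_eq_iff: "x - clamp01 x = 0 \<longleftrightarrow> 0 \<le> x \<and> x \<le> 1"
  by (auto simp: clamp01_def)

lemma continuous_clamp01: "continuous_on UNIV clamp01"
  unfolding clamp01_def[abs_def] by (intro continuous_intros)

text \<open>\<open>clamp01\<close> is the nearest-point projection onto [0,1]. The upper bound holds
  since b is no farther from its own projection than from that of a. The lower bound is the
  variational inequality of the projection: a - \<open>clamp01\<close> a has nonpositive product
  with every displacement from \<open>clamp01\<close> a to a point of [0,1].\<close>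

lemma clamp01_taylor:
  "\<bar>(b - clamp01 b)\<^sup>2 - (a - clamp01 a)\<^sup>2 - 2 * (a - clamp01 a) * (b - a)\<bar> \<le> 1 * (b - a)\<^sup>2"
proof -
  define ra rb where "ra = a - clamp01 a" and "rb = b - clamp01 b"
  have "\<bar>rb\<bar> \<le> \<bar>b - clamp01 a\<bar>"
    unfolding rb_def clamp01_def by (auto simp: max_def min_def)
  then have "rb\<^sup>2 \<le> (b - clamp01 a)\<^sup>2"
    by (simp add: abs_le_square_iff)
  also have "\<dots> = ra\<^sup>2 + 2 * ra * (b - a) + (b - a)\<^sup>2"
    by (simp add: ra_def power2_eq_square algebra_simps)
  finally have upper: "rb\<^sup>2 - ra\<^sup>2 - 2 * ra * (b - a) \<le> (b - a)\<^sup>2" by simp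
  have "ra * (clamp01 b - clamp01 a) \<le> 0"
    unfolding ra_def clamp01_def by (auto simp: max_def min_def mult_le_0_iff)
  moreover have "rb\<^sup>2 - ra\<^sup>2 - 2 * ra * (b - a) = (rb - ra)\<^sup>2 - 2 * (ra * (clamp01 b - clamp01 a))"
    by (simp add: ra_def rb_def power2_eq_square algebra_simps)
  ultimately have "rb\<^sup>2 - ra\<^sup>2 - 2 * ra * (b - a) \<ge> 0"
    by (smt (verit) zero_le_power2)
  then show ?thesis using upper by (simp add: ra_def rb_def)
qed

lemma square_taylor: "\<bar>b\<^sup>2 - a\<^sup>2 - 2 * a * (b - a)\<bar> \<le> 1 * (b - a)\<^sup>2" for a b :: real
proof -
  have "b\<^sup>2 - a\<^sup>2 - 2 * a * (b - a) = (b - a)\<^sup>2" by (simp add: power2_eq_square algebra_simps)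
  then show ?thesis by simp
qed

lemma Linf_deriv_diff:
  assumes "Linf_deriv N u v t" "Linf_deriv N u' v' t"
  shows "Linf_deriv N (\<lambda>s p. u s p - u' s p) (\<lambda>p. v p - v' p) t"
  unfolding Linf_deriv_def
proof (intro allI impI)
  fix \<epsilon> :: real assume "\<epsilon> > 0"
  then have e: "\<epsilon> / 2 > 0" by simp
  obtain d where d: "d > 0" "\<forall>s\<ge>0. s \<noteq> t \<longrightarrow> \<bar>s - t\<bar> < d \<longrightarrow> (AE p in N. \<bar>(u s p - u t p) / (s - t) - v p\<bar> \<le> \<epsilon> / 2)"
    using assms(1) e unfolding Linf_deriv_def by blast
  obtain d' where d': "d' > 0" "\<forall>s\<ge>0. s \<noteq> t \<longrightarrow> \<bar>s - t\<bar> < d' \<longrightarrow> (AE p in N. \<bar>(u' s p - u' t p) / (s - t) - v' p\<bar> \<le> \<epsilon> / 2)"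
    using assms(2) e unfolding Linf_deriv_def by blast
  show "\<exists>\<delta>>0. \<forall>s\<ge>0. s \<noteq> t \<longrightarrow> \<bar>s - t\<bar> < \<delta> \<longrightarrow>
      (AE p in N. \<bar>(u s p - u' s p - (u t p - u' t p)) / (s - t) - (v p - v' p)\<bar> \<le> \<epsilon>)"
  proof (intro exI[of _ "min d d'"] conjI allI impI)
    fix s :: real assume s: "s \<ge> 0" "s \<noteq> t" "\<bar>s - t\<bar> < min d d'"
    have "AE p in N. \<bar>(u s p - u t p) / (s - t) - v p\<bar> \<le> \<epsilon> / 2"
      "AE p in N. \<bar>(u' s p - u' t p) / (s - t) - v' p\<bar> \<le> \<epsilon> / 2"
      using d(2) d'(2) s by simp_all
    then show "AE p in N. \<bar>(u s p - u' s p - (u t p - u' t p)) / (s - t) - (v p - v' p)\<bar> \<le> \<epsilon>"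
    proof eventually_elim
      case (elim p)
      have "(u s p - u' s p - (u t p - u' t p)) / (s - t) - (v p - v' p)
          = ((u s p - u t p) / (s - t) - v p) - ((u' s p - u' t p) / (s - t) - v' p)"
        by (simp add: diff_divide_distrib)
      then show ?case using elim by linarith
    qed
  qed (use d d' in simp)
qed

lemma Linf_deriv_shift:
  assumes "Linf_deriv N u v (T + t)" "T \<ge> 0"
  shows "Linf_deriv N (\<lambda>s. u (T + s)) v t"
  unfolding Linf_deriv_def
proof (intro allI impI)
  fix \<epsilon> :: real assume "\<epsilon> > 0"
  then obtain d where d: "d > 0" "\<forall>s\<ge>0. s \<noteq> T + t \<longrightarrow> \<bar>s - (T + t)\<bar> < d \<longrightarrow>
      (AE p in N. \<bar>(u s p - u (T + t) p) / (s - (T + t)) - v p\<bar> \<le> \<epsilon>)"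
    using assms(1) unfolding Linf_deriv_def by blast
  have "AE p in N. \<bar>(u (T + s) p - u (T + t) p) / (s - t) - v p\<bar> \<le> \<epsilon>"
    if "s \<ge> 0" "s \<noteq> t" "\<bar>s - t\<bar> < d" for s
    using d(2)[rule_format, of "T + s"] that assms(2) by simp
  then show "\<exists>\<delta>>0. \<forall>s\<ge>0. s \<noteq> t \<longrightarrow> \<bar>s - t\<bar> < \<delta> \<longrightarrow>
      (AE p in N. \<bar>(u (T + s) p - u (T + t) p) / (s - t) - v p\<bar> \<le> \<epsilon>)"
    using d(1) by blast
qed

lemma Linf_deriv_complement:
  assumes "Linf_deriv N u v t"
  shows "Linf_deriv N (\<lambda>s p. 1 - u s p) (\<lambda>p. - v p) t"
proof -
  have "Linf_deriv N (\<lambda>_ _. 1) (\<lambda>_. 0) t"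
    unfolding Linf_deriv_def by (auto intro!: exI[of _ 1])
  from Linf_deriv_diff[OF this assms] show ?thesis by simp
qed

lemma kernel_comp:
  assumes W: "kernel M W" and G: "continuous_on UNIV G"
  shows "kernel M (\<lambda>x y. G (W x y))"
proof -
  obtain B where B: "B \<ge> 0" "\<And>x y. x \<in> space M \<Longrightarrow> y \<in> space M \<Longrightarrow> \<bar>W x y\<bar> \<le> B"
    using kernel_bounded[OF W] by blast
  have "bounded_measurable (M \<Otimes>\<^sub>M M) (\<lambda>(x, y). W x y)"
    using B by (intro bounded_measurableI[of _ _ B] kernel_measurable[OF W]) (auto simp: space_pair_measure)
  from bounded_measurable_continuous[OF G this]
  have bm: "bounded_measurable (M \<Otimes>\<^sub>M M) (\<lambda>(x, y). G (W x y))"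
    by (simp add: case_prod_unfold)
  then obtain C where C: "C \<ge> 0" "\<And>x y. x \<in> space M \<Longrightarrow> y \<in> space M \<Longrightarrow> \<bar>G (W x y)\<bar> \<le> C"
    using bounded_measurable_pairE[OF bm] by blast
  show ?thesis
    unfolding kernel_def
  proof (intro conjI)
    show "(\<lambda>(x, y). G (W x y)) \<in> borel_measurable (M \<Otimes>\<^sub>M M)"
      using bm by (rule bounded_measurableD)
    show "\<forall>x\<in>space M. \<forall>y\<in>space M. G (W x y) = G (W y x)"
      using W by (simp add: kernel_def)
    show "\<exists>B. \<forall>x\<in>space M. \<forall>y\<in>space M. \<bar>G (W x y)\<bar> \<le> B"
      using C(2) by blast
  qed
qed

text \<open>Clamping at every point yields a graphon in the strict sense of the definition, so
  \<open>velocity_sign\<close> applies to it at every pair of points.\<close>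

lemma graphon_clamp01:
  assumes "kernel M W"
  shows "graphon M (\<lambda>x y. clamp01 (W x y))"
  unfolding graphon_def using kernel_comp[OF assms continuous_clamp01] clamp01_bounds by simp

context prob_space
begin

text \<open>The differential equation without an initial condition. In this form it is preserved by
  time shifts and, by the symmetry of the rule, by complementation.\<close>

definition flow :: "nat \<Rightarrow> (real \<Rightarrow> 'a \<Rightarrow> 'a \<Rightarrow> real) \<Rightarrow> bool" where
  "flow k \<Phi> \<longleftrightarrow> (\<forall>t\<ge>0. kernel M (\<Phi> t) \<and>
     Linf_deriv (M \<Otimes>\<^sub>M M) (\<lambda>s (x, y). \<Phi> s x y) (\<lambda>(x, y). vel k (\<Phi> t) x y) t)"

lemma flow_kernel: "flow k \<Phi> \<Longrightarrow> t \<ge> 0 \<Longrightarrow> kernel M (\<Phi> t)"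
  by (simp add: flow_def)

lemma flow_Linf_deriv:
  "flow k \<Phi> \<Longrightarrow> t \<ge> 0 \<Longrightarrow> Linf_deriv (M \<Otimes>\<^sub>M M) (\<lambda>s (x, y). \<Phi> s x y) (\<lambda>(x, y). vel k (\<Phi> t) x y) t"
  by (simp add: flow_def)

lemma flow_of_trajectory:
  assumes "is_trajectory M k (extremist_rule k) W \<Phi>"
  shows "flow k \<Phi>"
  unfolding flow_def
proof (intro allI impI conjI)
  fix t :: real assume t: "t \<ge> 0"
  show "kernel M (\<Phi> t)" using assms t by (simp add: is_trajectory_def)
  let ?f = "\<lambda>s x y. (\<Phi> s x y - \<Phi> t x y) / (s - t) - vel k (\<Phi> t) x y"
  have lim: "((\<lambda>s. Linf_norm M (?f s)) \<longlongrightarrow> 0) (at t within {0..})"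
    using assms t by (simp add: is_trajectory_def)
  show "Linf_deriv (M \<Otimes>\<^sub>M M) (\<lambda>s (x, y). \<Phi> s x y) (\<lambda>(x, y). vel k (\<Phi> t) x y) t"
    unfolding Linf_deriv_def
  proof (intro allI impI)
    fix \<epsilon> :: real assume "\<epsilon> > 0"
    then have "eventually (\<lambda>s. Linf_norm M (?f s) < ereal \<epsilon>) (at t within {0..})"
      by (intro order_tendstoD(2)[OF lim]) simp
    then obtain d where d: "d > 0" "\<And>s. s \<ge> 0 \<Longrightarrow> s \<noteq> t \<Longrightarrow> \<bar>s - t\<bar> < d \<Longrightarrow> Linf_norm M (?f s) < ereal \<epsilon>"
      unfolding eventually_at dist_real_def by auto
    have "AE p in M \<Otimes>\<^sub>M M. \<bar>((case p of (x, y) \<Rightarrow> \<Phi> s x y) - (case p of (x, y) \<Rightarrow> \<Phi> t x y)) / (s - t)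
        - (case p of (x, y) \<Rightarrow> vel k (\<Phi> t) x y)\<bar> \<le> \<epsilon>" if s: "s \<ge> 0" "s \<noteq> t" "\<bar>s - t\<bar> < d" for s
      using esssup_AE[where M = "M \<Otimes>\<^sub>M M" and f = "\<lambda>(x, y). ereal \<bar>?f s x y\<bar>"]
    proof eventually_elim
      case (elim p)
      then have "(case p of (x, y) \<Rightarrow> ereal \<bar>?f s x y\<bar>) < ereal \<epsilon>"
        using d(2)[OF s] unfolding Linf_norm_def by (rule le_less_trans)
      then show ?case by (cases p) simp
    qed
    then show "\<exists>\<delta>>0. \<forall>s\<ge>0. s \<noteq> t \<longrightarrow> \<bar>s - t\<bar> < \<delta> \<longrightarrow>
        (AE p in M \<Otimes>\<^sub>M M. \<bar>((case p of (x, y) \<Rightarrow> \<Phi> s x y) - (case p of (x, y) \<Rightarrow> \<Phi> t x y)) / (s - t)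
        - (case p of (x, y) \<Rightarrow> vel k (\<Phi> t) x y)\<bar> \<le> \<epsilon>)"
      using d(1) by blast
  qed
qed

lemma flow_shift:
  assumes "flow k \<Phi>" "T \<ge> 0"
  shows "flow k (\<lambda>s. \<Phi> (T + s))"
  unfolding flow_def
proof (intro allI impI conjI)
  fix t :: real assume t: "t \<ge> 0"
  show "kernel M (\<Phi> (T + t))" using assms t by (intro flow_kernel) auto
  show "Linf_deriv (M \<Otimes>\<^sub>M M) (\<lambda>s (x, y). \<Phi> (T + s) x y) (\<lambda>(x, y). vel k (\<Phi> (T + t)) x y) t"
    using assms t by (intro Linf_deriv_shift[where u = "\<lambda>s (x, y). \<Phi> s x y"] flow_Linf_deriv) auto
qed

lemma flow_complement:
  assumes "flow k \<Phi>"
  shows "flow k (\<lambda>s x y. 1 - \<Phi> s x y)"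
  unfolding flow_def
proof (intro allI impI conjI)
  fix t :: real assume t: "t \<ge> 0"
  have "continuous_on UNIV (\<lambda>x::real. 1 - x)" by (intro continuous_intros)
  from kernel_comp[OF flow_kernel[OF assms t] this] show "kernel M (\<lambda>x y. 1 - \<Phi> t x y)" .
  from Linf_deriv_complement[OF flow_Linf_deriv[OF assms t]]
  show "Linf_deriv (M \<Otimes>\<^sub>M M) (\<lambda>s (x, y). 1 - \<Phi> s x y) (\<lambda>(x, y). vel k (\<lambda>x y. 1 - \<Phi> t x y) x y) t"
    unfolding velocity_extremist_complement by (simp add: case_prod_unfold)
qed

lemma flow_integral_deriv:
  assumes \<Phi>: "flow k \<Phi>" and t: "t \<ge> 0"
    and G: "continuous_on UNIV G" and G': "continuous_on UNIV G'"
    and taylor: "\<And>a b. \<bar>G b - G a - G' a * (b - a)\<bar> \<le> K * (b - a)\<^sup>2"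
  shows "((\<lambda>s. \<integral>(x, y). G (\<Phi> s x y) \<partial>(M \<Otimes>\<^sub>M M)) has_real_derivative
     (\<integral>(x, y). G' (\<Phi> t x y) * vel k (\<Phi> t) x y \<partial>(M \<Otimes>\<^sub>M M))) (at t within {0..})"
proof -
  interpret MM: prob_space "M \<Otimes>\<^sub>M M" by (rule prob_space_pair)
  show ?thesis
    using MM.has_derivative_integral[OF t flow_Linf_deriv[OF \<Phi> t]
        kernel_bounded_measurable[OF flow_kernel[OF \<Phi>]] velocity_bounded_measurable[OF flow_kernel[OF \<Phi> t]] G G' taylor]
    by (simp add: case_prod_unfold)
qed

text \<open>Let c be the clamped kernel. The derivative of the squared distance tests the velocity
  at \<Phi> against \<Phi> - c. By \<open>velocity_sign\<close> the product of \<Phi> - c with the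
  velocity at c is nonpositive, so that velocity may be subtracted, and the L^2 Lipschitz bound for
  \<Phi> and c gives Gronwall's hypothesis.\<close>

lemma flow_stays_in_unit_interval:
  assumes \<Phi>: "flow k \<Phi>" and init: "AE (x, y) in M \<Otimes>\<^sub>M M. 0 \<le> \<Phi> 0 x y \<and> \<Phi> 0 x y \<le> 1" and T: "T \<ge> 0"
  shows "AE (x, y) in M \<Otimes>\<^sub>M M. 0 \<le> \<Phi> T x y \<and> \<Phi> T x y \<le> 1"
proof -
  interpret MM: prob_space "M \<Otimes>\<^sub>M M" by (rule prob_space_pair)
  let ?c = "\<lambda>t x y. clamp01 (\<Phi> t x y)"
  let ?G = "\<lambda>x. (x - clamp01 x)\<^sup>2" and ?G' = "\<lambda>x. 2 * (x - clamp01 x)"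
  let ?g = "\<lambda>t. \<integral>(x, y). ?G (\<Phi> t x y) \<partial>(M \<Otimes>\<^sub>M M)"
  let ?g' = "\<lambda>t. \<integral>(x, y). ?G' (\<Phi> t x y) * vel k (\<Phi> t) x y \<partial>(M \<Otimes>\<^sub>M M)"
  have contG: "continuous_on UNIV ?G" and contG': "continuous_on UNIV ?G'"
    by (intro continuous_intros continuous_clamp01)+
  have "\<exists>B0. \<forall>s. 0 \<le> s \<and> s \<le> T \<longrightarrow> (AE p in M \<Otimes>\<^sub>M M. \<bar>case p of (x, y) \<Rightarrow> \<Phi> s x y\<bar> \<le> B0)"
  proof (rule Linf_deriv_locally_bounded[where v = "\<lambda>t (x, y). vel k (\<Phi> t) x y", OF _ _ _ T])
    fix t :: real assume t: "t \<ge> 0"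
    show "Linf_deriv (M \<Otimes>\<^sub>M M) (\<lambda>s (x, y). \<Phi> s x y) (\<lambda>(x, y). vel k (\<Phi> t) x y) t"
      by (rule flow_Linf_deriv[OF \<Phi> t])
    show "bounded_measurable (M \<Otimes>\<^sub>M M) (\<lambda>(x, y). \<Phi> t x y)"
      by (rule kernel_bounded_measurable[OF flow_kernel[OF \<Phi> t]])
    show "bounded_measurable (M \<Otimes>\<^sub>M M) (\<lambda>(x, y). vel k (\<Phi> t) x y)"
      by (rule velocity_bounded_measurable[OF flow_kernel[OF \<Phi> t]])
  qed
  then obtain B0 where B0: "\<forall>s. 0 \<le> s \<and> s \<le> T \<longrightarrow> (AE p in M \<Otimes>\<^sub>M M. \<bar>case p of (x, y) \<Rightarrow> \<Phi> s x y\<bar> \<le> B0)" ..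
  \<comment> \<open>Chosen because |u| + |1 - u| \<le> 1 + 2 |u|. It depends on T, which is harmless
    since T is fixed.\<close>
  define B where "B = 1 + 2 * \<bar>B0\<bar>"
  define L where "L = 2 * (2 * B ^ (k choose 2) * (real k ^ 2 * real (k choose 2)))"
  have G_bm: "bounded_measurable (M \<Otimes>\<^sub>M M) (\<lambda>(x, y). ?G (\<Phi> t x y))" if "t \<ge> 0" for t
    using bounded_measurable_continuous[OF contG kernel_bounded_measurable[OF flow_kernel[OF \<Phi> that]]]
    by (simp add: case_prod_unfold)
  have "?g T \<le> 0"
  proof (rule gronwall_zero[where g' = ?g' and L = L, OF _ _ _ T])
    show "(?g has_real_derivative ?g' t) (at t within {0..})" if "0 \<le> t" "t \<le> T" for t
      by (rule flow_integral_deriv[OF \<Phi> that(1) contG contG' clamp01_taylor])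
    have "AE (x, y) in M \<Otimes>\<^sub>M M. ?G (\<Phi> 0 x y) = 0"
      using init by eventually_elim (auto simp: clamp01_eq_iff[symmetric])
    then have "?g 0 = 0" by (intro integral_eq_zero_AE) (simp add: case_prod_unfold)
    then show "?g 0 \<le> 0" by simp
  next
    fix t assume t: "0 \<le> t" "t \<le> T"
    have K: "kernel M (\<Phi> t)" using flow_kernel[OF \<Phi> t(1)] .
    have gc: "graphon M (?c t)" using graphon_clamp01[OF K] .
    then have Kc: "kernel M (?c t)" by (simp add: graphon_def)
    have bmd: "bounded_measurable (M \<Otimes>\<^sub>M M) (\<lambda>(x, y). \<Phi> t x y - ?c t x y)"
      using bounded_measurable_diff[OF kernel_bounded_measurable[OF K] kernel_bounded_measurable[OF Kc]]
      by (simp add: case_prod_unfold)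
    have bmv: "bounded_measurable (M \<Otimes>\<^sub>M M) (\<lambda>(x, y). (\<Phi> t x y - ?c t x y) * (vel k (\<Phi> t) x y - vel k (?c t) x y))"
      using bounded_measurable_mult[OF bmd bounded_measurable_diff[OF velocity_bounded_measurable[OF K] velocity_bounded_measurable[OF Kc]]]
      by (simp add: case_prod_unfold)
    have bmv1: "bounded_measurable (M \<Otimes>\<^sub>M M) (\<lambda>(x, y). (\<Phi> t x y - ?c t x y) * vel k (\<Phi> t) x y)"
      using bounded_measurable_mult[OF bmd velocity_bounded_measurable[OF K]]
      by (simp add: case_prod_unfold)
    have "?g' t = 2 * (\<integral>(x, y). (\<Phi> t x y - ?c t x y) * vel k (\<Phi> t) x y \<partial>(M \<Otimes>\<^sub>M M))"
      by (simp only: case_prod_unfold mult.assoc integral_mult_right_zero)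
    also have "\<dots> \<le> 2 * (\<integral>(x, y). (\<Phi> t x y - ?c t x y) * (vel k (\<Phi> t) x y - vel k (?c t) x y) \<partial>(M \<Otimes>\<^sub>M M))"
    proof (intro mult_left_mono integral_mono MM.integrable_bounded_measurable bmv bmv1)
      fix p assume "p \<in> space (M \<Otimes>\<^sub>M M)"
      then obtain x y where p: "p = (x, y)" "x \<in> space M" "y \<in> space M"
        by (auto simp: space_pair_measure)
      have "(\<Phi> t x y - ?c t x y) * vel k (?c t) x y \<le> 0"
      proof -
        consider "\<Phi> t x y < 0" | "\<Phi> t x y > 1" | "0 \<le> \<Phi> t x y \<and> \<Phi> t x y \<le> 1" by linarith
        then show ?thesis
        proof cases
          case 1
          then have "?c t x y = 0" by (simp add: clamp01_def)
          then show ?thesis using velocity_sign(1)[OF gc p(2,3), of k] 1 by (simp add: mult_le_0_iff)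
        next
          case 2
          then have "?c t x y = 1" by (simp add: clamp01_def)
          then show ?thesis using velocity_sign(2)[OF gc p(2,3), of k] 2 by (simp add: mult_le_0_iff)
        next
          case 3
          then show ?thesis using clamp01_eq_iff[of "\<Phi> t x y"] by simp
        qed
      qed
      then show "(case p of (x, y) \<Rightarrow> (\<Phi> t x y - ?c t x y) * vel k (\<Phi> t) x y)
          \<le> (case p of (x, y) \<Rightarrow> (\<Phi> t x y - ?c t x y) * (vel k (\<Phi> t) x y - vel k (?c t) x y))"
        by (simp add: p(1) right_diff_distrib)
    qed simp
    also have "\<dots> \<le> 2 * (2 * B ^ (k choose 2) * (real k ^ 2 * real (k choose 2)) * ?g t)"
    proof (intro mult_left_mono velocity_L2_Lipschitz K Kc)
      show "1 \<le> B" by (simp add: B_def)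
      have "AE p in M \<Otimes>\<^sub>M M. \<bar>case p of (x, y) \<Rightarrow> \<Phi> t x y\<bar> \<le> B0" using B0 t by blast
      then show "AE (x, y) in M \<Otimes>\<^sub>M M. \<bar>\<Phi> t x y\<bar> + \<bar>1 - \<Phi> t x y\<bar> \<le> B"
        by eventually_elim (auto simp: B_def)
      show "AE (x, y) in M \<Otimes>\<^sub>M M. \<bar>?c t x y\<bar> + \<bar>1 - ?c t x y\<bar> \<le> B"
        by (intro AE_I2) (auto simp: B_def clamp01_bounds)
    qed simp
    finally show "?g' t \<le> L * ?g t" by (simp add: L_def mult_ac)
  qed
  moreover have nonneg: "AE p in M \<Otimes>\<^sub>M M. 0 \<le> (case p of (x, y) \<Rightarrow> ?G (\<Phi> T x y))"
    by (intro AE_I2) (auto split: prod.split)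
  ultimately have "?g T = 0" by (intro antisym integral_nonneg_AE)
  then have "AE p in M \<Otimes>\<^sub>M M. (case p of (x, y) \<Rightarrow> ?G (\<Phi> T x y)) = 0"
    using integral_nonneg_eq_0_iff_AE[OF MM.integrable_bounded_measurable[OF G_bm[OF T]] nonneg] by simp
  then show ?thesis by eventually_elim (auto simp: clamp01_eq_iff[symmetric])
qed

text \<open>Both curves are almost everywhere [0,1]-valued, so \<open>velocity_L2_Lipschitz\<close>
  holds with B = 1 along the whole curves.\<close>

lemma flow_unique:
  assumes \<Phi>: "flow k \<Phi>" and \<Psi>: "flow k \<Psi>"
    and \<Phi>01: "\<And>t. t \<ge> 0 \<Longrightarrow> AE (x, y) in M \<Otimes>\<^sub>M M. 0 \<le> \<Phi> t x y \<and> \<Phi> t x y \<le> 1"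
    and \<Psi>01: "\<And>t. t \<ge> 0 \<Longrightarrow> AE (x, y) in M \<Otimes>\<^sub>M M. 0 \<le> \<Psi> t x y \<and> \<Psi> t x y \<le> 1"
    and init: "AE (x, y) in M \<Otimes>\<^sub>M M. \<Phi> 0 x y = \<Psi> 0 x y" and T: "T \<ge> 0"
  shows "AE (x, y) in M \<Otimes>\<^sub>M M. \<Phi> T x y = \<Psi> T x y"
proof -
  interpret MM: prob_space "M \<Otimes>\<^sub>M M" by (rule prob_space_pair)
  let ?g = "\<lambda>t. \<integral>(x, y). (\<Phi> t x y - \<Psi> t x y)\<^sup>2 \<partial>(M \<Otimes>\<^sub>M M)"
  let ?g' = "\<lambda>t. \<integral>(x, y). 2 * (\<Phi> t x y - \<Psi> t x y) * (vel k (\<Phi> t) x y - vel k (\<Psi> t) x y) \<partial>(M \<Otimes>\<^sub>M M)"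
  define L where "L = 2 * (2 * 1 ^ (k choose 2) * (real k ^ 2 * real (k choose 2)))"
  have bm: "bounded_measurable (M \<Otimes>\<^sub>M M) (\<lambda>p. (case p of (x, y) \<Rightarrow> \<Phi> t x y) - (case p of (x, y) \<Rightarrow> \<Psi> t x y))"
    if "t \<ge> 0" for t
    by (intro bounded_measurable_diff kernel_bounded_measurable flow_kernel[OF \<Phi>] flow_kernel[OF \<Psi>] that)
  have bm2: "bounded_measurable (M \<Otimes>\<^sub>M M) (\<lambda>(x, y). (\<Phi> t x y - \<Psi> t x y)\<^sup>2)" if "t \<ge> 0" for t
    using bounded_measurable_mult[OF bm[OF that] bm[OF that]] by (simp add: case_prod_unfold power2_eq_square)
  have "?g T \<le> 0"
  proof (rule gronwall_zero[where g' = ?g' and L = L, OF _ _ _ T])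
    show "(?g has_real_derivative ?g' t) (at t within {0..})" if "0 \<le> t" "t \<le> T" for t
    proof -
      have bmv: "bounded_measurable (M \<Otimes>\<^sub>M M) (\<lambda>p. (case p of (x, y) \<Rightarrow> vel k (\<Phi> t) x y) - (case p of (x, y) \<Rightarrow> vel k (\<Psi> t) x y))"
        using that by (intro bounded_measurable_diff velocity_bounded_measurable flow_kernel[OF \<Phi>] flow_kernel[OF \<Psi>])
      have 1: "continuous_on UNIV (\<lambda>x::real. x\<^sup>2)" "continuous_on UNIV (\<lambda>x::real. 2 * x)"
        by (intro continuous_intros)+
      show ?thesis
        using MM.has_derivative_integral[OF that(1)
            Linf_deriv_diff[OF flow_Linf_deriv[OF \<Phi> that(1)] flow_Linf_deriv[OF \<Psi> that(1)]] bm bmv 1 square_taylor]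
        by (simp add: case_prod_unfold)
    qed
    have "AE (x, y) in M \<Otimes>\<^sub>M M. (\<Phi> 0 x y - \<Psi> 0 x y)\<^sup>2 = 0"
      using init by eventually_elim auto
    then have "?g 0 = 0" by (intro integral_eq_zero_AE) (simp add: case_prod_unfold)
    then show "?g 0 \<le> 0" by simp
  next
    fix t assume t: "0 \<le> t" "t \<le> T"
    have "?g' t = 2 * (\<integral>(x, y). (\<Phi> t x y - \<Psi> t x y) * (vel k (\<Phi> t) x y - vel k (\<Psi> t) x y) \<partial>(M \<Otimes>\<^sub>M M))"
      by (simp only: case_prod_unfold mult.assoc integral_mult_right_zero)
    also have "\<dots> \<le> 2 * (2 * 1 ^ (k choose 2) * (real k ^ 2 * real (k choose 2)) * ?g t)"
    proof (intro mult_left_mono velocity_L2_Lipschitz flow_kernel[OF \<Phi>] flow_kernel[OF \<Psi>] t)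
      show "AE (x, y) in M \<Otimes>\<^sub>M M. \<bar>\<Phi> t x y\<bar> + \<bar>1 - \<Phi> t x y\<bar> \<le> 1"
        using \<Phi>01[OF t(1)] by eventually_elim auto
      show "AE (x, y) in M \<Otimes>\<^sub>M M. \<bar>\<Psi> t x y\<bar> + \<bar>1 - \<Psi> t x y\<bar> \<le> 1"
        using \<Psi>01[OF t(1)] by eventually_elim auto
    qed simp_all
    finally show "?g' t \<le> L * ?g t" by (simp add: L_def mult_ac)
  qed
  moreover have nonneg: "AE p in M \<Otimes>\<^sub>M M. 0 \<le> (case p of (x, y) \<Rightarrow> (\<Phi> T x y - \<Psi> T x y)\<^sup>2)"
    by (intro AE_I2) (auto split: prod.split)
  ultimately have "?g T = 0" by (intro antisym integral_nonneg_AE)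
  then have "AE p in M \<Otimes>\<^sub>M M. (case p of (x, y) \<Rightarrow> (\<Phi> T x y - \<Psi> T x y)\<^sup>2) = 0"
    using integral_nonneg_eq_0_iff_AE[OF MM.integrable_bounded_measurable[OF bm2[OF T]] nonneg] by simp
  then show ?thesis by eventually_elim auto
qed

end

section \<open>Halving an atomless space and the central limit theorem\<close>

text \<open>If B splits A into two parts of positive measure, one of B and A - B has at most half
  the measure of A. Iterating gets below every \<epsilon>.\<close>

lemma (in finite_measure) atomless_small_subset:
  assumes atomless: "atomless M" and A: "A \<in> sets M" "measure M A > 0" and \<epsilon>: "\<epsilon> > 0"
  shows "\<exists>B\<in>sets M. B \<subseteq> A \<and> 0 < measure M B \<and> measure M B < \<epsilon>"
proof -
  have half: "\<exists>B\<in>sets M. B \<subseteq> A \<and> 0 < measure M B \<and> measure M B \<le> measure M A / 2"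
    if A': "A \<in> sets M" "measure M A > 0" for A
  proof -
    have pos: "emeasure M A > 0" using that by (simp add: emeasure_eq_measure)
    obtain B where B: "B \<in> sets M" "B \<subseteq> A" "0 < emeasure M B" "emeasure M B < emeasure M A"
      using atomless[unfolded atomless_def, rule_format, OF A'(1) pos] by auto
    have b: "0 < measure M B" "measure M B < measure M A"
      using B(3,4)
      by (simp_all add: emeasure_eq_measure ennreal_less_iff)
    have d: "measure M (A - B) = measure M A - measure M B"
      using B that by (intro finite_measure_Diff) auto
    show ?thesis
    proof (cases "measure M B \<le> measure M A / 2")
      case True
      then show ?thesis using B b by blast
    next
      case False
      then have "0 < measure M (A - B)" "measure M (A - B) \<le> measure M A / 2" using b d by linarith+
      then show ?thesis using B that by blast
    qed
  qed
  have iter: "\<exists>B\<in>sets M. B \<subseteq> A \<and> 0 < measure M B \<and> measure M B \<le> measure M A / 2 ^ n" for n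
  proof (induction n)
    case 0
    then show ?case using A by auto
  next
    case (Suc n)
    then obtain B where B: "B \<in> sets M" "B \<subseteq> A" "0 < measure M B" "measure M B \<le> measure M A / 2 ^ n" by blast
    obtain C where C: "C \<in> sets M" "C \<subseteq> B" "0 < measure M C" "measure M C \<le> measure M B / 2"
      using half[OF B(1,3)] by blast
    have "measure M C \<le> measure M A / 2 ^ Suc n" using C(4) B(4) by simp
    then show ?case using B C by blast
  qed
  have "(\<lambda>n. measure M A * (1 / 2) ^ n) \<longlonglongrightarrow> measure M A * 0"
    by (intro tendsto_mult LIMSEQ_power_zero tendsto_const) auto
  then have "eventually (\<lambda>n. measure M A * (1 / 2) ^ n < \<epsilon>) sequentially"
    using \<epsilon> by (intro order_tendstoD(2)) auto
  then obtain n where "measure M A * (1 / 2) ^ n < \<epsilon>"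
    by (auto simp: eventually_sequentially)
  then show ?thesis using iter[of n] by (auto simp: power_divide intro: le_less_trans)
qed

text \<open>Sierpinski's theorem, by exhaustion: each step adds a set of at least half the largest measure
  that still fits below \<open>c\<close>, so a set that always fits must be null.\<close>

lemma (in finite_measure) atomless_intermediate_value:
  assumes atomless: "atomless M" and c: "0 \<le> c" "c \<le> measure M (space M)"
  shows "\<exists>A\<in>sets M. measure M A = c"
proof -
  have step: "\<exists>A'. (A' \<in> sets M \<and> measure M A' \<le> c) \<and> (A \<subseteq> A' \<and>
      (\<forall>C\<in>sets M. C \<inter> A = {} \<and> measure M A + measure M C \<le> c \<longrightarrow> measure M C \<le> 2 * (measure M A' - measure M A)))"
    if A: "A \<in> sets M \<and> measure M A \<le> c" for A
  proof -
    define S where "S = {measure M C |C. C \<in> sets M \<and> C \<inter> A = {} \<and> measure M A + measure M C \<le> c}"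
    have ne: "S \<noteq> {}" unfolding S_def using A by (auto intro!: exI[of _ "{}"])
    have bdd: "bdd_above S" unfolding S_def by (rule bdd_aboveI[of _ c]) (auto, smt (verit) measure_nonneg)
    have "\<exists>s\<in>S. Sup S \<le> 2 * s"
    proof (cases "Sup S > 0")
      case True
      then have "Sup S / 2 < Sup S" by simp
      then obtain s where "s \<in> S" "Sup S / 2 < s" using less_cSup_iff[OF ne bdd] by blast
      then show ?thesis by (intro bexI[of _ s]) auto
    next
      case False
      moreover have "0 \<in> S" unfolding S_def using A by (auto intro!: exI[of _ "{}"])
      ultimately show ?thesis by (intro bexI[of _ 0]) auto
    qed
    then obtain B where B: "B \<in> sets M" "B \<inter> A = {}" "measure M A + measure M B \<le> c" "Sup S \<le> 2 * measure M B"
      unfolding S_def by blast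
    have m: "measure M (A \<union> B) = measure M A + measure M B"
      using A B by (intro finite_measure_Union) auto
    have "measure M C \<le> 2 * (measure M (A \<union> B) - measure M A)"
      if "C \<in> sets M" "C \<inter> A = {} \<and> measure M A + measure M C \<le> c" for C
    proof -
      have "measure M C \<in> S" unfolding S_def using that by blast
      then have "measure M C \<le> Sup S" using bdd by (rule cSup_upper)
      then show ?thesis using B(4) m by simp
    qed
    then show ?thesis using A B m by (intro exI[of _ "A \<union> B"]) auto
  qed
  have "\<exists>A. \<forall>n. (A n \<in> sets M \<and> measure M (A n) \<le> c) \<and> (A n \<subseteq> A (Suc n) \<and>
      (\<forall>C\<in>sets M. C \<inter> A n = {} \<and> measure M (A n) + measure M C \<le> c \<longrightarrow>
          measure M C \<le> 2 * (measure M (A (Suc n)) - measure M (A n))))"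
    using c by (intro dependent_nat_choice[of "\<lambda>n A. A \<in> sets M \<and> measure M A \<le> c"] step) (auto intro!: exI[of _ "{}"])
  then obtain A where A: "\<And>n. A n \<in> sets M" "\<And>n. measure M (A n) \<le> c" "\<And>n. A n \<subseteq> A (Suc n)"
    and large: "\<And>n C. C \<in> sets M \<Longrightarrow> C \<inter> A n = {} \<Longrightarrow> measure M (A n) + measure M C \<le> c \<Longrightarrow>
          measure M C \<le> 2 * (measure M (A (Suc n)) - measure M (A n))"
    by blast
  let ?U = "\<Union>n. A n"
  have U: "?U \<in> sets M" using A(1) by blast
  have lim: "(\<lambda>n. measure M (A n)) \<longlonglongrightarrow> measure M ?U"
    using A by (intro finite_Lim_measure_incseq) (auto intro!: incseq_SucI)
  have le: "measure M ?U \<le> c" using A(2) by (intro LIMSEQ_le_const2[OF lim]) auto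
  have "\<not> measure M ?U < c"
  proof
    assume less: "measure M ?U < c"
    have "measure M (space M - ?U) = measure M (space M) - measure M ?U"
      using U by (rule finite_measure_compl)
    then have "measure M (space M - ?U) > 0" using less c by linarith
    then obtain C where C: "C \<in> sets M" "C \<subseteq> space M - ?U" "0 < measure M C" "measure M C < c - measure M ?U"
      using atomless_small_subset[OF atomless, of "space M - ?U" "c - measure M ?U"] U less by auto
    have C_le: "measure M C \<le> 2 * (measure M (A (Suc n)) - measure M (A n))" for n
    proof (rule large[OF C(1)])
      show "C \<inter> A n = {}" using C(2) by blast
      have "measure M (A n) \<le> measure M ?U" using U by (intro finite_measure_mono) auto
      then show "measure M (A n) + measure M C \<le> c" using C(4) by linarith
    qed
    have "(\<lambda>n. 2 * (measure M (A (Suc n)) - measure M (A n))) \<longlonglongrightarrow> 2 * (measure M ?U - measure M ?U)"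
      by (intro tendsto_intros lim LIMSEQ_Suc)
    from LIMSEQ_le_const[OF this] have "measure M C \<le> 0" using C_le by auto
    then show False using C(3) by simp
  qed
  then show ?thesis using U le by (intro bexI[of _ ?U]) auto
qed

text \<open>The bounds exp (- x^2 / 2) \<ge> 1 - x^2 / 2 and pi < 4 reduce the claim to a polynomial
  integral, whose value 2 (a - a^3 / 6) / sqrt 8 at a = 19/20 is just above 57/100. An endpoint
  below 1 is taken so that the closed end still lies strictly inside one standard deviation.\<close>

lemma std_normal_central_interval:
  "measure std_normal_distribution {-19/20<..19/20} \<ge> 57/100"
proof -
  interpret real_distribution std_normal_distribution by (rule real_dist_normal_dist)
  let ?f = "\<lambda>x::real. (1 - x\<^sup>2 / 2) / sqrt 8"
  let ?F = "\<lambda>x::real. (x - x ^ 3 / 6) / sqrt 8"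
  let ?a = "19/20 :: real"
  have dens: "?f x \<le> std_normal_density x" if "x \<in> {-?a..?a}" for x
  proof -
    have "x\<^sup>2 \<le> 1" using that by (auto simp: abs_square_le_1 abs_le_iff)
    then have "0 \<le> 1 - x\<^sup>2 / 2" by simp
    moreover have "1 - x\<^sup>2 / 2 \<le> exp (- x\<^sup>2 / 2)"
      using exp_ge_add_one_self[of "- x\<^sup>2 / 2"] by simp
    moreover have "sqrt (2 * pi) \<le> sqrt 8" using pi_less_4 by simp
    then have "1 / sqrt 8 \<le> 1 / sqrt (2 * pi)"
      by (intro divide_left_mono) auto
    ultimately have "1 / sqrt 8 * (1 - x\<^sup>2 / 2) \<le> 1 / sqrt (2 * pi) * exp (- x\<^sup>2 / 2)"
      by (intro mult_mono) auto
    then show ?thesis by (simp add: std_normal_density_def)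
  qed
  have "sqrt 8 \<le> 283/100"
    by (rule real_le_lsqrt) (auto simp: power2_eq_square)
  then have "57/100 \<le> ?F ?a - ?F (- ?a)"
    by (simp add: field_simps power3_eq_cube)
  then have "ennreal (57/100) \<le> ennreal (?F ?a - ?F (- ?a))" by (intro ennreal_leI)
  also have "\<dots> = (\<integral>\<^sup>+x. ennreal (?f x) * indicator {-?a..?a} x \<partial>lborel)"
  proof (rule nn_integral_FTC_Icc[symmetric])
    show "?f \<in> borel_measurable borel" by measurable
    show "(?F has_real_derivative ?f x) (at x)" for x
    proof -
      have "(?F has_real_derivative (1 - of_nat 3 * (1 * x ^ (3 - Suc 0)) / 6) / sqrt 8) (at x)"
        by (intro DERIV_cdivide DERIV_diff DERIV_ident DERIV_power)
      then show ?thesis by (simp add: numeral_2_eq_2)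
    qed
    show "0 \<le> ?f x" if "x \<in> {-?a..?a}" for x
    proof -
      have "x\<^sup>2 \<le> 1" using that by (auto simp: abs_square_le_1 abs_le_iff)
      then show ?thesis by simp
    qed
  qed simp
  also have "\<dots> \<le> (\<integral>\<^sup>+x. ennreal (std_normal_density x) * indicator {-?a..?a} x \<partial>lborel)"
    using dens by (intro nn_integral_mono) (auto simp: indicator_def intro!: ennreal_leI)
  also have "\<dots> = (\<integral>\<^sup>+x. ennreal (std_normal_density x) * indicator {-?a<..?a} x \<partial>lborel)"
  proof (rule nn_integral_cong_AE)
    show "AE x in lborel. ennreal (std_normal_density x) * indicator {-?a..?a} x
        = ennreal (std_normal_density x) * indicator {-?a<..?a} x"
      using AE_lborel_singleton[of "-?a"] by eventually_elim (auto simp: indicator_def)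
  qed
  also have "\<dots> = emeasure std_normal_distribution {-?a<..?a}"
    by (subst emeasure_density) auto
  finally show ?thesis by (simp add: emeasure_eq_measure)
qed

section \<open>The central limit theorem for balanced coins\<close>

context prob_space
begin

text \<open>The limit theorem needs one infinite sequence of coins, so it is applied on the
  countable product and the event is then pushed to the first k coordinates. The value 55/100 lies
  strictly between 1/2 and the 57/100 of the limit.\<close>

lemma coin_sum_small:
  assumes A: "A \<in> sets M" "prob A = 1/2"
  shows "\<exists>K. \<forall>k\<ge>K. measure (sample_space k)
     {z \<in> space (sample_space k). (\<Sum>i\<in>{1..k}. if z i \<in> A then 1 else -1 :: real)\<^sup>2 < real k} \<ge> 55/100"
proof -
  let ?\<Omega> = "Pi\<^sub>M (UNIV :: nat set) (\<lambda>_. M)"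
  interpret P: product_prob_space "\<lambda>_::nat. M" UNIV by (rule product_prob_space_const)
  interpret N: real_distribution std_normal_distribution by (rule real_dist_normal_dist)
  define f :: "'a \<Rightarrow> real" where "f x = (if x \<in> A then 1 else -1)" for x
  have f[measurable]: "f \<in> borel_measurable M" unfolding f_def[abs_def] using A(1) by measurable
  \<comment> \<open>The shift by \<open>Suc\<close> reconciles the sums over i < n in the limit
    theorem with the vertices {1..k}.\<close>
  define X where "X i \<omega> = f (\<omega> (Suc i))" for i :: nat and \<omega> :: "nat \<Rightarrow> 'a"
  have X[measurable]: "X i \<in> borel_measurable ?\<Omega>" for i unfolding X_def[abs_def] by measurable
  have comp: "distr ?\<Omega> M (\<lambda>\<omega>. \<omega> i) = M" for i
    by (rule distr_PiM_component[of UNIV "\<lambda>_. M"]) (auto intro: prob_space_axioms)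
  have ind0: "P.indep_vars (\<lambda>_. M) (\<lambda>i \<omega>. \<omega> (Suc i)) UNIV"
    using distr_PiM_reindex[of UNIV "\<lambda>_. M" Suc UNIV] prob_space_axioms
    by (subst P.indep_vars_iff_distr_eq_PiM) (simp_all add: comp)
  have ind: "P.indep_vars (\<lambda>_. borel) X UNIV"
    unfolding X_def[abs_def] by (rule P.indep_vars_compose2[OF ind0]) simp
  have EX: "P.expectation (\<lambda>\<omega>. g (f (\<omega> i))) = (g 1 + g (-1)) / 2" for g :: "real \<Rightarrow> real" and i
  proof -
    have "P.expectation (\<lambda>\<omega>. g (f (\<omega> i))) = (\<integral>x. g (f x) \<partial>(distr ?\<Omega> M (\<lambda>\<omega>. \<omega> i)))"
    proof (rule integral_distr[symmetric])
      have "(\<lambda>x. g (f x)) = (\<lambda>x. if x \<in> A then g 1 else g (-1))" by (auto simp: f_def)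
      then show "(\<lambda>x. g (f x)) \<in> borel_measurable M" using A(1) by simp
    qed simp
    also have "\<dots> = (\<integral>x. g (-1) + (g 1 - g (-1)) * indicator A x \<partial>M)"
      unfolding comp by (intro Bochner_Integration.integral_cong) (auto simp: f_def indicator_def)
    also have "\<dots> = g (-1) + (g 1 - g (-1)) * prob A"
      using A(1) by (subst Bochner_Integration.integral_add) (auto simp: prob_space emeasure_eq_measure)
    finally show ?thesis using A(2) by (simp add: field_simps)
  qed
  have clt: "weak_conv_m (\<lambda>n. distr ?\<Omega> borel (\<lambda>\<omega>. (\<Sum>i<n. X i \<omega>) / sqrt (real n * 1\<^sup>2))) std_normal_distribution"
  proof (rule P.central_limit_theorem_zero_mean[OF ind])
    show "P.expectation (X n) = 0" for n
      using EX[of "\<lambda>x. x" "Suc n"] by (simp add: X_def[abs_def])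
    then show "P.variance (X n) = 1\<^sup>2" for n
      using EX[of "\<lambda>x. x\<^sup>2" "Suc n"] by (simp add: X_def[abs_def])
    show "integrable ?\<Omega> (\<lambda>x. (X n x)\<^sup>2)" for n
      using borel_measurable_power[OF X[of n], of 2]
      by (intro P.integrable_const_bound[where B = 1]) (simp_all add: X_def f_def)
    show "distr ?\<Omega> borel (X n) = distr M borel f" for n
    proof -
      have "distr M borel f = distr (distr ?\<Omega> M (\<lambda>\<omega>. \<omega> (Suc n))) borel f" by (simp add: comp)
      also have "\<dots> = distr ?\<Omega> borel (X n)" by (subst distr_distr) (auto simp: comp_def X_def[abs_def])
      finally show ?thesis by simp
    qed
  qed simp
  define \<mu> where "\<mu> n = distr ?\<Omega> borel (\<lambda>\<omega>. (\<Sum>i<n. X i \<omega>) / sqrt (real n * 1\<^sup>2))" for n :: nat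
  have rd: "real_distribution (\<mu> n)" for n
    unfolding \<mu>_def by (intro P.real_distribution_distr) measurable
  \<comment> \<open>Weak convergence gives convergence of distribution functions only at continuity
    points of the limit, so the normal distribution has to be shown free of atoms.\<close>
  have cont: "isCont (cdf std_normal_distribution) x" for x
  proof -
    have "emeasure std_normal_distribution {x} = 0"
    proof -
      have "AE y in lborel. ennreal (std_normal_density y) * indicator {x} y = 0"
        using AE_lborel_singleton[of x] by eventually_elim (auto simp: indicator_def)
      then show ?thesis by (subst emeasure_density) (auto simp: nn_integral_0_iff_AE)
    qed
    then show ?thesis unfolding N.isCont_cdf by (simp add: measure_def)
  qed
  have lim: "(\<lambda>n. cdf (\<mu> n) x) \<longlonglongrightarrow> cdf std_normal_distribution x" for x
    using clt cont[of x] unfolding weak_conv_m_def weak_conv_def \<mu>_def by blast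
  let ?a = "19/20 :: real"
  have "(\<lambda>n. cdf (\<mu> n) ?a - cdf (\<mu> n) (-?a)) \<longlonglongrightarrow> cdf std_normal_distribution ?a - cdf std_normal_distribution (-?a)"
    by (intro tendsto_diff lim)
  moreover have "cdf std_normal_distribution ?a - cdf std_normal_distribution (-?a) > 55/100"
    using std_normal_central_interval by (subst N.cdf_diff_eq) auto
  ultimately have "eventually (\<lambda>n. cdf (\<mu> n) ?a - cdf (\<mu> n) (-?a) > 55/100) sequentially"
    by (rule order_tendstoD(1))
  then obtain K where K: "\<And>n. n \<ge> K \<Longrightarrow> cdf (\<mu> n) ?a - cdf (\<mu> n) (-?a) > 55/100"
    by (auto simp: eventually_sequentially)
  show ?thesis
  proof (intro exI[of _ "max K 1"] allI impI)
    fix k assume k: "k \<ge> max K 1"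
    interpret \<mu>k: real_distribution "\<mu> k" by (rule rd)
    let ?S = "\<lambda>z. \<Sum>i\<in>{1..k}. f (z i)"
    let ?E = "{z \<in> space (sample_space k). (?S z)\<^sup>2 < real k}"
    have sum_eq: "(\<Sum>i<k. X i \<omega>) = ?S \<omega>" for \<omega>
      unfolding X_def by (rule sum.reindex_bij_witness[of _ "\<lambda>i. i - 1" Suc]) auto
    have m: "(\<lambda>z. ?S z) \<in> borel_measurable (sample_space k)"
      by (intro borel_measurable_sum measurable_compose[OF _ f] measurable_component_singleton)
    have E: "?E \<in> sets (sample_space k)" using m by measurable
    have "55/100 < cdf (\<mu> k) ?a - cdf (\<mu> k) (-?a)" using K k by simp
    also have "\<dots> = measure (\<mu> k) {-?a<..?a}" by (rule \<mu>k.cdf_diff_eq) simp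
    also have "\<dots> = measure ?\<Omega> ((\<lambda>\<omega>. ?S \<omega> / sqrt k) -` {-?a<..?a} \<inter> space ?\<Omega>)"
      unfolding \<mu>_def sum_eq[symmetric] by (subst measure_distr) (auto simp del: One_nat_def)
    also have "\<dots> \<le> measure ?\<Omega> ((\<lambda>\<omega>. restrict \<omega> {1..k}) -` ?E \<inter> space ?\<Omega>)"
    proof (rule P.finite_measure_mono)
      show "(\<lambda>\<omega>. restrict \<omega> {1..k}) -` ?E \<inter> space ?\<Omega> \<in> sets ?\<Omega>"
        by (rule measurable_sets[OF measurable_restrict_subset E]) simp
      show "(\<lambda>\<omega>. ?S \<omega> / sqrt k) -` {-?a<..?a} \<inter> space ?\<Omega> \<subseteq> (\<lambda>\<omega>. restrict \<omega> {1..k}) -` ?E \<inter> space ?\<Omega>"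
      proof
        fix \<omega> assume \<omega>: "\<omega> \<in> (\<lambda>\<omega>. ?S \<omega> / sqrt k) -` {-?a<..?a} \<inter> space ?\<Omega>"
        have k0: "real k > 0" using k by simp
        have "-?a < ?S \<omega> / sqrt k" "?S \<omega> / sqrt k \<le> ?a" using \<omega> by simp_all
        then have "\<bar>?S \<omega> / sqrt k\<bar> < 1" by linarith
        then have "(?S \<omega> / sqrt k)\<^sup>2 < 1" by (simp add: abs_square_less_1)
        then have "(?S \<omega>)\<^sup>2 < real k" using k0 by (simp add: power_divide)
        moreover have "?S (restrict \<omega> {1..k}) = ?S \<omega>" by (intro sum.cong) auto
        moreover have "restrict \<omega> {1..k} \<in> space (sample_space k)"
          using \<omega> by (auto simp: space_PiM)
        ultimately show "\<omega> \<in> (\<lambda>\<omega>. restrict \<omega> {1..k}) -` ?E \<inter> space ?\<Omega>" using \<omega> by simp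
      qed
    qed
    also have "\<dots> = measure (distr ?\<Omega> (sample_space k) (\<lambda>\<omega>. restrict \<omega> {1..k})) ?E"
      by (rule measure_distr[symmetric, OF measurable_restrict_subset E]) simp
    also have "distr ?\<Omega> (sample_space k) (\<lambda>\<omega>. restrict \<omega> {1..k}) = sample_space k"
      by (rule P.distr_PiM_restrict_finite) auto
    finally show "55/100 \<le> measure (sample_space k)
     {z \<in> space (sample_space k). (\<Sum>i\<in>{1..k}. if z i \<in> A then 1 else -1 :: real)\<^sup>2 < real k}"
      unfolding f_def by simp
  qed
qed

end

section \<open>The bipartite graphon\<close>

lemma real_choose_two: "real (k choose 2) = real k * (real k - 1) / 2"
proof -
  have "even (k * (k - 1))" by auto
  then have "real (k choose 2) = real (k * (k - 1)) / 2"
    by (simp add: choose_two real_of_nat_div)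
  then show ?thesis by (cases k) (simp_all add: field_simps)
qed

context prob_space
begin

definition bipartite :: "'a set \<Rightarrow> 'a \<Rightarrow> 'a \<Rightarrow> real" where
  "bipartite A x y = of_bool ((x \<in> A) \<noteq> (y \<in> A))"

lemma graphon_bipartite:
  assumes "A \<in> sets M"
  shows "graphon M (bipartite A)"
proof -
  have [measurable]: "A \<in> sets M" by fact
  have "(\<lambda>p. of_bool ((fst p \<in> A) \<noteq> (snd p \<in> A)) :: real) \<in> borel_measurable (M \<Otimes>\<^sub>M M)"
    by measurable
  then show ?thesis
    unfolding graphon_def kernel_def bipartite_def case_prod_unfold
    by (auto intro!: exI[of _ 1])
qed

lemma kernel_bipartite: "A \<in> sets M \<Longrightarrow> kernel M (bipartite A)"
  using graphon_bipartite by (simp add: graphon_def)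

lemma integral_bipartite:
  assumes A: "A \<in> sets M" "prob A = 1/2"
  shows "(\<integral>(x, y). bipartite A x y \<partial>(M \<Otimes>\<^sub>M M)) = 1/2"
proof -
  interpret MM: prob_space "M \<Otimes>\<^sub>M M" by (rule prob_space_pair)
  have sq: "measure (M \<Otimes>\<^sub>M M) (S \<times> T) = prob S * prob T" if "S \<in> sets M" "T \<in> sets M" for S T
    using that by (simp add: measure_def emeasure_pair_measure_Times enn2real_mult)
  have c: "prob (space M - A) = 1/2" using A by (simp add: prob_compl)
  have "(\<integral>(x, y). bipartite A x y \<partial>(M \<Otimes>\<^sub>M M))
      = (\<integral>p. indicator (A \<times> (space M - A)) p + indicator ((space M - A) \<times> A) p \<partial>(M \<Otimes>\<^sub>M M))"
    by (intro Bochner_Integration.integral_cong) (auto simp: bipartite_def indicator_def space_pair_measure)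
  also have "\<dots> = measure (M \<Otimes>\<^sub>M M) (A \<times> (space M - A)) + measure (M \<Otimes>\<^sub>M M) ((space M - A) \<times> A)"
    using A(1) by (subst Bochner_Integration.integral_add) (auto simp: MM.emeasure_eq_measure)
  also have "\<dots> = prob A * prob (space M - A) + prob (space M - A) * prob A" using A(1) by (simp add: sq)
  also have "\<dots> = 1/2" unfolding A(2) c by simp
  finally show ?thesis .
qed

definition cut_graph :: "'a set \<Rightarrow> nat \<Rightarrow> (nat \<Rightarrow> 'a) \<Rightarrow> nat set set" where
  "cut_graph A k z = {e \<in> complete_on k. (z (Min e) \<in> A) \<noteq> (z (Max e) \<in> A)}"

lemma cut_graph_in_graphs: "cut_graph A k z \<in> graphs k"
  by (auto simp: cut_graph_def graphs_def)

lemma induced_weight_bipartite: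
  assumes "F \<in> graphs k"
  shows "induced_weight k F (bipartite A) z = of_bool (F = cut_graph A k z)"
proof -
  have "induced_weight k F (bipartite A) z = sample_weight (complete_on k) F (\<lambda>e. of_bool (e \<in> cut_graph A k z))"
    unfolding sample_weight_def by (intro prod.cong) (auto simp: edge_value_def bipartite_def cut_graph_def)
  also have "\<dots> = of_bool (F = cut_graph A k z)"
    using assms cut_graph_in_graphs[of A k z] by (intro sample_weight_of_bool finite_complete_on) (auto simp: graphs_def)
  finally show ?thesis .
qed

text \<open>With signs s i = 1 or -1, twice the indicator that a and b are separated is 1 - s a s b,
  and this vanishes for a = b. Summing over all ordered pairs gives the identity, by which the cut
  graph has more than half of all edges exactly if the squared sum of signs is below k.\<close>

lemma card_cut_graph:
  "4 * real (card (cut_graph A k z)) = (real k)\<^sup>2 - (\<Sum>i\<in>{1..k}. if z i \<in> A then 1 else -1 :: real)\<^sup>2"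
proof -
  define s :: "nat \<Rightarrow> real" where "s i = (if z i \<in> A then 1 else -1)" for i
  have mem: "{a, b} \<in> cut_graph A k z \<longleftrightarrow> (z a \<in> A) \<noteq> (z b \<in> A)" if "a \<in> {1..k}" "b \<in> {1..k} - {a}" for a b
    using that doubleton_in_complete_on[OF that] by (cases a b rule: linorder_cases) (auto simp: cut_graph_def)
  have "2 * (2 * real (card (cut_graph A k z)))
      = 2 * (\<Sum>a\<in>{1..k}. \<Sum>b\<in>{1..k} - {a}. of_bool ({a, b} \<in> cut_graph A k z))"
    by (subst sum_ordered_pairs_of_bool) (auto simp: cut_graph_def)
  also have "\<dots> = (\<Sum>a\<in>{1..k}. \<Sum>b\<in>{1..k} - {a}. 1 - s a * s b)"
    unfolding sum_distrib_left by (intro sum.cong refl, subst mem) (auto simp: s_def)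
  also have "\<dots> = (\<Sum>a\<in>{1..k}. \<Sum>b\<in>{1..k}. 1 - s a * s b)"
    by (intro sum.cong refl sum.mono_neutral_left) (auto simp: s_def)
  also have "\<dots> = (real k)\<^sup>2 - (\<Sum>i\<in>{1..k}. s i)\<^sup>2"
    by (simp add: sum_subtractf sum_product power2_eq_square)
  finally show ?thesis by (simp add: s_def)
qed

lemma integral_velocity_bipartite:
  assumes A: "A \<in> sets M" "prob A = 1/2"
  shows "\<exists>K. \<forall>k\<ge>K. (\<integral>(x, y). vel k (bipartite A) x y \<partial>(M \<Otimes>\<^sub>M M)) \<ge> (real k)\<^sup>2 / 40"
proof -
  obtain K where K: "\<And>k. k \<ge> K \<Longrightarrow> measure (sample_space k)
     {z \<in> space (sample_space k). (\<Sum>i\<in>{1..k}. if z i \<in> A then 1 else -1 :: real)\<^sup>2 < real k} \<ge> 55/100"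
    using coin_sum_small[OF A] by blast
  show ?thesis
  proof (intro exI[of _ "max K 22"] allI impI)
    fix k assume k: "k \<ge> max K 22"
    interpret Z: prob_space "sample_space k" by (rule prob_space_sample_space)
    have [measurable]: "A \<in> sets M" by (rule A(1))
    let ?S = "\<lambda>z. \<Sum>i\<in>{1..k}. if z i \<in> A then 1 else -1 :: real"
    let ?E = "{z \<in> space (sample_space k). (?S z)\<^sup>2 < real k}"
    let ?N = "real (k choose 2)"
    let ?s = "\<lambda>z. \<Sum>F\<in>graphs k. \<Sum>a\<in>{1..k}. \<Sum>b\<in>{1..k} - {a}. drift k F {a, b} * (1 * induced_weight k F (bipartite A) z)"
    have bm1: "bounded_measurable (M \<Otimes>\<^sub>M M) (\<lambda>(x, y). 1 :: real)"
      by (intro bounded_measurableI[of _ _ 1]) auto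
    note iv = integral_mult_velocity[OF kernel_bipartite[OF A(1)] bm1, of k]
    have m: "?S \<in> borel_measurable (sample_space k)" by measurable
    have E: "?E \<in> sets (sample_space k)" using m by measurable
    \<comment> \<open>Twice the edge count of the cut graph is at most k^2 / 2. Passing the
      threshold yields 2 N minus this amount; otherwise the loss is at most this amount.\<close>
    have lower: "2 * ?N * indicator ?E z - (real k)\<^sup>2 / 2 \<le> ?s z" for z
    proof -
      let ?G = "cut_graph A k z"
      have "?s z = (\<Sum>F\<in>graphs k. if F = ?G then \<Sum>a\<in>{1..k}. \<Sum>b\<in>{1..k} - {a}. drift k ?G {a, b} else 0)"
        by (intro sum.cong refl) (auto simp: induced_weight_bipartite)
      also have "\<dots> = (\<Sum>a\<in>{1..k}. \<Sum>b\<in>{1..k} - {a}. drift k ?G {a, b})"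
        using finite_graphs cut_graph_in_graphs by (subst sum.delta) auto
      finally have s: "?s z = \<dots>" .
      have G: "4 * real (card ?G) = (real k)\<^sup>2 - (?S z)\<^sup>2" by (rule card_cut_graph)
      have G_le: "2 * real (card ?G) \<le> (real k)\<^sup>2 / 2" using G zero_le_power2[of "?S z"] by linarith
      have thr: "1/2 * ?N = ((real k)\<^sup>2 - real k) / 4"
        unfolding real_choose_two by (simp add: power2_eq_square field_simps)
      show ?thesis
      proof (cases "z \<in> ?E")
        case True
        then have "real (card ?G) > 1/2 * ?N" unfolding thr using G by simp
        then show ?thesis
          unfolding s sum_drift[OF cut_graph_in_graphs] using True G_le by simp
      next
        case False
        have "card ?G \<le> k choose 2"
          using card_mono[OF finite_complete_on, of ?G k] by (auto simp: card_complete_on cut_graph_def)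
        then have "real (card ?G) \<le> ?N" by simp
        then show ?thesis
          unfolding s sum_drift[OF cut_graph_in_graphs] using False G_le by auto
      qed
    qed
    have intE: "integrable (sample_space k) (\<lambda>z. 2 * ?N * indicator ?E z - (real k)\<^sup>2 / 2)"
      using E by (intro Bochner_Integration.integrable_diff integrable_mult_right integrable_real_indicator)
        (auto simp: Z.emeasure_eq_measure simp del: One_nat_def)
    have "(real k)\<^sup>2 / 40 \<le> 2 * ?N * (55/100) - (real k)\<^sup>2 / 2"
    proof -
      \<comment> \<open>The left-hand constant comes from k^2 / 20 - (55/100) k \<ge> k^2 / 40,
        which for positive k means k \<ge> 22.\<close>
      have "22 * real k \<le> real k * real k" using k by (intro mult_right_mono) auto
      then show ?thesis unfolding real_choose_two by (simp add: power2_eq_square field_simps)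
    qed
    also have "\<dots> \<le> 2 * ?N * measure (sample_space k) ?E - (real k)\<^sup>2 / 2"
      using K[of k] k by (intro diff_right_mono mult_left_mono) auto
    also have "\<dots> = (\<integral>z. 2 * ?N * indicator ?E z - (real k)\<^sup>2 / 2 \<partial>(sample_space k))"
      using E by (subst Bochner_Integration.integral_diff)
        (auto simp: Z.prob_space Z.emeasure_eq_measure simp del: One_nat_def)
    also have "\<dots> \<le> (\<integral>z. ?s z \<partial>(sample_space k))"
      by (rule integral_mono[OF intE iv(3) lower])
    also have "\<dots> = (\<integral>(x, y). vel k (bipartite A) x y \<partial>(M \<Otimes>\<^sub>M M))"
      using iv(1) by simp
    finally show "(real k)\<^sup>2 / 40 \<le> (\<integral>(x, y). vel k (bipartite A) x y \<partial>(M \<Otimes>\<^sub>M M))" .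
  qed
qed

text \<open>The density is the value at S = T = \<open>space M\<close>. Boundedness of the family
  must be verified, since the supremum is taken in the reals.\<close>

lemma abs_integral_le_cut_dist:
  assumes "kernel M W"
  shows "\<bar>\<integral>(x, y). W x y \<partial>(M \<Otimes>\<^sub>M M)\<bar> \<le> cut_dist M W (\<lambda>_ _. 0)"
proof -
  interpret MM: prob_space "M \<Otimes>\<^sub>M M" by (rule prob_space_pair)
  let ?f = "\<lambda>(x, y). W x y - 0"
  let ?I = "\<lambda>(S, T). \<bar>set_lebesgue_integral (M \<Otimes>\<^sub>M M) (S \<times> T) ?f\<bar>"
  have int: "integrable (M \<Otimes>\<^sub>M M) ?f"
    using MM.integrable_bounded_measurable[OF kernel_bounded_measurable[OF assms]] by simp
  have bdd: "bdd_above (?I ` (sets M \<times> sets M))"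
  proof (rule bdd_aboveI2)
    fix p assume "p \<in> sets M \<times> sets M"
    then obtain S T where p: "p = (S, T)" "S \<in> sets M" "T \<in> sets M" by auto
    then have ST: "S \<times> T \<in> sets (M \<Otimes>\<^sub>M M)" by simp
    have "\<bar>set_lebesgue_integral (M \<Otimes>\<^sub>M M) (S \<times> T) ?f\<bar> \<le> (\<integral>p. \<bar>indicator (S \<times> T) p *\<^sub>R ?f p\<bar> \<partial>(M \<Otimes>\<^sub>M M))"
      unfolding set_lebesgue_integral_def by (rule integral_abs_bound)
    also have "\<dots> \<le> (\<integral>p. \<bar>?f p\<bar> \<partial>(M \<Otimes>\<^sub>M M))"
      using int by (intro integral_mono') (auto simp: indicator_def split: prod.split)
    finally show "?I p \<le> (\<integral>p. \<bar>?f p\<bar> \<partial>(M \<Otimes>\<^sub>M M))" by (simp add: p(1))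
  qed
  have "set_lebesgue_integral (M \<Otimes>\<^sub>M M) (space M \<times> space M) ?f = (\<integral>(x, y). W x y \<partial>(M \<Otimes>\<^sub>M M))"
    unfolding space_pair_measure[symmetric] using set_integral_space[OF int] by simp
  then have "?I (space M, space M) = \<bar>\<integral>(x, y). W x y \<partial>(M \<Otimes>\<^sub>M M)\<bar>" by simp
  moreover have "?I (space M, space M) \<le> (SUP p\<in>sets M \<times> sets M. ?I p)"
    by (intro cSUP_upper bdd) auto
  ultimately show ?thesis unfolding cut_dist_def by simp
qed

text \<open>The zero graphon samples only the empty graph, which has no edge to lose and whose edge
  count is never above the threshold.\<close>

lemma velocity_zero: "vel k (\<lambda>_ _. 0) x y = 0"
  unfolding velocity_extremist
proof (intro sum.neutral ballI)
  fix F a b assume F: "F \<in> graphs k" and "a \<in> {1..k}" "b \<in> {1..k} - {a}"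
  show "drift k F {a, b} * t_ind M k F a b (\<lambda>_ _. 0) x y = 0"
  proof (cases "F = {}")
    case True
    then show ?thesis by (auto simp: drift_def zero_less_iff_neq_zero)
  next
    case False
    then obtain e where "e \<in> F" "e \<in> complete_on k" using F by (auto simp: graphs_def)
    then have "induced_weight k F (\<lambda>_ _. 0) z = 0" for z :: "nat \<Rightarrow> 'a"
      unfolding sample_weight_def by (intro prod_zero finite_complete_on bexI[of _ e]) (auto simp: edge_value_def)
    then show ?thesis unfolding t_ind_eq by simp
  qed
qed

text \<open>The constant zero curve is a trajectory of any graphon that vanishes almost everywhere.
  This shows that the set defining the threshold is nonempty, without which its supremum could not
  be bounded.\<close>

lemma zero_is_dest:
  assumes W: "graphon M W" and "L1_norm M W \<le> 0"
  shows "is_dest M k (extremist_rule k) W (\<lambda>_ _. 0)"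
proof -
  interpret MM: prob_space "M \<Otimes>\<^sub>M M" by (rule prob_space_pair)
  have K: "kernel M W" using W by (simp add: graphon_def)
  have Z: "graphon M (\<lambda>_ _. 0)" by (auto simp: graphon_def kernel_def)
  have bm: "bounded_measurable (M \<Otimes>\<^sub>M M) (\<lambda>(x, y). \<bar>W x y\<bar>)"
    using bounded_measurable_continuous[OF _ kernel_bounded_measurable[OF K], of abs]
    by (simp add: case_prod_unfold continuous_intros)
  have nonneg: "AE p in M \<Otimes>\<^sub>M M. 0 \<le> (case p of (x, y) \<Rightarrow> \<bar>W x y\<bar>)"
    by (intro AE_I2) (auto split: prod.split)
  have "(\<integral>(x, y). \<bar>W x y\<bar> \<partial>(M \<Otimes>\<^sub>M M)) = 0"
    using assms(2) nonneg unfolding L1_norm_def by (intro antisym integral_nonneg_AE)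
  then have "AE p in M \<Otimes>\<^sub>M M. (case p of (x, y) \<Rightarrow> \<bar>W x y\<bar>) = 0"
    using integral_nonneg_eq_0_iff_AE[OF MM.integrable_bounded_measurable[OF bm] nonneg] by simp
  then have 0: "AE (x, y) in M \<Otimes>\<^sub>M M. 0 = W x y" by eventually_elim auto
  have "Linf_norm M (\<lambda>x y. (0 - 0) / (s - t) - vel k (\<lambda>_ _. 0) x y) = 0" for s t :: real
    unfolding Linf_norm_def velocity_zero
    using esssup_const[of "M \<Otimes>\<^sub>M M" "0 :: ereal"] MM.emeasure_space_1
    by (simp add: case_prod_unfold zero_ereal_def[symmetric])
  then have "is_trajectory M k (extremist_rule k) W (\<lambda>_ _ _. 0)"
    using 0 Z unfolding is_trajectory_def graphon_def by simp
  moreover have "((\<lambda>t::real. cut_dist M (\<lambda>_ _. 0) (\<lambda>_ _. 0)) \<longlongrightarrow> 0) at_top"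
  proof -
    have "sets M \<times> sets M \<noteq> {}" using sets.top by blast
    then show ?thesis
      unfolding cut_dist_def by (simp add: set_lebesgue_integral_def case_prod_unfold)
  qed
  ultimately show ?thesis
    unfolding is_dest_def using Z by (intro conjI exI[of _ "\<lambda>_ _ _. 0"]) auto
qed

end

section \<open>The density threshold\<close>

context prob_space
begin

lemma integral_complement:
  assumes "kernel M W"
  shows "(\<integral>(x, y). 1 - W x y \<partial>(M \<Otimes>\<^sub>M M)) = 1 - (\<integral>(x, y). W x y \<partial>(M \<Otimes>\<^sub>M M))"
proof -
  interpret MM: prob_space "M \<Otimes>\<^sub>M M" by (rule prob_space_pair)
  have "integrable (M \<Otimes>\<^sub>M M) (\<lambda>p. W (fst p) (snd p))"
    using MM.integrable_bounded_measurable[OF kernel_bounded_measurable[OF assms]] by (simp add: case_prod_unfold)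
  then show ?thesis by (simp add: case_prod_unfold MM.prob_space)
qed

text \<open>The displacement d has |d| \<le> 1, so the integral of d^2 grows at rate at most 2 k^2.
  The inequality |d| \<le> \<epsilon> / 2 + d^2 / (2 \<epsilon>) then passes from d^2 to |d|, which
  cannot be differentiated directly.\<close>

lemma flow_displacement_L1:
  assumes \<Phi>: "flow k \<Phi>" and \<Phi>01: "\<And>t. t \<ge> 0 \<Longrightarrow> AE (x, y) in M \<Otimes>\<^sub>M M. 0 \<le> \<Phi> t x y \<and> \<Phi> t x y \<le> 1"
    and t: "t \<ge> 0" and \<epsilon>: "\<epsilon> > 0"
  shows "(\<integral>(x, y). \<bar>\<Phi> t x y - \<Phi> 0 x y\<bar> \<partial>(M \<Otimes>\<^sub>M M)) \<le> \<epsilon> / 2 + (real k)\<^sup>2 * t / \<epsilon>"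
proof -
  interpret MM: prob_space "M \<Otimes>\<^sub>M M" by (rule prob_space_pair)
  let ?d = "\<lambda>t x y. \<Phi> t x y - \<Phi> 0 x y"
  let ?g = "\<lambda>t. \<integral>(x, y). (?d t x y)\<^sup>2 \<partial>(M \<Otimes>\<^sub>M M)"
  let ?g' = "\<lambda>t. \<integral>(x, y). 2 * ?d t x y * vel k (\<Phi> t) x y \<partial>(M \<Otimes>\<^sub>M M)"
  have bm: "bounded_measurable (M \<Otimes>\<^sub>M M) (\<lambda>p. (case p of (x, y) \<Rightarrow> \<Phi> t x y) - (case p of (x, y) \<Rightarrow> \<Phi> 0 x y))"
    if "t \<ge> 0" for t
    using that by (intro bounded_measurable_diff kernel_bounded_measurable flow_kernel[OF \<Phi>]) auto
  have bm2: "bounded_measurable (M \<Otimes>\<^sub>M M) (\<lambda>(x, y). (?d t x y)\<^sup>2)"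
    using bounded_measurable_mult[OF bm[OF t] bm[OF t]] by (simp add: case_prod_unfold power2_eq_square)
  have abs: "continuous_on UNIV (abs :: real \<Rightarrow> real)" by (intro continuous_intros)
  have bmabs: "bounded_measurable (M \<Otimes>\<^sub>M M) (\<lambda>(x, y). \<bar>?d t x y\<bar>)"
    using bounded_measurable_continuous[OF abs bm[OF t]] by (simp add: case_prod_unfold)
  \<comment> \<open>The sign is reversed because \<open>increment_ge\<close> bounds increments from
    below.\<close>
  have der: "((\<lambda>s. - ?g s) has_real_derivative - ?g' s) (at s within {0..})" if "0 \<le> s" "s \<le> t" for s
  proof (rule DERIV_minus)
    have "Linf_deriv (M \<Otimes>\<^sub>M M) (\<lambda>_ (x, y). \<Phi> 0 x y) (\<lambda>_. 0) s"
      unfolding Linf_deriv_def by (auto intro!: exI[of _ 1])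
    from Linf_deriv_diff[OF flow_Linf_deriv[OF \<Phi> that(1)] this]
    have 0: "Linf_deriv (M \<Otimes>\<^sub>M M) (\<lambda>s p. (case p of (x, y) \<Rightarrow> \<Phi> s x y) - (case p of (x, y) \<Rightarrow> \<Phi> 0 x y))
        (\<lambda>(x, y). vel k (\<Phi> s) x y) s" by simp
    have 1: "continuous_on UNIV (\<lambda>x::real. x\<^sup>2)" "continuous_on UNIV (\<lambda>x::real. 2 * x)"
      by (intro continuous_intros)+
    show "(?g has_real_derivative ?g' s) (at s within {0..})"
      using MM.has_derivative_integral[OF that(1) 0 bm
          velocity_bounded_measurable[OF flow_kernel[OF \<Phi> that(1)]] 1 square_taylor]
      by (simp add: case_prod_unfold)
  qed
  have "- ?g 0 + (- 2 * (real k)\<^sup>2) * t \<le> - ?g t"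
  proof (rule increment_ge[OF der _ t])
    fix s assume s: "0 \<le> s" "s \<le> t"
    have bmd: "bounded_measurable (M \<Otimes>\<^sub>M M) (\<lambda>(x, y). ?d s x y)"
      using bm[OF s(1)] by (simp add: case_prod_unfold)
    have d1: "AE (x, y) in M \<Otimes>\<^sub>M M. \<bar>?d s x y\<bar> \<le> 1"
      using \<Phi>01[OF s(1)] \<Phi>01[OF order_refl] by eventually_elim auto
    have "\<bar>\<integral>(x, y). ?d s x y * vel k (\<Phi> s) x y \<partial>(M \<Otimes>\<^sub>M M)\<bar> \<le> (real k)\<^sup>2 * 1"
      by (rule abs_integral_mult_velocity_le[OF flow_kernel[OF \<Phi> s(1)] bmd \<Phi>01[OF s(1)] d1]) simp
    moreover have "?g' s = 2 * (\<integral>(x, y). ?d s x y * vel k (\<Phi> s) x y \<partial>(M \<Otimes>\<^sub>M M))"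
      by (simp only: case_prod_unfold mult.assoc integral_mult_right_zero)
    ultimately show "- 2 * (real k)\<^sup>2 \<le> - ?g' s" by linarith
  qed
  then have g: "?g t \<le> 2 * (real k)\<^sup>2 * t" by (simp add: case_prod_unfold)
  have "(\<integral>(x, y). \<bar>?d t x y\<bar> \<partial>(M \<Otimes>\<^sub>M M)) \<le> (\<integral>p. \<epsilon> / 2 + (case p of (x, y) \<Rightarrow> (?d t x y)\<^sup>2) / (2 * \<epsilon>) \<partial>(M \<Otimes>\<^sub>M M))"
  proof (rule integral_mono)
    show "integrable (M \<Otimes>\<^sub>M M) (\<lambda>(x, y). \<bar>?d t x y\<bar>)" by (rule MM.integrable_bounded_measurable[OF bmabs])
    show "integrable (M \<Otimes>\<^sub>M M) (\<lambda>p. \<epsilon> / 2 + (case p of (x, y) \<Rightarrow> (?d t x y)\<^sup>2) / (2 * \<epsilon>))"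
      by (intro Bochner_Integration.integrable_add integrable_divide MM.integrable_bounded_measurable[OF bm2]) simp
    fix p assume "p \<in> space (M \<Otimes>\<^sub>M M)"
    obtain x y where p: "p = (x, y)" by (cases p)
    have "2 * \<epsilon> * \<bar>?d t x y\<bar> \<le> \<epsilon>\<^sup>2 + \<bar>?d t x y\<bar>\<^sup>2" by (rule sum_squares_bound)
    then show "(case p of (x, y) \<Rightarrow> \<bar>?d t x y\<bar>) \<le> \<epsilon> / 2 + (case p of (x, y) \<Rightarrow> (?d t x y)\<^sup>2) / (2 * \<epsilon>)"
      using \<epsilon> unfolding p by (simp add: field_simps power2_eq_square)
  qed
  also have "\<dots> = \<epsilon> / 2 + ?g t / (2 * \<epsilon>)"
    by (subst Bochner_Integration.integral_add)
       (auto simp: MM.prob_space intro!: MM.integrable_bounded_measurable[OF bm2])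
  also have "\<dots> \<le> \<epsilon> / 2 + 2 * (real k)\<^sup>2 * t / (2 * \<epsilon>)"
    using g \<epsilon> by (intro add_left_mono divide_right_mono) auto
  finally show ?thesis by simp
qed

text \<open>While the curve stays within L^1 distance 1 / (80 k^2) of the bipartite graphon, the
  Lipschitz bound costs at most half of the initial rate k^2 / 40, so the density grows at rate at
  least k^2 / 80.\<close>

lemma flow_density_increases:
  assumes A: "A \<in> sets M" and k: "k > 0"
    and vA: "(\<integral>(x, y). vel k (bipartite A) x y \<partial>(M \<Otimes>\<^sub>M M)) \<ge> (real k)\<^sup>2 / 40"
    and \<Phi>: "flow k \<Phi>" and \<Phi>01: "\<And>t. t \<ge> 0 \<Longrightarrow> AE (x, y) in M \<Otimes>\<^sub>M M. 0 \<le> \<Phi> t x y \<and> \<Phi> t x y \<le> 1"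
    and init: "AE (x, y) in M \<Otimes>\<^sub>M M. \<Phi> 0 x y = (1 - 2 * \<delta>) * bipartite A x y"
    and \<delta>: "0 < \<delta>" "2 * \<delta> \<le> 1 / (2048000 * (real k) ^ 4)"
  shows "\<exists>T\<ge>0. (\<integral>(x, y). \<Phi> 0 x y \<partial>(M \<Otimes>\<^sub>M M)) + 2 * \<delta> \<le> (\<integral>(x, y). \<Phi> T x y \<partial>(M \<Otimes>\<^sub>M M))"
proof -
  interpret MM: prob_space "M \<Otimes>\<^sub>M M" by (rule prob_space_pair)
  \<comment> \<open>The distance budget 1 / (80 k^2) is split into \<epsilon> / 2 = 1 / (160 k^2),
    k^2 T / \<epsilon> = 1 / (320 k^2) and 2 \<delta> \<le> 1 / (320 k^2). The density gained by
    time T is (k^2 / 80) T = 1 / (2048000 k^4), the bound assumed for 2 \<delta>.\<close>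
  define T where "T = 1 / (25600 * (real k) ^ 6)"
  define \<epsilon> where "\<epsilon> = 1 / (80 * (real k)\<^sup>2)"
  have k1: "real k \<ge> 1" using k by simp
  have T: "T \<ge> 0" and \<epsilon>: "\<epsilon> > 0" using k by (simp_all add: T_def \<epsilon>_def)
  have K: "kernel M (bipartite A)" by (rule kernel_bipartite[OF A])
  have b01: "AE (x, y) in M \<Otimes>\<^sub>M M. 0 \<le> bipartite A x y \<and> bipartite A x y \<le> 1"
    by (intro AE_I2) (auto simp: bipartite_def)
  have int: "integrable (M \<Otimes>\<^sub>M M) (\<lambda>(x, y). \<bar>U x y - W x y\<bar>)" if "kernel M U" "kernel M W" for U W
  proof -
    have abs: "continuous_on UNIV (abs :: real \<Rightarrow> real)" by (intro continuous_intros)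
    show ?thesis
      using MM.integrable_bounded_measurable[OF bounded_measurable_continuous[OF abs
          bounded_measurable_diff[OF kernel_bounded_measurable[OF that(1)] kernel_bounded_measurable[OF that(2)]]]]
      by (simp add: case_prod_unfold)
  qed
  have vel_ge: "(real k)\<^sup>2 / 80 \<le> (\<integral>(x, y). 1 * vel k (\<Phi> t) x y \<partial>(M \<Otimes>\<^sub>M M))" if t: "0 \<le> t" "t \<le> T" for t
  proof -
    note Kt = flow_kernel[OF \<Phi> t(1)] and K0 = flow_kernel[OF \<Phi> order_refl]
    have "(\<integral>(x, y). \<bar>\<Phi> 0 x y - bipartite A x y\<bar> \<partial>(M \<Otimes>\<^sub>M M)) \<le> 2 * \<delta>"
    proof -
      have "AE p in M \<Otimes>\<^sub>M M. \<bar>case p of (x, y) \<Rightarrow> \<bar>\<Phi> 0 x y - bipartite A x y\<bar>\<bar> \<le> 2 * \<delta>"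
        using init by eventually_elim (use \<delta>(1) in \<open>auto simp: bipartite_def\<close>)
      from MM.abs_integral_le_const[OF _ this] int[OF K0 K] show ?thesis by auto
    qed
    moreover have "(\<integral>(x, y). \<bar>\<Phi> t x y - bipartite A x y\<bar> \<partial>(M \<Otimes>\<^sub>M M))
        \<le> (\<integral>(x, y). \<bar>\<Phi> t x y - \<Phi> 0 x y\<bar> \<partial>(M \<Otimes>\<^sub>M M)) + (\<integral>(x, y). \<bar>\<Phi> 0 x y - bipartite A x y\<bar> \<partial>(M \<Otimes>\<^sub>M M))"
      unfolding Bochner_Integration.integral_add[OF int[OF Kt K0] int[OF K0 K], symmetric]
      by (intro integral_mono Bochner_Integration.integrable_add int Kt K0 K) auto
    moreover have "(\<integral>(x, y). \<bar>\<Phi> t x y - \<Phi> 0 x y\<bar> \<partial>(M \<Otimes>\<^sub>M M)) \<le> \<epsilon> / 2 + (real k)\<^sup>2 * t / \<epsilon>"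
      by (rule flow_displacement_L1[OF \<Phi> \<Phi>01 t(1) \<epsilon>])
    moreover have "(real k)\<^sup>2 * t / \<epsilon> \<le> 1 / (320 * (real k)\<^sup>2)"
    proof -
      have "(real k)\<^sup>2 * t / \<epsilon> \<le> (real k)\<^sup>2 * T / \<epsilon>"
        using t \<epsilon> by (intro divide_right_mono mult_left_mono) auto
      also have "\<dots> = 1 / (320 * (real k)\<^sup>2)"
        using k by (simp add: T_def \<epsilon>_def field_simps power_numeral_reduce)
      finally show ?thesis .
    qed
    moreover have "2 * \<delta> \<le> 1 / (320 * (real k)\<^sup>2)"
    proof -
      have "(real k)\<^sup>2 \<le> (real k) ^ 4" using k1 by (intro power_increasing) auto
      then have "320 * (real k)\<^sup>2 \<le> 2048000 * (real k) ^ 4" by (intro mult_mono) auto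
      then have "1 / (2048000 * (real k) ^ 4) \<le> 1 / (320 * (real k)\<^sup>2)"
        using k by (intro divide_left_mono) auto
      then show ?thesis using \<delta>(2) by linarith
    qed
    moreover have "\<epsilon> / 2 = 1 / (160 * (real k)\<^sup>2)" by (simp add: \<epsilon>_def)
    moreover have "1 / (160 * (real k)\<^sup>2) + 1 / (320 * (real k)\<^sup>2) + 1 / (320 * (real k)\<^sup>2) = 1 / (80 * (real k)\<^sup>2)"
      using k by (simp add: field_simps)
    ultimately have close: "(\<integral>(x, y). \<bar>\<Phi> t x y - bipartite A x y\<bar> \<partial>(M \<Otimes>\<^sub>M M)) \<le> 1 / (80 * (real k)\<^sup>2)"
      by linarith
    have N: "real (k choose 2) \<le> (real k)\<^sup>2 / 2"
      unfolding real_choose_two by (simp add: power2_eq_square field_simps)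
    have "2 * (real k)\<^sup>2 * real (k choose 2) * (\<integral>(x, y). \<bar>\<Phi> t x y - bipartite A x y\<bar> \<partial>(M \<Otimes>\<^sub>M M))
        \<le> 2 * (real k)\<^sup>2 * ((real k)\<^sup>2 / 2) * (1 / (80 * (real k)\<^sup>2))"
      using N close by (intro mult_mono) (auto intro!: Bochner_Integration.integral_nonneg split: prod.split)
    also have "\<dots> = (real k)\<^sup>2 / 80" using k by (simp add: field_simps power2_eq_square)
    finally have "\<bar>(\<integral>(x, y). vel k (\<Phi> t) x y \<partial>(M \<Otimes>\<^sub>M M)) - (\<integral>(x, y). vel k (bipartite A) x y \<partial>(M \<Otimes>\<^sub>M M))\<bar> \<le> (real k)\<^sup>2 / 80"
      using integral_velocity_Lipschitz[OF Kt K \<Phi>01[OF t(1)] b01, of k] by linarith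
    then show ?thesis unfolding mult_1 using vA by linarith
  qed
  have "(\<integral>(x, y). \<Phi> 0 x y \<partial>(M \<Otimes>\<^sub>M M)) + (real k)\<^sup>2 / 80 * T \<le> (\<integral>(x, y). \<Phi> T x y \<partial>(M \<Otimes>\<^sub>M M))"
  proof (rule increment_ge[OF _ vel_ge T])
    fix t :: real assume "0 \<le> t" "t \<le> T"
    then show "((\<lambda>t. \<integral>(x, y). \<Phi> t x y \<partial>(M \<Otimes>\<^sub>M M)) has_real_derivative
        (\<integral>(x, y). 1 * vel k (\<Phi> t) x y \<partial>(M \<Otimes>\<^sub>M M))) (at t within {0..})"
      by (intro flow_integral_deriv[OF \<Phi>, where G = "\<lambda>x. x" and G' = "\<lambda>_. 1" and K = 0]) (auto intro!: continuous_intros)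
  qed
  moreover have "2 * \<delta> \<le> (real k)\<^sup>2 / 80 * T"
  proof -
    have "(real k)\<^sup>2 / 80 * T = 1 / (2048000 * (real k) ^ 4)"
      using k by (simp add: T_def field_simps power_numeral_reduce)
    then show ?thesis using \<delta>(2) by simp
  qed
  ultimately show ?thesis using T by (intro exI[of _ T]) auto
qed

lemma threshold_element_le:
  assumes A: "A \<in> sets M" "prob A = 1/2" and k: "k > 0"
    and vA: "(\<integral>(x, y). vel k (bipartite A) x y \<partial>(M \<Otimes>\<^sub>M M)) \<ge> (real k)\<^sup>2 / 40"
    and \<delta>: "0 < \<delta>" "2 * \<delta> \<le> 1 / (2048000 * (real k) ^ 4)"
    and dest: "\<And>W. graphon M W \<Longrightarrow> L1_norm M W \<le> p \<Longrightarrow> is_dest M k (extremist_rule k) W (\<lambda>_ _. 0)"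
  shows "p \<le> 1/2 - \<delta>"
proof (rule ccontr)
  assume "\<not> p \<le> 1/2 - \<delta>"
  then have p: "1/2 - \<delta> \<le> p" by simp
  interpret MM: prob_space "M \<Otimes>\<^sub>M M" by (rule prob_space_pair)
  let ?m = "\<lambda>W. \<integral>(x, y). W x y \<partial>(M \<Otimes>\<^sub>M M)"
  have L1: "L1_norm M W = ?m W" if "graphon M W" for W
    unfolding L1_norm_def using that
    by (intro Bochner_Integration.integral_cong) (auto simp: graphon_def space_pair_measure)
  have m_cong: "?m U = ?m W" if "kernel M U" "kernel M W" "AE (x, y) in M \<Otimes>\<^sub>M M. U x y = W x y" for U W
  proof (rule integral_cong_AE)
    show "AE q in M \<Otimes>\<^sub>M M. (case q of (x, y) \<Rightarrow> U x y) = (case q of (x, y) \<Rightarrow> W x y)"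
      using that(3) by eventually_elim auto
  qed (use that kernel_measurable in auto)
  \<comment> \<open>All trajectories come from \<open>dest\<close>. Convergence in cut distance is
    used only through the density.\<close>
  have flow_to_zero: "\<exists>\<Phi>. flow k \<Phi> \<and> (AE (x, y) in M \<Otimes>\<^sub>M M. \<Phi> 0 x y = W x y)
      \<and> (\<forall>t\<ge>0. AE (x, y) in M \<Otimes>\<^sub>M M. 0 \<le> \<Phi> t x y \<and> \<Phi> t x y \<le> 1) \<and> ((\<lambda>t. ?m (\<Phi> t)) \<longlongrightarrow> 0) at_top"
    if W: "graphon M W" "?m W \<le> p" for W
  proof -
    obtain \<Phi> where tr: "is_trajectory M k (extremist_rule k) W \<Phi>" and cut: "((\<lambda>t. cut_dist M (\<Phi> t) (\<lambda>_ _. 0)) \<longlongrightarrow> 0) at_top"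
      using dest[OF W(1)] W L1 unfolding is_dest_def by auto
    have fl: "flow k \<Phi>" by (rule flow_of_trajectory[OF tr])
    have init: "AE (x, y) in M \<Otimes>\<^sub>M M. \<Phi> 0 x y = W x y" using tr by (simp add: is_trajectory_def)
    have W01: "AE (x, y) in M \<Otimes>\<^sub>M M. 0 \<le> W x y \<and> W x y \<le> 1"
      using W(1) by (intro AE_I2) (auto simp: graphon_def space_pair_measure)
    have "AE (x, y) in M \<Otimes>\<^sub>M M. 0 \<le> \<Phi> 0 x y \<and> \<Phi> 0 x y \<le> 1"
      using init W01 by eventually_elim auto
    then have "\<forall>t\<ge>0. AE (x, y) in M \<Otimes>\<^sub>M M. 0 \<le> \<Phi> t x y \<and> \<Phi> t x y \<le> 1"
      using flow_stays_in_unit_interval[OF fl] by blast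
    moreover have "((\<lambda>t. ?m (\<Phi> t)) \<longlongrightarrow> 0) at_top"
    proof (rule Lim_null_comparison[OF _ cut])
      show "eventually (\<lambda>t. norm (?m (\<Phi> t)) \<le> cut_dist M (\<Phi> t) (\<lambda>_ _. 0)) at_top"
        using eventually_ge_at_top[of "0::real"]
      proof eventually_elim
        case (elim t)
        then show ?case using abs_integral_le_cut_dist[OF flow_kernel[OF fl elim]] by simp
      qed
    qed
    ultimately show ?thesis using fl init by blast
  qed

  have "(real k) ^ 4 \<ge> 1" using k by (intro one_le_power) auto
  then have "1 / (2048000 * (real k) ^ 4) \<le> 1" by (simp add: divide_le_eq)
  then have \<delta>1: "2 * \<delta> \<le> 1" using \<delta>(2) by linarith
  let ?W = "\<lambda>x y. (1 - 2 * \<delta>) * bipartite A x y"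
  have "continuous_on UNIV (\<lambda>x::real. (1 - 2 * \<delta>) * x)" by (intro continuous_intros)
  from kernel_comp[OF kernel_bipartite[OF A(1)] this] have "kernel M ?W" .
  then have W: "graphon M ?W" unfolding graphon_def using \<delta> \<delta>1 by (auto simp: bipartite_def)
  have mW: "?m ?W = 1/2 - \<delta>"
  proof -
    have "?m ?W = (1 - 2 * \<delta>) * ?m (bipartite A)"
      by (simp only: case_prod_unfold integral_mult_right_zero)
    then show ?thesis by (simp add: integral_bipartite[OF A])
  qed
  obtain \<Phi> where \<Phi>: "flow k \<Phi>" and \<Phi>0: "AE (x, y) in M \<Otimes>\<^sub>M M. \<Phi> 0 x y = ?W x y"
    and \<Phi>01: "\<forall>t\<ge>0. AE (x, y) in M \<Otimes>\<^sub>M M. 0 \<le> \<Phi> t x y \<and> \<Phi> t x y \<le> 1"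
    and \<Phi>lim: "((\<lambda>t. ?m (\<Phi> t)) \<longlongrightarrow> 0) at_top"
    using flow_to_zero[OF W] mW p by auto
  have m0: "?m (\<Phi> 0) = 1/2 - \<delta>"
    using m_cong[OF flow_kernel[OF \<Phi>] _ \<Phi>0] W mW by (simp add: graphon_def)
  obtain T where T: "T \<ge> 0" and mT: "1/2 + \<delta> \<le> ?m (\<Phi> T)"
    using flow_density_increases[OF A(1) k vA \<Phi> _ \<Phi>0 \<delta>] \<Phi>01 m0 by auto

  \<comment> \<open>\<Phi> T is [0,1]-valued only almost everywhere, so it is clamped before
    complementing to obtain a graphon to which \<open>dest\<close> applies.\<close>
  let ?V = "\<lambda>x y. 1 - clamp01 (\<Phi> T x y)"
  have KT: "kernel M (\<Phi> T)" by (rule flow_kernel[OF \<Phi> T])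
  have gc: "graphon M (\<lambda>x y. clamp01 (\<Phi> T x y))" by (rule graphon_clamp01[OF KT])
  then have Kc: "kernel M (\<lambda>x y. clamp01 (\<Phi> T x y))" by (simp add: graphon_def)
  have "continuous_on UNIV (\<lambda>x::real. 1 - x)" by (intro continuous_intros)
  from kernel_comp[OF Kc this] have "kernel M ?V" .
  then have V: "graphon M ?V" unfolding graphon_def using clamp01_bounds by simp
  have clampT: "AE (x, y) in M \<Otimes>\<^sub>M M. clamp01 (\<Phi> T x y) = \<Phi> T x y"
    using \<Phi>01[rule_format, OF T] by eventually_elim (auto simp: clamp01_def)
  have "?m ?V = 1 - ?m (\<Phi> T)"
    using integral_complement[OF Kc] m_cong[OF Kc KT clampT] by simp
  then have "?m ?V \<le> p" using mT p by simp
  then obtain \<Psi> where \<Psi>: "flow k \<Psi>" and \<Psi>0: "AE (x, y) in M \<Otimes>\<^sub>M M. \<Psi> 0 x y = ?V x y"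
    and \<Psi>01: "\<forall>t\<ge>0. AE (x, y) in M \<Otimes>\<^sub>M M. 0 \<le> \<Psi> t x y \<and> \<Psi> t x y \<le> 1"
    and \<Psi>lim: "((\<lambda>t. ?m (\<Psi> t)) \<longlongrightarrow> 0) at_top"
    using flow_to_zero[OF V] by auto
  \<comment> \<open>From time T on, \<Phi> and the complement of \<Psi> are flows with the same
    initial value. The density of \<Phi> would therefore tend both to 0 and to 1.\<close>
  have eq: "AE (x, y) in M \<Otimes>\<^sub>M M. \<Phi> (T + s) x y = 1 - \<Psi> s x y" if s: "s \<ge> 0" for s
  proof (rule flow_unique[OF flow_shift[OF \<Phi> T] flow_complement[OF \<Psi>] _ _ _ s])
    show "AE (x, y) in M \<Otimes>\<^sub>M M. 0 \<le> \<Phi> (T + t) x y \<and> \<Phi> (T + t) x y \<le> 1" if "t \<ge> 0" for t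
      using \<Phi>01 T that by simp
    show "AE (x, y) in M \<Otimes>\<^sub>M M. 0 \<le> 1 - \<Psi> t x y \<and> 1 - \<Psi> t x y \<le> 1" if "t \<ge> 0" for t
      using \<Psi>01[rule_format, OF that] by eventually_elim auto
    show "AE (x, y) in M \<Otimes>\<^sub>M M. \<Phi> (T + 0) x y = 1 - \<Psi> 0 x y"
      using \<Psi>0 clampT by eventually_elim auto
  qed
  have "eventually (\<lambda>s. 1 - ?m (\<Psi> s) = ?m (\<Phi> (T + s))) at_top"
    using eventually_ge_at_top[of "0::real"]
  proof eventually_elim
    case (elim s)
    have "?m (\<Phi> (T + s)) = ?m (\<lambda>x y. 1 - \<Psi> s x y)"
      using elim T by (intro m_cong[OF _ _ eq[OF elim]] flow_kernel[OF \<Phi>] flow_kernel[OF flow_complement[OF \<Psi>]]) auto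
    then show ?case using integral_complement[OF flow_kernel[OF \<Psi> elim]] by simp
  qed
  moreover have "((\<lambda>s. 1 - ?m (\<Psi> s)) \<longlongrightarrow> 1 - 0) at_top"
    by (intro tendsto_diff tendsto_const \<Psi>lim)
  ultimately have "((\<lambda>s. ?m (\<Phi> (T + s))) \<longlongrightarrow> 1) at_top"
    by (simp add: tendsto_cong)
  moreover have "((\<lambda>s. ?m (\<Phi> (T + s))) \<longlongrightarrow> 0) at_top"
    by (rule filterlim_compose[OF \<Phi>lim filterlim_tendsto_add_at_top[OF tendsto_const filterlim_ident]])
  ultimately have "(1::real) = 0"
    by (rule tendsto_unique[rotated]) simp
  then show False by simp
qed

end

text \<open>The gap equals 1 / (2 10^5 f P) with f = \<open>falling2 k\<close> \<ge> 1 and P the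
  power of two. From k \<ge> 22 follows \<open>k choose 2\<close> \<ge> 5 k + 1, so P \<ge> 2^(5 k)
  \<ge> k^5 \<ge> 22 k^4, and 22 times 10^5 exceeds 2048000.\<close>

lemma gap_small:
  assumes "k \<ge> 22"
  shows "0 < falling2 k / (2 * 10^5 * ((falling2 k)\<^sup>2 * 2 powi (int (k choose 2) - 1)))"
    and "2 * (falling2 k / (2 * 10^5 * ((falling2 k)\<^sup>2 * 2 powi (int (k choose 2) - 1)))) \<le> 1 / (2048000 * (real k) ^ 4)"
proof -
  have f1: "falling2 k \<ge> 1"
  proof -
    have "1 * 1 \<le> real k * (real k - 1)" using assms by (intro mult_mono) auto
    then show ?thesis by (simp add: falling2_def)
  qed
  have "22 \<le> real k" using assms by simp
  moreover from this have "22 * real k \<le> real k * real k" by (intro mult_right_mono) auto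
  ultimately have "2 * (5 * real k + 1) \<le> real k * real k - real k" by argo
  then have "real (5 * k + 1) \<le> real (k choose 2)"
    unfolding real_choose_two using assms by (simp add: right_diff_distrib)
  then have N: "5 * k + 1 \<le> k choose 2" by linarith
  define P :: real where "P = 2 powi (int (k choose 2) - 1)"
  \<comment> \<open>The exponent is nonnegative because \<open>k choose 2\<close> is positive, so
    the integer power is a natural one.\<close>
  have "P = 2 ^ ((k choose 2) - 1)"
    unfolding P_def using N assms by (subst power_int_def) (simp add: nat_diff_distrib)
  also have "\<dots> \<ge> 2 ^ (5 * k)" using N by (intro power_increasing) auto
  also have "(2::real) ^ (5 * k) = (2 ^ k) ^ 5" by (simp add: power_mult[symmetric] mult.commute)
  also have "\<dots> \<ge> real k ^ 5" using of_nat_less_two_power[of k] by (intro power_mono) (auto simp: less_imp_le)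
  also have "real k ^ 5 = real k * real k ^ 4" by (simp add: power_numeral_reduce)
  also have "\<dots> \<ge> 22 * real k ^ 4" using assms by (intro mult_right_mono) auto
  finally have P: "22 * real k ^ 4 \<le> P" by simp
  have k4: "real k ^ 4 > 0" using assms by simp
  have P0: "P > 0" using P k4 by linarith
  have eq: "falling2 k / (2 * 10^5 * ((falling2 k)\<^sup>2 * P)) = 1 / (2 * 10^5 * (falling2 k * P))"
    using f1 P0 by (simp add: power2_eq_square)
  show "0 < falling2 k / (2 * 10^5 * ((falling2 k)\<^sup>2 * 2 powi (int (k choose 2) - 1)))"
    using f1 P0 unfolding P_def[symmetric] eq by simp
  have "1 * P \<le> falling2 k * P" using f1 P0 by (intro mult_right_mono) auto
  then have "2048000 * real k ^ 4 \<le> 100000 * (falling2 k * P)" using P k4 by linarith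
  then have "2048000 * real k ^ 4 \<le> 10^5 * (falling2 k * P)" by simp
  then have "1 / (10^5 * (falling2 k * P)) \<le> 1 / (2048000 * real k ^ 4)"
    using k4 P0 f1 by (intro divide_left_mono) (auto intro!: mult_pos_pos)
  then show "2 * (falling2 k / (2 * 10^5 * ((falling2 k)\<^sup>2 * 2 powi (int (k choose 2) - 1)))) \<le> 1 / (2048000 * (real k) ^ 4)"
    unfolding P_def[symmetric] eq by (simp add: mult.commute)
qed

theorem theorem7p6:
  fixes M :: "'a measure"
  assumes "prob_space M" and "atomless M" and "separable_sigma_algebra M"
  shows "\<exists>K::nat. \<forall>k\<ge>K.
           (let C = (falling2 k)\<^sup>2 * 2 powi (int (k choose 2) - 1)
            in density_threshold M k \<le> 1/2 - falling2 k / (2 * 10^5 * C))"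
proof -
  interpret prob_space M by fact
  obtain A where A: "A \<in> sets M" "prob A = 1/2"
    using atomless_intermediate_value[OF assms(2), of "1/2"] by (auto simp: prob_space)
  obtain K where K: "\<And>k. k \<ge> K \<Longrightarrow> (\<integral>(x, y). vel k (bipartite A) x y \<partial>(M \<Otimes>\<^sub>M M)) \<ge> (real k)\<^sup>2 / 40"
    using integral_velocity_bipartite[OF A] by blast
  show ?thesis
    unfolding Let_def
  proof (intro exI[of _ "max K 22"] allI impI)
    fix k assume k: "max K 22 \<le> k"
    let ?\<delta> = "falling2 k / (2 * 10^5 * ((falling2 k)\<^sup>2 * 2 powi (int (k choose 2) - 1)))"
    let ?P = "{p. 0 \<le> p \<and> p \<le> 1 \<and>
      (\<forall>W. graphon M W \<and> L1_norm M W \<le> p \<longrightarrow> is_dest M k (extremist_rule k) W (\<lambda>_ _. 0))}"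
    have "0 \<in> ?P" using zero_is_dest by simp
    then have "?P \<noteq> {}" by blast
    moreover have "p \<le> 1/2 - ?\<delta>" if "p \<in> ?P" for p
      using that k K gap_small[of k] by (intro threshold_element_le[OF A]) auto
    ultimately show "density_threshold M k \<le> 1/2 - ?\<delta>"
      unfolding density_threshold_def by (rule cSup_least)
  qed
qed

end
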